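(* Let $W$ be a vector space with $\dim W\geq 7$. The ideal of the secant variety of the Grassmannian of $3$-planes in its Plücker embedding, $\sigma(G(3,W^* ))\subset \mathbb P \Lambda^3 W^*$, is generated in degree three by the $SL(W)$-module of highest weight $2\omega_1+\omega_7$ occurring in $S^3(\Lambda^3 W)$, i.e., by $S_{3,1^6}W=S_{3111111}W\subset S^3(\Lambda^3 W)$.
   Context: $K$ is an algebraically closed field of characteristic zero, $W=K^n$. The ideal of a subvariety of $\mathbb P\Lambda^3W^*$ lives in $\mathrm{Sym}(\Lambda^3W)=\bigoplus_d S^d(\Lambda^3W)$. $S_\pi W$ denotes the irreducible $GL(W)$-module (Schur module) associated to the partition $\pi$, and $\omega_i$ are the fundamental weights of $SL(W)$; the partition $(3,1^6)$ corresponds to the weight $2\omega_1+\omega_7$. $\sigma(\cdot)$ denotes the secant variety (Zariski closure of the union of secant lines). *)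

theory Defs
  imports Main "HOL-Library.Poly_Mapping" "HOL-Computational_Algebra.Polynomial"
begin

definition alg_closed :: "'a::field itself \<Rightarrow> bool" where
  "alg_closed _ \<longleftrightarrow> (\<forall>p :: 'a poly. Polynomial.degree p > 0 \<longrightarrow> (\<exists>x. poly p x = 0))"

text \<open>W = K^n with basis e_0..e_(n-1). Variables of Sym(Lambda^3 W) are the basis vectors
  e_i wedge e_j wedge e_k of Lambda^3 W, indexed by triples (i,j,k) with i<j<k<n.
  Polynomials: poly_mappings from monomials (finite multisets of variables) to coefficients.\<close>
type_synonym var3 = "nat \<times> nat \<times> nat"
type_synonym 'a mpoly3 = "(var3 \<Rightarrow>\<^sub>0 nat) \<Rightarrow>\<^sub>0 'a"

definition valid_var :: "nat \<Rightarrow> var3 \<Rightarrow> bool" where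
  "valid_var n v \<longleftrightarrow> (case v of (i,j,k) \<Rightarrow> i < j \<and> j < k \<and> k < n)"

definition polyring :: "nat \<Rightarrow> 'a::comm_ring_1 mpoly3 set" where
  "polyring n = {p. \<forall>m \<in> Poly_Mapping.keys p. \<forall>v \<in> Poly_Mapping.keys m. valid_var n v}"

definition Var3 :: "var3 \<Rightarrow> 'a::comm_ring_1 mpoly3" where
  "Var3 v = Poly_Mapping.single (Poly_Mapping.single v 1) 1"

definition monom :: "(var3 \<Rightarrow>\<^sub>0 nat) \<Rightarrow> 'a::comm_ring_1 mpoly3" where
  "monom m = Poly_Mapping.single m 1"

definition const3 :: "'a::comm_ring_1 \<Rightarrow> 'a mpoly3" where
  "const3 c = Poly_Mapping.single 0 c"

definition evalp :: "(var3 \<Rightarrow> 'a::comm_ring_1) \<Rightarrow> 'a mpoly3 \<Rightarrow> 'a" where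
  "evalp x p = (\<Sum>m \<in> Poly_Mapping.keys p.
      Poly_Mapping.lookup p m * (\<Prod>v \<in> Poly_Mapping.keys m. x v ^ Poly_Mapping.lookup m v))"

definition pluecker :: "(nat \<Rightarrow> 'a::comm_ring_1) \<Rightarrow> (nat \<Rightarrow> 'a) \<Rightarrow> (nat \<Rightarrow> 'a) \<Rightarrow> var3 \<Rightarrow> 'a" where
  "pluecker u v w t = (case t of (i,j,k) \<Rightarrow>
       u i * (v j * w k - v k * w j) - u j * (v i * w k - v k * w i) + u k * (v i * w j - v j * w i))"

text \<open>Affine cone over the union of secant lines of G(3,W^*): sums of two decomposable 3-forms.
  (Its Zariski closure has the same vanishing ideal.)\<close>
definition secant_cone :: "(var3 \<Rightarrow> 'a::comm_ring_1) set" where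
  "secant_cone = {x. \<exists>u v w u' v' w'. x = (\<lambda>t. pluecker u v w t + pluecker u' v' w' t)}"

definition secant_ideal :: "nat \<Rightarrow> 'a::comm_ring_1 mpoly3 set" where
  "secant_ideal n = {p \<in> polyring n. \<forall>x \<in> secant_cone. evalp x p = 0}"

definition ideal_gen :: "'a::comm_ring_1 mpoly3 set \<Rightarrow> 'a mpoly3 set \<Rightarrow> 'a mpoly3 set" where
  "ideal_gen R G = {(\<Sum>g\<in>F. c g * g) | F c. finite F \<and> F \<subseteq> G \<and> (\<forall>g\<in>F. c g \<in> R)}"

text \<open>e_i wedge e_j wedge e_k expressed in the sorted basis.\<close>
definition wv :: "nat \<Rightarrow> nat \<Rightarrow> nat \<Rightarrow> 'a::comm_ring_1 mpoly3" where
  "wv i j k =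
     (if i < j \<and> j < k then Var3 (i,j,k)
      else if i < k \<and> k < j then - Var3 (i,k,j)
      else if j < i \<and> i < k then - Var3 (j,i,k)
      else if j < k \<and> k < i then Var3 (j,k,i)
      else if k < i \<and> i < j then Var3 (k,i,j)
      else if k < j \<and> j < i then - Var3 (k,j,i)
      else 0)"

text \<open>Action of the elementary matrix E_ab of gl(W) (e_b \<mapsto> e_a) on a variable of Lambda^3 W.\<close>
definition Evar :: "nat \<Rightarrow> nat \<Rightarrow> var3 \<Rightarrow> 'a::comm_ring_1 mpoly3" where
  "Evar a b t = (case t of (i,j,k) \<Rightarrow>
      (if i = b then wv a j k else 0) + (if j = b then wv i a k else 0) + (if k = b then wv i j a else 0))"

text \<open>Extension of E_ab to Sym(Lambda^3 W) as a derivation.\<close>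
definition Eop :: "nat \<Rightarrow> nat \<Rightarrow> 'a::comm_ring_1 mpoly3 \<Rightarrow> 'a mpoly3" where
  "Eop a b p = (\<Sum>m \<in> Poly_Mapping.keys p. const3 (Poly_Mapping.lookup p m) *
      (\<Sum>v \<in> Poly_Mapping.keys m. of_nat (Poly_Mapping.lookup m v) *
           monom (m - Poly_Mapping.single v 1) * Evar a b v))"

definition weight :: "(var3 \<Rightarrow>\<^sub>0 nat) \<Rightarrow> nat \<Rightarrow> nat" where
  "weight m a = (\<Sum>v \<in> Poly_Mapping.keys m. Poly_Mapping.lookup m v *
      (case v of (i,j,k) \<Rightarrow> (if i = a then 1 else 0) + (if j = a then 1 else 0) + (if k = a then 1 else 0)))"

definition lam316 :: "nat \<Rightarrow> nat" where
  "lam316 a = (if a = 0 then 3 else if a \<le> 6 then 1 else 0)"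

text \<open>Highest weight vectors of weight (3,1^6) in Sym(Lambda^3 W) (automatically of degree 3):
  weight vectors killed by all raising operators E_{a,a+1}.\<close>
definition hw316 :: "nat \<Rightarrow> 'a::comm_ring_1 mpoly3 \<Rightarrow> bool" where
  "hw316 n p \<longleftrightarrow> p \<in> polyring n \<and> (\<forall>m \<in> Poly_Mapping.keys p. weight m = lam316)
      \<and> (\<forall>a. Suc a < n \<longrightarrow> Eop a (Suc a) p = 0)"

inductive_set S316 :: "nat \<Rightarrow> 'a::comm_ring_1 mpoly3 set" for n where
  hw: "hw316 n p \<Longrightarrow> p \<in> S316 n"
| add: "p \<in> S316 n \<Longrightarrow> q \<in> S316 n \<Longrightarrow> p + q \<in> S316 n"
| smult: "p \<in> S316 n \<Longrightarrow> const3 c * p \<in> S316 n"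
| act: "p \<in> S316 n \<Longrightarrow> a < n \<Longrightarrow> b < n \<Longrightarrow> Eop a b p \<in> S316 n"

end

theory Submission
  imports Defs "HOL-Library.Function_Algebras" "HOL-Library.Product_Lexorder"
begin

text \<open>A sum of two decomposable three-forms lives on a six-dimensional space, and such sums are dense in the
  three-forms in six variables. The module of highest weight (3,1,1,1,1,1,1) is spanned by the coefficients of
  the six-forms \<open>Q\<^sub>u Q\<^sub>v Q\<^sub>w\<close>, where \<open>Q\<^sub>u\<close> is the contraction of the generic three-form X with
  the u-th basis vector: on the secant variety each Q is a sum of two two-forms of rank two, so these cubics vanish.

  Let J be the ideal generated by these cubics. Contracting the relation \<open>Q Q Q = 0\<close> repeatedly and using that
  contraction is an odd derivation, one finds that every product of total degree seven of X, the
  two-forms \<open>Q\<^sub>u\<close> and the one-forms \<open>L\<^sub>u\<^sub>v\<close> has its coefficients in J. Consequently every alternating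
  polarization of a polynomial into seven new letters lies in J.

  Let p be a weight vector in the vanishing ideal. By induction on the weight the raising operators send p into J.
  If at least seven letters occur in p, polarizing seven of them alternatingly into new letters and then back
  multiplies p, modulo J, by a positive integer (a Capelli identity), so p is in J. If at most six letters occur,
  p is zero by density. The same Capelli argument shows that any highest weight vector of this weight lies in J.\<close>

text \<open>Seven is one more than the number of vectors in two decomposable three-forms, so a
  polarization that alternates in seven letters vanishes on the secant variety. Polarization goes
  into seven fresh letters, hence the work in n + 7 letters and the final return to n. Reading the
  fresh letters as anticommuting variables turns alternation into multiplication: polarizing one,
  two or three letters of a variable gives the coefficients of L, Q or X, and seven polarizations
  give sums of old polynomials times words of total degree seven. The obstacle is the way back.
  Returning a fresh letter to its origin c reproduces the vector with the factor (weight of c) +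
  (number of remaining letters), but also leaves error terms E_cb p for the remaining b. They are
  harmless only if E_cb p is already in J, which is why the letters are taken in increasing order.
  Characteristic zero serves to cancel these factors and the small integers created by contraction,
  and to tell polynomials apart by their values.\<close>

abbreviation lk :: "('b \<Rightarrow>\<^sub>0 'c::zero) \<Rightarrow> 'b \<Rightarrow> 'c" where "lk \<equiv> Poly_Mapping.lookup"
abbreviation ky :: "('b \<Rightarrow>\<^sub>0 'c::zero) \<Rightarrow> 'b set" where "ky \<equiv> Poly_Mapping.keys"
abbreviation sg :: "'b \<Rightarrow> 'c \<Rightarrow> ('b \<Rightarrow>\<^sub>0 'c::zero)" where "sg \<equiv> Poly_Mapping.single"

section \<open>Polynomials in the Pluecker variables\<close>

lemma poly_mapping_sum_single:
  fixes p :: "'b \<Rightarrow>\<^sub>0 'c::comm_monoid_add"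
  assumes "finite A" "ky p \<subseteq> A"
  shows "p = (\<Sum>m\<in>A. sg m (lk p m))"
proof (rule poly_mapping_eqI)
  fix k
  have "lk (\<Sum>m\<in>A. sg m (lk p m)) k = (\<Sum>m\<in>A. if m = k then lk p m else 0)"
    by (simp add: lookup_sum lookup_single when_def)
  also have "\<dots> = lk p k"
    using assms by (auto simp: sum.delta not_in_keys_iff_lookup_eq_zero[symmetric])
  finally show "lk p k = lk (\<Sum>m\<in>A. sg m (lk p m)) k" by simp
qed

text \<open>The support of a sum may be smaller than the union of the supports, so all three sums
  are compared over that union, where the surplus terms vanish.\<close>

lemma additive_on_poly_mapping:
  fixes F :: "('b \<Rightarrow>\<^sub>0 'c::comm_monoid_add) \<Rightarrow> 'd::comm_monoid_add"
  assumes F: "\<And>p. F p = (\<Sum>m\<in>ky p. G (lk p m) m)"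
    and G0: "\<And>m. G 0 m = 0" and Gadd: "\<And>c d m. G (c + d) m = G c m + G d m"
  shows "F (p + q) = F p + F q"
proof -
  let ?A = "ky p \<union> ky q"
  have *: "F r = (\<Sum>m\<in>?A. G (lk r m) m)" if "ky r \<subseteq> ?A" for r
    unfolding F by (rule sum.mono_neutral_left) (use that in \<open>auto simp: in_keys_iff G0\<close>)
  have "ky (p + q) \<subseteq> ?A" by (rule keys_add)
  then show ?thesis
    by (simp add: * lookup_add Gadd sum.distrib)
qed

definition meval :: "(var3 \<Rightarrow> 'b::comm_ring_1) \<Rightarrow> (var3 \<Rightarrow>\<^sub>0 nat) \<Rightarrow> 'b" where
  "meval f m = (\<Prod>v\<in>ky m. f v ^ lk m v)"

lemma meval_superset:
  assumes "finite A" "ky m \<subseteq> A"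
  shows "meval f m = (\<Prod>v\<in>A. f v ^ lk m v)"
  unfolding meval_def by (rule prod.mono_neutral_left) (use assms in \<open>auto simp: in_keys_iff\<close>)

lemma meval_0 [simp]: "meval f 0 = 1"
  by (simp add: meval_def)

lemma meval_single [simp]: "meval f (sg v k) = f v ^ k"
  by (subst meval_superset[of "{v}"]) auto

lemma meval_add: "meval f (m + m') = meval f m * meval f m'"
proof -
  let ?A = "ky m \<union> ky m'"
  have "ky (m + m') \<subseteq> ?A" by (rule keys_add)
  then show ?thesis
    by (simp add: meval_superset[of ?A] lookup_add power_add prod.distrib)
qed

locale unital_hom =
  fixes h :: "'a::comm_ring_1 \<Rightarrow> 'b::comm_ring_1"
  assumes hom_add: "h (x + y) = h x + h y"
    and hom_mult: "h (x * y) = h x * h y"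
    and hom_one: "h 1 = 1"
begin

lemma hom_zero: "h 0 = 0"
  using hom_add[of 0 0] by simp

lemma hom_uminus: "h (- x) = - h x"
  using hom_add[of x "- x"] hom_zero by (simp add: eq_neg_iff_add_eq_0 add.commute)

lemma hom_diff: "h (x - y) = h x - h y"
  using hom_add[of x "- y"] hom_uminus by simp

lemma hom_sum: "h (sum f A) = (\<Sum>x\<in>A. h (f x))"
  by (induction A rule: infinite_finite_induct) (simp_all add: hom_zero hom_add)

lemma hom_power: "h (x ^ k) = h x ^ k"
  by (induction k) (simp_all add: hom_one hom_mult)

end

text \<open>The universal property of the polynomial ring. It serves three times:
  \<open>h = id\<close> is evaluation at a point, \<open>h = const3\<close> the retraction to fewer
  letters, and the inclusion of constants into univariate polynomials is substitution of a
  curve.\<close>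

definition psubst :: "('a::comm_ring_1 \<Rightarrow> 'b::comm_ring_1) \<Rightarrow> (var3 \<Rightarrow> 'b) \<Rightarrow> 'a mpoly3 \<Rightarrow> 'b" where
  "psubst h f p = (\<Sum>m\<in>ky p. h (lk p m) * meval f m)"

lemma evalp_psubst: "evalp x p = psubst id x p"
  by (simp add: evalp_def psubst_def meval_def)

context unital_hom
begin

lemma psubst_add: "psubst h f (p + q) = psubst h f p + psubst h f q"
  by (rule additive_on_poly_mapping[where G = "\<lambda>c m. h c * meval f m"])
    (simp_all add: psubst_def hom_zero hom_add distrib_right)

lemma psubst_zero: "psubst h f 0 = 0"
  by (simp add: psubst_def)

lemma psubst_sum: "psubst h f (sum g A) = (\<Sum>x\<in>A. psubst h f (g x))"
  by (induction A rule: infinite_finite_induct) (simp_all add: psubst_zero psubst_add)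

lemma psubst_single: "psubst h f (sg m c) = h c * meval f m"
  by (simp add: psubst_def hom_zero)

lemma psubst_mult: "psubst h f (p * q) = psubst h f p * psubst h f q"
proof -
  have p: "p = (\<Sum>m\<in>ky p. sg m (lk p m))" and q: "q = (\<Sum>m\<in>ky q. sg m (lk q m))"
    by (rule poly_mapping_sum_single; simp)+
  have "p * q = (\<Sum>m\<in>ky p. \<Sum>m'\<in>ky q. sg (m + m') (lk p m * lk q m'))"
    by (subst p, subst q) (simp add: sum_product mult_single)
  then have "psubst h f (p * q) =
      (\<Sum>m\<in>ky p. \<Sum>m'\<in>ky q. (h (lk p m) * meval f m) * (h (lk q m') * meval f m'))"
    by (simp add: psubst_sum psubst_single hom_mult meval_add mult_ac)
  also have "\<dots> = psubst h f p * psubst h f q"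
    by (simp add: psubst_def sum_product)
  finally show ?thesis .
qed

lemma psubst_const: "psubst h f (const3 c) = h c"
  by (simp add: const3_def psubst_single)

lemma psubst_Var3: "psubst h f (Var3 v) = f v"
  by (simp add: Var3_def psubst_single hom_one)

lemma psubst_hom: "unital_hom (psubst h f)"
proof
  show "psubst h f 1 = 1"
    using psubst_const[of f 1] by (simp add: const3_def hom_one)
qed (simp_all add: psubst_add psubst_mult)

end

lemma unital_hom_id: "unital_hom id"
  by standard simp_all

lemma unital_hom_evalp: "unital_hom (evalp x)"
  using unital_hom.psubst_hom[OF unital_hom_id, of x] by (simp add: evalp_psubst[abs_def])

lemma evalp_Var3 [simp]: "evalp x (Var3 v) = x v"
  by (simp add: evalp_psubst unital_hom.psubst_Var3[OF unital_hom_id])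

lemma evalp_const [simp]: "evalp x (const3 c) = c"
  by (simp add: evalp_psubst unital_hom.psubst_const[OF unital_hom_id])

lemma const3_simps:
  "const3 0 = 0" "const3 1 = 1" "const3 (c + d) = const3 c + const3 d"
  "const3 (c * d) = const3 c * const3 d" "const3 (- c) = - const3 c"
  "const3 (c - d) = const3 c - const3 d"
  by (simp_all add: const3_def single_add mult_single single_uminus single_diff)

lemma unital_hom_const3: "unital_hom const3"
  by standard (simp_all add: const3_simps)

lemma const3_of_nat: "const3 (of_nat k) = of_nat k"
  by (simp add: const3_def)

lemma monom_mult: "monom (m + m') = monom m * monom m'"
  by (simp add: monom_def mult_single)

lemma single_eq_const_monom: "sg m c = const3 c * monom m"
  by (simp add: const3_def monom_def mult_single)

lemma monom_0: "monom 0 = 1"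
  by (simp add: monom_def)

lemma monom_single: "monom (sg v 1) = Var3 v"
  by (simp add: monom_def Var3_def)

lemma monomial_induct [case_names zero add]:
  assumes "P 0" and "\<And>v m. P m \<Longrightarrow> P (sg v (1::nat) + m)"
  shows "P (m :: var3 \<Rightarrow>\<^sub>0 nat)"
proof -
  have *: "P (sg v k + m)" if "P m" for v k m
  proof (induction k)
    case (Suc k)
    have "sg v (Suc k) + m = sg v 1 + (sg v k + m)"
      by (simp add: add.assoc[symmetric] single_add[symmetric])
    then show ?case using assms(2)[OF Suc] by simp
  qed (use that in simp)
  have "P (\<Sum>v\<in>A. sg v (lk m v))" if "finite A" for A
    using that by (induction A rule: finite_induct) (simp_all add: assms(1) *)
  from this[of "ky m"] show ?thesis
    using poly_mapping_sum_single[of "ky m" m] by simp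
qed

lemma monom_eq_meval: "monom m = meval Var3 m"
  by (induction m rule: monomial_induct)
    (simp_all add: monom_0 monom_mult meval_add monom_single[unfolded One_nat_def])

lemma mpoly3_vars_induct [consumes 1, case_names const var add mult]:
  fixes p :: "'a::comm_ring_1 mpoly3"
  assumes vars: "\<And>m v. m \<in> ky p \<Longrightarrow> v \<in> ky m \<Longrightarrow> v \<in> V"
    and const: "\<And>c. P (const3 c)" and var: "\<And>v. v \<in> V \<Longrightarrow> P (Var3 v)"
    and add: "\<And>p q. P p \<Longrightarrow> P q \<Longrightarrow> P (p + q)" and mult: "\<And>p q. P p \<Longrightarrow> P q \<Longrightarrow> P (p * q)"
  shows "P p"
proof -
  have one: "P 1" and zero: "P 0"
    using const[of 1] const[of 0] by (simp_all add: const3_simps)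
  have pow: "P (x ^ k)" if "P x" for x k
    by (induction k) (simp_all add: one mult that)
  have "P (\<Prod>v\<in>A. Var3 v ^ lk m v)" if "finite A" "A \<subseteq> V" for m A
    using that by (induction A rule: finite_induct) (simp_all add: one mult pow var)
  then have mon: "P (monom m)" if "m \<in> ky p" for m
    using vars[OF that] by (simp add: monom_eq_meval meval_def subset_iff)
  have "P (\<Sum>m\<in>A. sg m (lk p m))" if "finite A" "A \<subseteq> ky p" for A
    using that
    by (induction A rule: finite_induct)
      (simp_all add: zero single_eq_const_monom[of _ "lk p _"] add mult[OF const mon])
  from this[of "ky p"] show ?thesis
    using poly_mapping_sum_single[of "ky p" p] by simp
qed

lemmas mpoly3_induct [case_names const var add mult] = mpoly3_vars_induct[where V = UNIV, OF UNIV_I]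

section \<open>The subring of polynomials in n letters\<close>

lemma polyring_const: "const3 c \<in> polyring n"
  by (auto simp: polyring_def const3_def)

lemma polyring_add: "p \<in> polyring n \<Longrightarrow> q \<in> polyring n \<Longrightarrow> p + q \<in> polyring n"
  using keys_add[of p q] by (auto simp: polyring_def)

lemma polyring_mult: "p \<in> polyring n \<Longrightarrow> q \<in> polyring n \<Longrightarrow> p * q \<in> polyring n"
proof -
  assume p: "p \<in> polyring n" and q: "q \<in> polyring n"
  have "valid_var n v" if m: "m \<in> ky (p * q)" and v: "v \<in> ky m" for m v
  proof -
    obtain a b where "a \<in> ky p" "b \<in> ky q" "m = a + b" using m keys_mult[of p q] by blast
    then show ?thesis using p q v keys_add[of a b] by (auto simp: polyring_def)
  qed
  then show ?thesis by (auto simp: polyring_def)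
qed

lemma polyring_Var3: "valid_var n v \<Longrightarrow> Var3 v \<in> polyring n"
  by (auto simp: polyring_def Var3_def)

lemma polyring_induct [consumes 1, case_names const var add mult]:
  assumes "p \<in> polyring n"
    and const: "\<And>c. P (const3 c)" and var: "\<And>v. valid_var n v \<Longrightarrow> P (Var3 v)"
    and add: "\<And>p q. p \<in> polyring n \<Longrightarrow> q \<in> polyring n \<Longrightarrow> P p \<Longrightarrow> P q \<Longrightarrow> P (p + q)"
    and mult: "\<And>p q. p \<in> polyring n \<Longrightarrow> q \<in> polyring n \<Longrightarrow> P p \<Longrightarrow> P q \<Longrightarrow> P (p * q)"
  shows "P p"
proof -
  have "p \<in> polyring n \<and> P p"
  proof (rule mpoly3_vars_induct[of p "{v. valid_var n v}"])
    show "v \<in> {v. valid_var n v}" if "m \<in> ky p" "v \<in> ky m" for m v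
      using assms(1) that by (auto simp: polyring_def)
  qed (simp_all add: const var add mult polyring_const polyring_Var3 polyring_add polyring_mult)
  then show ?thesis ..
qed

lemma polyring_0: "0 \<in> polyring n"
  by (simp add: polyring_def)

lemma polyring_uminus: "p \<in> polyring n \<Longrightarrow> - p \<in> polyring n"
  using polyring_mult[OF polyring_const[of "-1"], of p] by (simp add: const3_simps)

lemma polyring_sum: "(\<And>i. i \<in> A \<Longrightarrow> f i \<in> polyring n) \<Longrightarrow> sum f A \<in> polyring n"
  by (induction A rule: infinite_finite_induct) (simp_all add: polyring_0 polyring_add)

lemma polyring_wv: "i < n \<Longrightarrow> j < n \<Longrightarrow> k < n \<Longrightarrow> wv i j k \<in> polyring n"
  by (auto simp: wv_def polyring_0 valid_var_def intro!: polyring_uminus polyring_Var3)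

section \<open>The operators of gl(W)\<close>

definition mon_deriv :: "(var3 \<Rightarrow> 'a::comm_ring_1 mpoly3) \<Rightarrow> (var3 \<Rightarrow>\<^sub>0 nat) \<Rightarrow> 'a mpoly3" where
  "mon_deriv \<delta> m = (\<Sum>v\<in>ky m. of_nat (lk m v) * monom (m - sg v 1) * \<delta> v)"

definition pderivation :: "(var3 \<Rightarrow> 'a::comm_ring_1 mpoly3) \<Rightarrow> 'a mpoly3 \<Rightarrow> 'a mpoly3" where
  "pderivation \<delta> p = (\<Sum>m\<in>ky p. const3 (lk p m) * mon_deriv \<delta> m)"

lemma Eop_pderivation: "Eop a b = pderivation (Evar a b)"
  by (simp add: fun_eq_iff Eop_def pderivation_def mon_deriv_def)

lemma mon_deriv_superset:
  assumes "finite A" "ky m \<subseteq> A"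
  shows "mon_deriv \<delta> m = (\<Sum>v\<in>A. of_nat (lk m v) * monom (m - sg v 1) * \<delta> v)"
  unfolding mon_deriv_def by (rule sum.mono_neutral_left) (use assms in \<open>auto simp: in_keys_iff\<close>)

lemma mon_deriv_add: "mon_deriv \<delta> (m + m') = monom m * mon_deriv \<delta> m' + monom m' * mon_deriv \<delta> m"
proof -
  let ?A = "ky m \<union> ky m'"
  \<comment> \<open>Exponent subtraction is truncated, so it can be moved past \<open>m'\<close>
    only if v occurs in m; otherwise the coefficient is zero.\<close>
  have *: "of_nat (lk m v) * monom (m + m' - sg v 1) = of_nat (lk m v) * monom (m - sg v 1) * (monom m' :: 'a mpoly3)"
    for m m' :: "var3 \<Rightarrow>\<^sub>0 nat" and v
  proof (cases "lk m v = 0")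
    case False
    have "m + m' - sg v 1 = (m - sg v 1) + m'"
      by (rule poly_mapping_eqI) (use False in \<open>auto simp: lookup_add lookup_minus lookup_single when_def\<close>)
    then show ?thesis by (simp add: monom_mult mult.assoc)
  qed simp
  have "ky (m + m') \<subseteq> ?A" by (rule keys_add)
  then have "mon_deriv \<delta> (m + m') =
      (\<Sum>v\<in>?A. of_nat (lk m v) * monom (m + m' - sg v 1) * \<delta> v
             + of_nat (lk m' v) * monom (m' + m - sg v 1) * \<delta> v)"
    by (simp add: mon_deriv_superset[of ?A] lookup_add distrib_right add.commute)
  also have "\<dots> = (\<Sum>v\<in>?A. monom m' * (of_nat (lk m v) * monom (m - sg v 1) * \<delta> v)
             + monom m * (of_nat (lk m' v) * monom (m' - sg v 1) * \<delta> v))"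
    unfolding * by (simp add: mult_ac)
  also have "\<dots> = monom m' * mon_deriv \<delta> m + monom m * mon_deriv \<delta> m'"
    by (simp add: mon_deriv_superset[of ?A] sum.distrib sum_distrib_left)
  finally show ?thesis by (simp add: add.commute)
qed

lemma pderivation_add: "pderivation \<delta> (p + q) = pderivation \<delta> p + pderivation \<delta> q"
  by (rule additive_on_poly_mapping[where G = "\<lambda>c m. const3 c * mon_deriv \<delta> m"])
    (simp_all add: pderivation_def const3_simps distrib_right)

lemma pderivation_zero: "pderivation \<delta> 0 = 0"
  by (simp add: pderivation_def)

lemma pderivation_sum: "pderivation \<delta> (sum g A) = (\<Sum>x\<in>A. pderivation \<delta> (g x))"
  by (induction A rule: infinite_finite_induct) (simp_all add: pderivation_zero pderivation_add)

lemma pderivation_single: "pderivation \<delta> (sg m c) = const3 c * mon_deriv \<delta> m"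
  by (simp add: pderivation_def const3_simps)

lemma pderivation_mult: "pderivation \<delta> (p * q) = p * pderivation \<delta> q + pderivation \<delta> p * q"
proof -
  have p: "p = (\<Sum>m\<in>ky p. sg m (lk p m))" and q: "q = (\<Sum>m\<in>ky q. sg m (lk q m))"
    by (rule poly_mapping_sum_single; simp)+
  have "p * q = (\<Sum>m\<in>ky p. \<Sum>m'\<in>ky q. sg (m + m') (lk p m * lk q m'))"
    by (subst p, subst q) (simp add: sum_product mult_single)
  moreover have "pderivation \<delta> (sg (m + m') (c * d))
      = sg m c * pderivation \<delta> (sg m' d) + pderivation \<delta> (sg m c) * sg m' d" for m m' c d
    unfolding pderivation_single mon_deriv_add const3_simps unfolding single_eq_const_monom[of m]
      single_eq_const_monom[of m'] by (simp add: algebra_simps)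
  ultimately have "pderivation \<delta> (p * q) =
      (\<Sum>m\<in>ky p. \<Sum>m'\<in>ky q. sg m (lk p m) * pderivation \<delta> (sg m' (lk q m'))
          + pderivation \<delta> (sg m (lk p m)) * sg m' (lk q m'))"
    by (simp add: pderivation_sum)
  also have "\<dots> = (\<Sum>m\<in>ky p. sg m (lk p m)) * (\<Sum>m\<in>ky q. pderivation \<delta> (sg m (lk q m)))
      + (\<Sum>m\<in>ky p. pderivation \<delta> (sg m (lk p m))) * (\<Sum>m\<in>ky q. sg m (lk q m))"
    by (simp add: sum_product sum.distrib)
  also have "\<dots> = p * pderivation \<delta> q + pderivation \<delta> p * q"
    by (simp only: pderivation_sum[symmetric] p[symmetric] q[symmetric])
  finally show ?thesis .
qed

lemma pderivation_const: "pderivation \<delta> (const3 c) = 0"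
  by (simp add: const3_def pderivation_single mon_deriv_def)

lemma pderivation_Var3: "pderivation \<delta> (Var3 v) = \<delta> v"
  by (simp add: Var3_def pderivation_single mon_deriv_def const3_simps monom_0)

lemmas Eop_add = pderivation_add[of "Evar a b" for a b, folded Eop_pderivation]
lemmas Eop_zero [simp] = pderivation_zero[of "Evar a b" for a b, folded Eop_pderivation]
lemmas Eop_mult = pderivation_mult[of "Evar a b" for a b, folded Eop_pderivation]
lemmas Eop_const [simp] = pderivation_const[of "Evar a b" for a b, folded Eop_pderivation]
lemmas Eop_Var3 = pderivation_Var3[of "Evar a b" for a b, folded Eop_pderivation]
lemma Eop_one [simp]: "Eop a b 1 = 0"
  using Eop_const[of a b 1] by (simp add: const3_simps)

lemma Eop_uminus: "Eop a b (- p) = - Eop a b p"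
  using Eop_add[of a b p "- p"] by (simp add: eq_neg_iff_add_eq_0 add.commute)

lemma Eop_smult: "Eop a b (const3 c * p) = const3 c * Eop a b p"
  by (simp add: Eop_mult)

lemma wv_swap12: "wv j i k = - wv i j k"
  by (auto simp: wv_def)

lemma wv_swap23: "wv i k j = - wv i j k"
  by (auto simp: wv_def)

lemma wv_same: "wv i i k = 0" "wv i k i = 0" "wv k i i = 0"
  by (auto simp: wv_def)

lemma wv_sorted: "i < j \<Longrightarrow> j < k \<Longrightarrow> wv i j k = Var3 (i, j, k)"
  by (simp add: wv_def)

text \<open>Replaces the six-way case split in \<open>wv\<close>: adjacent transpositions sort the
  indices, repeated indices give zero on both sides, and only increasing triples remain, where
  \<open>wv\<close> is a variable.\<close>

lemma alternating3_eqI: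
  fixes f g :: "nat \<Rightarrow> nat \<Rightarrow> nat \<Rightarrow> 'b::ab_group_add"
  assumes f: "\<And>i j k. f j i k = - f i j k" "\<And>i j k. f i k j = - f i j k" "\<And>i k. f i i k = 0"
    and g: "\<And>i j k. g j i k = - g i j k" "\<And>i j k. g i k j = - g i j k" "\<And>i k. g i i k = 0"
    and eq: "\<And>i j k. i < j \<Longrightarrow> j < k \<Longrightarrow> f i j k = g i j k"
  shows "f i j k = g i j k"
proof -
  have le: "f i j k = g i j k" if "i \<le> j" "j \<le> k" for i j k
  proof -
    have "f i k k = 0" "g i k k = 0"
      using f(1)[of i k k] f(2)[of k i k] f(3)[of k i] g(1)[of i k k] g(2)[of k i k] g(3)[of k i] by simp_all
    then show ?thesis using that eq f(3) g(3) by (metis order.order_iff_strict)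
  qed
  have le12: "f i j k = g i j k" if "i \<le> j" for i j k
    using that le f(1,2) g(1,2) by (metis nle_le)
  show ?thesis
    using le12[of i j k] le12[of j i k] f(1) g(1) by (metis nle_le)
qed

lemma Eop_wv: "Eop a b (wv i j k) =
    (if i = b then wv a j k else 0) + (if j = b then wv i a k else 0) + (if k = b then wv i j a else 0)"
proof (rule alternating3_eqI[where f = "\<lambda>i j k. Eop a b (wv i j k)" and
      g = "\<lambda>i j k. (if i = b then wv a j k else 0) + (if j = b then wv i a k else 0) + (if k = b then wv i j a else 0)"])
  fix i j k :: nat
  show "Eop a b (wv j i k) = - Eop a b (wv i j k)" by (subst wv_swap12) (simp add: Eop_uminus)
  show "Eop a b (wv i k j) = - Eop a b (wv i j k)" by (subst wv_swap23) (simp add: Eop_uminus)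
  show "Eop a b (wv i i k) = 0" by (simp add: wv_same)
  show "(if j = b then wv a i k else 0) + (if i = b then wv j a k else 0) + (if k = b then wv j i a else 0)
    = - ((if i = b then wv a j k else 0) + (if j = b then wv i a k else 0) + (if k = b then wv i j a else (0::'a mpoly3)))"
    by (simp add: wv_swap12[of j a k] wv_swap12[of a i k] wv_swap12[of j i a])
  show "(if i = b then wv a k j else 0) + (if k = b then wv i a j else 0) + (if j = b then wv i k a else 0)
    = - ((if i = b then wv a j k else 0) + (if j = b then wv i a k else 0) + (if k = b then wv i j a else (0::'a mpoly3)))"
    by (simp add: wv_swap23[of a k j] wv_swap23[of i a j] wv_swap23[of i k a])
  show "(if i = b then wv a i k else 0) + (if i = b then wv i a k else 0) + (if k = b then wv i i a else 0) = (0::'a mpoly3)"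
    by (simp add: wv_same wv_swap12[of a b k])
  show "Eop a b (wv i j k) = 
    (if i = b then wv a j k else 0) + (if j = b then wv i a k else 0) + (if k = b then wv i j a else 0)"
    if "i < j" "j < k"
    unfolding wv_sorted[OF that] by (simp add: Eop_Var3 Evar_def)
qed

text \<open>The commutator of two derivations is a derivation, so the bracket of gl(W) has to be
  verified on variables only.\<close>

lemma Eop_commutator:
  "Eop a b (Eop c d p) - Eop c d (Eop a b p)
    = (if b = c then Eop a d p else 0) - (if d = a then Eop c b p else 0)"
proof (induction p rule: mpoly3_induct)
  case (var v)
  obtain i j k where "v = (i, j, k)" by (cases v)
  then show ?case
    by (simp add: Eop_Var3 Evar_def Eop_add Eop_wv if_distrib[of "Eop _ _"] if_distrib[of uminus] cong: if_cong)
next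
  case (add p q)
  have "Eop a b (Eop c d (p + q)) - Eop c d (Eop a b (p + q))
    = (Eop a b (Eop c d p) - Eop c d (Eop a b p)) + (Eop a b (Eop c d q) - Eop c d (Eop a b q))"
    by (simp add: Eop_add)
  then show ?case unfolding add by (simp add: Eop_add)
next
  case (mult p q)
  have "Eop a b (Eop c d (p * q)) - Eop c d (Eop a b (p * q))
    = p * (Eop a b (Eop c d q) - Eop c d (Eop a b q)) + (Eop a b (Eop c d p) - Eop c d (Eop a b p)) * q"
    by (simp add: Eop_mult Eop_add algebra_simps)
  also have "\<dots> = (if b = c then Eop a d (p * q) else 0) - (if d = a then Eop c b (p * q) else 0)"
    unfolding mult by (simp add: Eop_mult algebra_simps)
  finally show ?case .
qed simp

lemma Eop_polyring: "p \<in> polyring n \<Longrightarrow> a < n \<Longrightarrow> Eop a b p \<in> polyring n"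
proof (induction p rule: polyring_induct)
  case (var v)
  obtain i j k where "v = (i, j, k)" by (cases v)
  with var show ?case
    by (auto simp: Eop_Var3 Evar_def valid_var_def intro!: polyring_add polyring_0 polyring_wv)
qed (simp_all add: polyring_0 Eop_add Eop_mult polyring_add polyring_mult polyring_const)

lemma Eop_fresh: "p \<in> polyring n \<Longrightarrow> n \<le> b \<Longrightarrow> Eop a b p = 0"
proof (induction p rule: polyring_induct)
  case (var v)
  then show ?case by (auto simp: Eop_Var3 Evar_def valid_var_def split: prod.splits)
qed (simp_all add: Eop_add Eop_mult)

section \<open>Exterior multiplication and contraction operators\<close>

lemmas fun_apply = plus_fun_apply zero_fun_apply minus_apply uminus_apply

declare fun_apply [simp del]

text \<open>Additivity is demanded instead of linearity, so that differentiation of the coefficients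
  by \<open>Eop\<close>, which is not linear over the polynomial ring, lives in the same ring of
  operators.\<close>

typedef (overloaded) 'r extop =
  "{F :: (nat set \<Rightarrow> 'r::comm_ring_1) \<Rightarrow> (nat set \<Rightarrow> 'r). \<forall>f g. F (f + g) = F f + F g}"
  morphisms app Extop
  by (rule exI[of _ "\<lambda>f. f"]) simp

lemma app_add [simp]: "app F (f + g) = app F f + app F g"
  using app[of F] by simp

lemma app_0 [simp]: "app F 0 = 0"
  using app_add[of F 0 0] by simp

lemma app_uminus [simp]: "app F (- f) = - app F f"
  using app_add[of F f "- f"] by (simp add: eq_neg_iff_add_eq_0 add.commute)

lemma app_diff [simp]: "app F (f - g) = app F f - app F g"
  using app_add[of F f "- g"] by simp

lemma app_sum: "app F (sum g A) = (\<Sum>x\<in>A. app F (g x))"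
  by (induction A rule: infinite_finite_induct) simp_all

lemma extop_eqI: "(\<And>f S. app F f S = app G f S) \<Longrightarrow> F = G"
  by (metis app_inject ext)

instantiation extop :: (comm_ring_1) ring_1
begin

definition "0 = Extop (\<lambda>f. 0)"
definition "1 = Extop (\<lambda>f. f)"
definition "F + G = Extop (\<lambda>f. app F f + app G f)"
definition "F - G = Extop (\<lambda>f. app F f - app G f)"
definition "- F = Extop (\<lambda>f. - app F f)" for F :: "'a extop"
definition "F * G = Extop (\<lambda>f. app F (app G f))"

lemma app_simps:
  "app 0 f = 0" "app 1 f = f" "app (F + G) f = app F f + app G f" "app (F - G) f = app F f - app G f"
  "app (- F) f = - app F f" "app (F * G) f = app F (app G f)"
  by (simp_all add: zero_extop_def one_extop_def plus_extop_def minus_extop_def uminus_extop_def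
      times_extop_def Extop_inverse algebra_simps)

instance
proof
  show "(0 :: 'a extop) \<noteq> 1"
  proof
    assume "(0 :: 'a extop) = 1"
    then have "app 0 (\<lambda>_. 1 :: 'a) {} = app 1 (\<lambda>_. 1) {}" by simp
    then show False by (simp add: app_simps fun_apply)
  qed
qed (rule extop_eqI; simp add: app_simps fun_apply algebra_simps)+

end

declare app_simps [simp]

lemma sum_fun_apply: "(\<Sum>x\<in>A. f x) S = (\<Sum>x\<in>A. f x S)"
  for f :: "'b \<Rightarrow> 'c \<Rightarrow> 'd::comm_monoid_add"
  by (induction A rule: infinite_finite_induct) (simp_all add: fun_apply)

lemma app_sum_op: "app (\<Sum>x\<in>A. F x) f = (\<Sum>x\<in>A. app (F x) f)"
  by (induction A rule: infinite_finite_induct) simp_all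

text \<open>A function on sets of letters is an element of the exterior algebra on the letters: its value at S is
  the coefficient of the increasing product of the letters in S. Below, \<open>th\<close> is exterior multiplication by a
  letter, \<open>io\<close> contraction, \<open>ka\<close> multiplication by a scalar, \<open>pr\<close> kills the letters of a set, and \<open>vac\<close>
  is the unit. Working with operators makes associativity free and puts all of them into one ring.\<close>

definition esgn :: "nat \<Rightarrow> nat set \<Rightarrow> 'r::comm_ring_1" where
  "esgn a S = (-1) ^ card {s \<in> S. s < a}"

lemma esgn_square [simp]: "esgn a S * esgn a S = 1"
  by (simp add: esgn_def power_add[symmetric] mult_2[symmetric])

lemma esgn_square' [simp]: "esgn a S * (esgn a S * x) = x"
  by (simp add: mult.assoc[symmetric])

lemma esgn_insert: "b \<notin> S \<Longrightarrow> esgn a (insert b S) = (if b < a then - esgn a S else esgn a S)"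
proof -
  assume b: "b \<notin> S"
  have "{s \<in> insert b S. s < a} = (if b < a then insert b {s \<in> S. s < a} else {s \<in> S. s < a})"
    by auto
  moreover have "finite {s \<in> S. s < a}" by (rule finite_subset[of _ "{..<a}"]) auto
  ultimately show ?thesis using b by (simp add: esgn_def)
qed

lemma esgn_remove: "b \<in> S \<Longrightarrow> (esgn a (S - {b}) :: 'r::comm_ring_1) = (if b < a then - esgn a S else esgn a S)"
  using esgn_insert[of b "S - {b}" a, where 'a = 'r] by (auto simp: insert_absorb minus_equation_iff split: if_splits)

definition th :: "nat \<Rightarrow> 'r::comm_ring_1 extop" where
  "th a = Extop (\<lambda>f S. if a \<in> S then esgn a S * f (S - {a}) else 0)"

definition io :: "nat \<Rightarrow> 'r::comm_ring_1 extop" where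
  "io a = Extop (\<lambda>f S. if a \<in> S then 0 else esgn a S * f (insert a S))"

definition ka :: "'r::comm_ring_1 \<Rightarrow> 'r extop" where
  "ka r = Extop (\<lambda>f S. r * f S)"

definition pr :: "nat set \<Rightarrow> 'r::comm_ring_1 extop" where
  "pr P = Extop (\<lambda>f S. if S \<inter> P = {} then f S else 0)"

definition lf :: "('r \<Rightarrow> 'r) \<Rightarrow> 'r::comm_ring_1 extop" where
  "lf h = Extop (\<lambda>f S. h (f S))"

lemma app_th: "app (th a) f S = (if a \<in> S then esgn a S * f (S - {a}) else 0)"
  unfolding th_def by (subst Extop_inverse) (auto simp: fun_apply fun_eq_iff distrib_left)

lemma app_io: "app (io a) f S = (if a \<in> S then 0 else esgn a S * f (insert a S))"
  unfolding io_def by (subst Extop_inverse) (auto simp: fun_apply fun_eq_iff distrib_left)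

lemma app_ka: "app (ka r) f S = r * f S"
  unfolding ka_def by (subst Extop_inverse) (auto simp: fun_apply fun_eq_iff distrib_left)

lemma app_pr: "app (pr P) f S = (if S \<inter> P = {} then f S else 0)"
  unfolding pr_def by (subst Extop_inverse) (auto simp: fun_apply fun_eq_iff distrib_left)

lemma app_lf: "(\<And>x y. h (x + y) = h x + h y) \<Longrightarrow> app (lf h) f S = h (f S)"
  unfolding lf_def by (subst Extop_inverse) (auto simp: fun_apply fun_eq_iff)

lemma th_th: "th a * th b = - (th b * th a)"
proof (rule extop_eqI)
  fix f :: "nat set \<Rightarrow> 'a" and S
  show "app (th a * th b) f S = app (- (th b * th a)) f S"
  proof (cases "a \<noteq> b \<and> a \<in> S \<and> b \<in> S")
    case True
    then have "S - {a} - {b} = S - {b} - {a}" by auto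
    with True show ?thesis by (cases "a < b") (auto simp: fun_apply app_th esgn_remove mult_ac)
  qed (auto simp: fun_apply app_th)
qed

lemma io_th: "io a * th b = (if a = b then 1 else 0) - th b * io a"
proof (rule extop_eqI)
  fix f :: "nat set \<Rightarrow> 'a" and S
  show "app (io a * th b) f S = app ((if a = b then 1 else 0) - th b * io a) f S"
  proof (cases "a = b")
    case True
    show ?thesis
    proof (cases "a \<in> S")
      case True
      then show ?thesis using \<open>a = b\<close> by (simp add: fun_apply app_th app_io esgn_remove insert_absorb)
    next
      case False
      then show ?thesis using \<open>a = b\<close> by (simp add: fun_apply app_th app_io esgn_insert)
    qed
  next
    case False
    show ?thesis
    proof (cases "a \<notin> S \<and> b \<in> S")
      case True
      then have "insert a S - {b} = insert a (S - {b})" using False by auto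
      with True False show ?thesis
        by (cases "a < b") (auto simp: fun_apply app_th app_io esgn_remove esgn_insert mult_ac)
    qed (use False in \<open>auto simp: fun_apply app_th app_io\<close>)
  qed
qed

lemma th_ka: "th a * ka r = ka r * th a"
  by (rule extop_eqI) (simp add: fun_apply app_th app_ka mult_ac)

lemma io_ka: "io a * ka r = ka r * io a"
  by (rule extop_eqI) (simp add: fun_apply app_io app_ka mult_ac)

lemma pr_ka: "pr P * ka r = ka r * pr P"
  by (rule extop_eqI) (simp add: fun_apply app_pr app_ka)

lemma ka_mult: "ka r * ka s = ka (r * s)"
  by (rule extop_eqI) (simp add: fun_apply app_ka mult_ac)

lemma ka_add: "ka r + ka s = ka (r + s)"
  by (rule extop_eqI) (simp add: fun_apply app_ka distrib_right)

lemma ka_0 [simp]: "ka 0 = 0"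
  by (rule extop_eqI) (simp add: fun_apply app_ka)

lemma ka_1 [simp]: "ka 1 = 1"
  by (rule extop_eqI) (simp add: fun_apply app_ka)

lemma ka_uminus: "ka (- r) = - ka r"
  by (rule extop_eqI) (simp add: fun_apply app_ka)

lemma ka_of_nat: "ka (of_nat k) = of_nat k"
  by (induction k) (simp_all add: ka_add[symmetric])

lemma pr_th: "pr P * th a = (if a \<in> P then 0 else th a * pr P)"
  by (rule extop_eqI) (auto simp: fun_apply app_pr app_th)

lemma pr_io: "pr {a} * io a = io a"
  by (rule extop_eqI) (auto simp: fun_apply app_pr app_io)

definition vac :: "nat set \<Rightarrow> 'r::comm_ring_1" where
  "vac S = (if S = {} then 1 else 0)"

lemma io_vac [simp]: "app (io a) vac = 0"
  by (auto simp: fun_apply fun_eq_iff app_io vac_def)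

lemma pr_vac [simp]: "app (pr P) vac = vac"
  by (auto simp: fun_apply fun_eq_iff app_pr vac_def)

text \<open>The contractions of the three-form with coefficients c by two, one and no basis vectors, as operators
  of exterior multiplication; Qop and Xop carry the extra factors 2 and 6.\<close>

definition Lop :: "nat set \<Rightarrow> (nat \<Rightarrow> nat \<Rightarrow> nat \<Rightarrow> 'r::comm_ring_1) \<Rightarrow> nat \<Rightarrow> nat \<Rightarrow> 'r extop" where
  "Lop P c u v = (\<Sum>k\<in>P. th k * ka (c u v k))"

definition Qop :: "nat set \<Rightarrow> (nat \<Rightarrow> nat \<Rightarrow> nat \<Rightarrow> 'r::comm_ring_1) \<Rightarrow> nat \<Rightarrow> 'r extop" where
  "Qop P c u = (\<Sum>j\<in>P. th j * Lop P c u j)"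

definition Xop :: "nat set \<Rightarrow> (nat \<Rightarrow> nat \<Rightarrow> nat \<Rightarrow> 'r::comm_ring_1) \<Rightarrow> 'r extop" where
  "Xop P c = (\<Sum>i\<in>P. th i * Qop P c i)"

lemma th_th_assoc: "th a * (th b * F) = - (th b * (th a * F))"
  by (simp add: mult.assoc[symmetric] th_th[of a b])

lemma commute_sum_op:
  fixes F :: "'i \<Rightarrow> 'r::comm_ring_1 extop"
  assumes "\<And>k. F k * G = G * F k" shows "sum F A * G = G * sum F A"
  by (simp add: sum_distrib_left sum_distrib_right assms)

lemma anticommute_sum_op:
  fixes F :: "'i \<Rightarrow> 'r::comm_ring_1 extop"
  assumes "\<And>k. F k * G = - (G * F k)" shows "sum F A * G = - (G * sum F A)"
  by (simp add: sum_distrib_left sum_distrib_right assms sum_negf)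

lemma anticommute_mult_op:
  fixes F G H :: "'r::comm_ring_1 extop"
  shows "F * H = - (H * F) \<Longrightarrow> G * H = H * G \<Longrightarrow> F * G * H = - (H * (F * G))"
    and "F * H = - (H * F) \<Longrightarrow> G * H = - (H * G) \<Longrightarrow> F * G * H = H * (F * G)"
    and "F * H = H * F \<Longrightarrow> G * H = - (H * G) \<Longrightarrow> F * G * H = - (H * (F * G))"
    and "F * H = H * F \<Longrightarrow> G * H = H * G \<Longrightarrow> F * G * H = H * (F * G)"
proof -
  have *: "F * G * H = F * (G * H)" "F * (H * G) = F * H * G" by (simp_all add: mult.assoc)
  show "F * H = - (H * F) \<Longrightarrow> G * H = H * G \<Longrightarrow> F * G * H = - (H * (F * G))"
    and "F * H = - (H * F) \<Longrightarrow> G * H = - (H * G) \<Longrightarrow> F * G * H = H * (F * G)"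
    and "F * H = H * F \<Longrightarrow> G * H = - (H * G) \<Longrightarrow> F * G * H = - (H * (F * G))"
    and "F * H = H * F \<Longrightarrow> G * H = H * G \<Longrightarrow> F * G * H = H * (F * G)"
    unfolding *(1) by (simp_all add: *(2)) (simp_all add: mult.assoc)
qed

text \<open>Parity decides every commutation sign below: L is a one-form and odd, Q a two-form and
  even, X a three-form and odd. The proofs climb this tower through the defining sums.\<close>

lemma Lop_th: "Lop P c u v * th a = - (th a * Lop P c u v)"
  unfolding Lop_def
  by (intro anticommute_sum_op anticommute_mult_op(1) th_th th_ka[symmetric])

lemma Qop_th: "Qop P c u * th a = th a * Qop P c u"
  unfolding Qop_def
  by (intro commute_sum_op anticommute_mult_op(2) th_th Lop_th)

lemma Xop_th: "Xop P c * th a = - (th a * Xop P c)"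
  unfolding Xop_def
  by (intro anticommute_sum_op anticommute_mult_op(1) th_th Qop_th)

lemma ka_ka: "ka r * ka s = ka s * ka r"
  by (simp add: ka_mult mult.commute)

lemma Lop_ka: "Lop P c u v * ka r = ka r * Lop P c u v"
  unfolding Lop_def by (intro commute_sum_op anticommute_mult_op(4) th_ka ka_ka)

lemma Qop_ka: "Qop P c u * ka r = ka r * Qop P c u"
  unfolding Qop_def by (intro commute_sum_op anticommute_mult_op(4) th_ka Lop_ka)

lemma Xop_ka: "Xop P c * ka r = ka r * Xop P c"
  unfolding Xop_def by (intro commute_sum_op anticommute_mult_op(4) th_ka Qop_ka)

lemma th_Lop: "th a * Lop P c u v = - (Lop P c u v * th a)"
  by (simp add: Lop_th)

lemma Lop_Lop: "Lop P c u v * Lop P' c' u' v' = - (Lop P' c' u' v' * Lop P c u v)"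
  unfolding Lop_def[of P]
  by (intro anticommute_sum_op anticommute_mult_op(1) th_Lop Lop_ka[symmetric])

lemma Qop_Lop: "Qop P c u * Lop P' c' v w = Lop P' c' v w * Qop P c u"
  unfolding Qop_def by (intro commute_sum_op anticommute_mult_op(2) th_Lop Lop_Lop)

lemma Qop_Qop: "Qop P c u * Qop P' c' w = Qop P' c' w * Qop P c u"
  unfolding Qop_def[of P]
  by (intro commute_sum_op anticommute_mult_op(4) Qop_th[symmetric] Qop_Lop[symmetric])

lemma Xop_Lop: "Xop P c * Lop P' c' u v = - (Lop P' c' u v * Xop P c)"
  unfolding Xop_def
  by (intro anticommute_sum_op anticommute_mult_op(1) th_Lop Qop_Lop)

lemma Xop_Qop: "Xop P c * Qop P' c' u = Qop P' c' u * Xop P c"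
  unfolding Xop_def
  by (intro commute_sum_op anticommute_mult_op(4) Qop_th[symmetric] Qop_Qop)

lemma th_Xop: "th a * Xop P c = - (Xop P c * th a)"
  by (simp add: Xop_th)

lemma Xop_Xop: "Xop P c * Xop P' c' = - (Xop P' c' * Xop P c)"
  unfolding Xop_def[of P]
  by (intro anticommute_sum_op anticommute_mult_op(1) th_Xop Xop_Qop[symmetric])

section \<open>Contraction of the three-form and of its contractions\<close>

locale alternating3 =
  fixes c :: "nat \<Rightarrow> nat \<Rightarrow> nat \<Rightarrow> 'r::comm_ring_1" and P :: "nat set"
  assumes c12: "c j i k = - c i j k" and c23: "c i k j = - c i j k" and finP: "finite P"
begin

abbreviation "L \<equiv> Lop P c"
abbreviation "Q \<equiv> Qop P c"
abbreviation "X \<equiv> Xop P c"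

lemma L_swap: "L v u = - L u v"
  by (simp add: Lop_def c12[of v u] ka_uminus sum_negf)

lemma io_L: "w \<in> P \<Longrightarrow> io w * L u v = ka (c u v w) - L u v * io w"
proof -
  assume w: "w \<in> P"
  have "io w * (th k * ka (c u v k)) = (if k = w then ka (c u v w) else 0) - th k * ka (c u v k) * io w" for k
    by (simp add: mult.assoc[symmetric] io_th left_diff_distrib)
      (simp add: mult.assoc io_ka)
  then show ?thesis
    using w finP by (simp add: Lop_def sum_distrib_left sum_distrib_right sum_subtractf)
qed

text \<open>Contracting either letter of Q yields the same one-form, because the sign from passing
  the first letter is undone by the antisymmetry of \<open>c\<close>; hence the 2. Three such equal
  hits give the 3 in \<open>io_X\<close>.\<close>

lemma io_Q: "w \<in> P \<Longrightarrow> io w * Q u = 2 * L u w + Q u * io w"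
proof -
  assume w: "w \<in> P"
  have "io w * (th j * L u j) = (if j = w then L u w else 0) + th j * ka (c u w j) + th j * L u j * io w" for j
  proof -
    have "io w * (th j * L u j) = (if j = w then L u w else 0) - th j * (io w * L u j)"
      by (simp add: mult.assoc[symmetric] io_th left_diff_distrib)
    moreover have "ka (c u j w) = - ka (c u w j)"
      by (subst c23) (rule ka_uminus)
    ultimately show ?thesis
      unfolding io_L[OF w] by (simp only: right_diff_distrib mult_minus_right mult.assoc) simp
  qed
  then show ?thesis
    using w finP by (simp add: Qop_def Lop_def[of P c u w] sum_distrib_left sum_distrib_right sum.distrib mult_2)
qed

lemma io_X: "w \<in> P \<Longrightarrow> io w * X = 3 * Q w - X * io w"
proof -
  assume w: "w \<in> P"
  have "io w * (th i * Q i) = (if i = w then Q w else 0) + 2 * (th i * L w i) - th i * Q i * io w" for i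
  proof -
    have "io w * (th i * Q i) = (if i = w then Q w else 0) - th i * (io w * Q i)"
      by (simp add: mult.assoc[symmetric] io_th left_diff_distrib)
    moreover have "th i * (2 * L i w) = - (2 * (th i * L w i))"
      by (subst L_swap) (simp add: mult_2 distrib_left)
    ultimately show ?thesis
      unfolding io_Q[OF w] by (simp add: distrib_left mult.assoc)
  qed
  then have "io w * X = Q w + 2 * (\<Sum>i\<in>P. th i * L w i) - X * io w"
    using w finP by (simp add: Xop_def sum_distrib_left sum_distrib_right sum.distrib sum_subtractf)
  also have "\<dots> = 3 * Q w - X * io w"
  proof -
    have "(3 :: 'r extop) = 1 + 2" by simp
    then show ?thesis by (simp only: Qop_def[symmetric] distrib_right mult_1_left)
  qed
  finally show ?thesis .
qed

end

section \<open>Products of degree seven modulo the cubics\<close>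

text \<open>Everything built from the unit by letters, scalars and sums. An operator commuting with
  letters and scalars is determined here by its value at \<open>vac\<close>, which is all that the
  cubics provide; functions with infinitely many nonzero coefficients are out of reach.\<close>

inductive_set M0 :: "(nat set \<Rightarrow> 'r::comm_ring_1) set" where
  ka: "app (ka r) vac \<in> M0"
| th: "f \<in> M0 \<Longrightarrow> app (th a) f \<in> M0"
| add: "f \<in> M0 \<Longrightarrow> g \<in> M0 \<Longrightarrow> f + g \<in> M0"

lemma assoc_rule: "A * B = C \<Longrightarrow> A * (B * F) = C * F" for A :: "'b::semigroup_mult"
  by (simp add: mult.assoc[symmetric])

lemma app_of_nat: "app (of_nat k) f S = of_nat k * f S"
  by (simp add: ka_of_nat[symmetric] app_ka)

text \<open>\<open>J_div\<close> packages characteristic zero: the integers produced by contraction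
  can be cancelled inside the ideal.\<close>

locale cubic_ideal = alternating3 c P for c :: "nat \<Rightarrow> nat \<Rightarrow> nat \<Rightarrow> 'r::comm_ring_1" and P :: "nat set" +
  fixes J :: "'r set"
  assumes J_0: "0 \<in> J" and J_add: "x \<in> J \<Longrightarrow> y \<in> J \<Longrightarrow> x + y \<in> J"
    and J_mult: "x \<in> J \<Longrightarrow> r * x \<in> J"
    and J_div: "of_nat (Suc k) * x \<in> J \<Longrightarrow> x \<in> J"
    and J_cubics: "u \<in> P \<Longrightarrow> v \<in> P \<Longrightarrow> w \<in> P \<Longrightarrow> app (Q u * (Q v * Q w)) vac S \<in> J"
begin

lemma J_uminus: "x \<in> J \<Longrightarrow> - x \<in> J"
  using J_mult[of x "-1"] by simp

lemma J_diff: "x \<in> J \<Longrightarrow> y \<in> J \<Longrightarrow> x - y \<in> J"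
  using J_add[of x "- y"] J_uminus[of y] by simp

lemma J_sum: "(\<And>i. i \<in> A \<Longrightarrow> f i \<in> J) \<Longrightarrow> sum f A \<in> J"
  by (induction A rule: infinite_finite_induct) (simp_all add: J_0 J_add)

definition "MJ = {f :: nat set \<Rightarrow> 'r. \<forall>S. f S \<in> J}"

text \<open>Contractions belong to \<open>Alg\<close> as well as multiplications, and
  \<open>NN\<close> is a two-sided ideal relative to \<open>Alg\<close>. So a relation may be
  contracted and multiplied from both sides.\<close>

definition "Alg = {F. (\<forall>f\<in>M0. app F f \<in> M0) \<and> (\<forall>f\<in>MJ. app F f \<in> MJ)}"

definition "NN = {F. \<forall>f\<in>M0. app F f \<in> MJ}"

lemma MJ_0: "0 \<in> MJ" and MJ_add: "f \<in> MJ \<Longrightarrow> g \<in> MJ \<Longrightarrow> f + g \<in> MJ"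
  and MJ_uminus: "f \<in> MJ \<Longrightarrow> - f \<in> MJ" and MJ_diff: "f \<in> MJ \<Longrightarrow> g \<in> MJ \<Longrightarrow> f - g \<in> MJ"
  by (auto simp: MJ_def fun_apply J_0 J_add J_uminus J_diff)

lemma MJ_sum: "(\<And>i. i \<in> A \<Longrightarrow> f i \<in> MJ) \<Longrightarrow> sum f A \<in> MJ"
  by (auto simp: MJ_def sum_fun_apply intro: J_sum)

lemma MJ_th: "f \<in> MJ \<Longrightarrow> app (th a) f \<in> MJ" and MJ_io: "f \<in> MJ \<Longrightarrow> app (io a) f \<in> MJ"
  and MJ_ka: "f \<in> MJ \<Longrightarrow> app (ka r) f \<in> MJ" and MJ_pr: "f \<in> MJ \<Longrightarrow> app (pr A) f \<in> MJ"
  by (auto simp: MJ_def app_th app_io app_ka app_pr J_0 J_mult)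

lemma M0_0: "0 \<in> M0"
  using M0.ka[of 0] by simp

lemma M0_ka: "f \<in> M0 \<Longrightarrow> app (ka r) f \<in> M0"
proof (induction rule: M0.induct)
  case (ka s)
  show ?case using M0.ka[of "r * s"] by (simp add: ka_mult[symmetric])
next
  case (th f a)
  have "app (ka r) (app (th a) f) = app (th a) (app (ka r) f)"
    by (simp only: app_simps(6)[symmetric] th_ka)
  then show ?case using M0.th[OF th.IH] by simp
qed (simp add: M0.add)

lemma M0_uminus: "f \<in> M0 \<Longrightarrow> - f \<in> M0"
  using M0_ka[of f "-1"] by (simp add: ka_uminus)

lemma M0_io: "f \<in> M0 \<Longrightarrow> app (io a) f \<in> M0"
proof (induction rule: M0.induct)
  case (ka s)
  have "app (io a) (app (ka s) vac) = app (ka s) (app (io a) vac)"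
    by (simp only: app_simps(6)[symmetric] io_ka)
  then show ?case by (simp add: M0_0)
next
  case (th f b)
  have "app (io a) (app (th b) f) = app ((if a = b then 1 else 0) - th b * io a) f"
    by (simp only: app_simps(6)[symmetric] io_th)
  also have "\<dots> = (if a = b then f else 0) + - app (th b) (app (io a) f)"
    by simp
  also have "\<dots> \<in> M0"
    using th by (intro M0.add M0_uminus M0.th) (auto simp: M0_0)
  finally show ?case .
qed (simp add: M0.add)

lemma Alg_add: "F \<in> Alg \<Longrightarrow> G \<in> Alg \<Longrightarrow> F + G \<in> Alg"
  by (auto simp: Alg_def intro: M0.add MJ_add)

lemma Alg_0: "0 \<in> Alg"
  by (auto simp: Alg_def intro: M0_0 MJ_0)

lemma Alg_mult: "F \<in> Alg \<Longrightarrow> G \<in> Alg \<Longrightarrow> F * G \<in> Alg"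
  by (auto simp: Alg_def)

lemma Alg_sum: "(\<And>i. i \<in> A \<Longrightarrow> F i \<in> Alg) \<Longrightarrow> sum F A \<in> Alg"
  by (induction A rule: infinite_finite_induct) (simp_all add: Alg_0 Alg_add)

lemma Alg_th: "th a \<in> Alg" and Alg_io: "io a \<in> Alg" and Alg_ka: "ka r \<in> Alg"
  by (auto simp: Alg_def intro: M0.th MJ_th M0_io MJ_io M0_ka MJ_ka)

lemma Alg_L: "L u v \<in> Alg"
  unfolding Lop_def by (intro Alg_sum Alg_mult Alg_th Alg_ka)

lemma Alg_Q: "Q u \<in> Alg"
  unfolding Qop_def by (intro Alg_sum Alg_mult Alg_th Alg_L)

lemma NN_0: "0 \<in> NN" and NN_add: "F \<in> NN \<Longrightarrow> G \<in> NN \<Longrightarrow> F + G \<in> NN"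
  and NN_uminus: "F \<in> NN \<Longrightarrow> - F \<in> NN" and NN_diff: "F \<in> NN \<Longrightarrow> G \<in> NN \<Longrightarrow> F - G \<in> NN"
  by (auto simp: NN_def intro: MJ_0 MJ_add MJ_uminus MJ_diff)

lemma NN_left: "F \<in> Alg \<Longrightarrow> G \<in> NN \<Longrightarrow> F * G \<in> NN"
  and NN_right: "G \<in> NN \<Longrightarrow> F \<in> Alg \<Longrightarrow> G * F \<in> NN"
  by (auto simp: NN_def Alg_def)

lemma NN_sum: "(\<And>i. i \<in> A \<Longrightarrow> F i \<in> NN) \<Longrightarrow> sum F A \<in> NN"
  by (induction A rule: infinite_finite_induct) (simp_all add: NN_0 NN_add)

lemma NN_div: "of_nat (Suc k) * F \<in> NN \<Longrightarrow> F \<in> NN"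
  using J_div by (auto simp: NN_def MJ_def app_of_nat simp del: of_nat_Suc)

lemma NN_twice: "F + F \<in> NN \<Longrightarrow> F \<in> NN"
  using NN_div[of 1 F] by (simp add: mult_2)

lemma NN_uminus_iff: "- F \<in> NN \<longleftrightarrow> F \<in> NN"
  using NN_uminus[of F] NN_uminus[of "- F"] by auto

text \<open>Contraction is an odd derivation; hence the graded commutators with it preserve the ideal.\<close>

lemma NN_io: "F \<in> NN \<Longrightarrow> io w * F + F * io w \<in> NN"
  by (intro NN_add NN_left NN_right Alg_io)

text \<open>The hypothesis on J concerns \<open>vac\<close> only. A product of two-forms commutes
  with letters and scalars, which carries it to all of \<open>M0\<close>.\<close>

lemma QQQ_NN:
  assumes "u \<in> P" "v \<in> P" "w \<in> P"
  shows "Q u * (Q v * Q w) \<in> NN"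
proof -
  let ?F = "Q u * (Q v * Q w)"
  have th: "?F * th a = th a * ?F" for a
    by (simp add: mult.assoc Qop_th assoc_rule[OF Qop_th])
  have ka: "?F * ka r = ka r * ?F" for r
    by (simp add: mult.assoc Qop_ka assoc_rule[OF Qop_ka])
  have "app ?F f \<in> MJ" if "f \<in> M0" for f
    using that
  proof (induction rule: M0.induct)
    case (ka r)
    have "app ?F (app (ka r) vac) = app (ka r) (app ?F vac)"
      using \<open>?F * ka r = ka r * ?F\<close> by (metis app_simps(6))
    moreover have "app ?F vac \<in> MJ" using J_cubics assms by (simp add: MJ_def)
    ultimately show ?case by (simp only: MJ_ka)
  next
    case (th f a)
    have "app ?F (app (th a) f) = app (th a) (app ?F f)"
      using \<open>?F * th a = th a * ?F\<close> by (metis app_simps(6))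
    then show ?case using MJ_th[OF th.IH] by (simp only:)
  next
    case (add f g)
    then show ?case by (simp only: app_add MJ_add)
  qed
  then show ?thesis by (simp add: NN_def)
qed

lemma io_Q_sum: "w \<in> P \<Longrightarrow> io w * Q u = L u w + L u w + Q u * io w"
  by (simp add: io_Q mult_2)

lemma io_X_sum: "w \<in> P \<Longrightarrow> io w * X = Q w + Q w + Q w - X * io w"
proof -
  have "(3 :: 'r extop) = 1 + 1 + 1" by simp
  then show "w \<in> P \<Longrightarrow> ?thesis" by (simp only: io_X distrib_right mult_1_left)
qed

lemma L_X: "L u v * X = - (X * L u v)" and L_Q: "L u v * Q w = Q w * L u v" and Q_X: "Q u * X = X * Q u"
  by (simp_all add: Xop_Lop Qop_Lop Xop_Qop)

lemmas normal_order = L_X L_Q Q_X assoc_rule[OF L_X] assoc_rule[OF L_Q] assoc_rule[OF Q_X]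
  Lop_ka Qop_ka Xop_ka assoc_rule[OF Lop_ka] assoc_rule[OF Qop_ka] assoc_rule[OF Xop_ka]
lemmas io_rules = io_L io_Q_sum io_X_sum assoc_rule[OF io_L] assoc_rule[OF io_Q_sum] assoc_rule[OF io_X_sum]
  io_ka assoc_rule[OF io_ka]

lemma XQQ_NN: "u \<in> P \<Longrightarrow> v \<in> P \<Longrightarrow> X * (Q u * Q v) \<in> NN"
  unfolding Xop_def sum_distrib_right mult.assoc
  by (intro NN_sum NN_left Alg_th QQQ_NN)

text \<open>Contracting X Q Q with w gives three times Q Q Q, already known, minus twice the sum in
  question. Thus X Q L is skew in two of its indices modulo \<open>NN\<close>, which feeds the
  exchange argument below.\<close>

lemma XQL_NN:
  assumes "u \<in> P" "v \<in> P" "w \<in> P"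
  shows "X * (Q v * L u w) + X * (Q u * L v w) \<in> NN" (is "?A \<in> NN")
proof -
  let ?D = "io w * (X * (Q u * Q v)) + X * (Q u * Q v) * io w"
  let ?B = "Q w * (Q u * Q v)"
  have eq: "?D = ?B + ?B + ?B - (?A + ?A)"
    using assms by (simp add: io_rules normal_order algebra_simps)
  have "?B + ?B + ?B - ?D \<in> NN"
    using assms by (intro NN_diff NN_add QQQ_NN NN_io XQQ_NN)
  then have "?A + ?A \<in> NN" unfolding eq by (simp add: algebra_simps)
  then show ?thesis by (rule NN_twice)
qed

text \<open>If h is antisymmetric under a and b, under g and d, under v and a, and changes sign when the pairs (a,b)
  and (g,d) are exchanged, it is totally antisymmetric in its five indices;
  since the exchange of the pairs is an even permutation, it vanishes.\<close>

lemma pair_exchange_NN: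
  assumes ab: "\<And>v a b g d. h v b a g d = - h v a b g d" and cd: "\<And>v a b g d. h v a b d g = - h v a b g d"
    and ex: "\<And>v a b g d. h v g d a b = - h v a b g d"
    and sw: "\<And>v a b g d. v \<in> P \<Longrightarrow> a \<in> P \<Longrightarrow> b \<in> P \<Longrightarrow> g \<in> P \<Longrightarrow> d \<in> P \<Longrightarrow> h v a b g d + h a v b g d \<in> NN"
    and P: "v \<in> P" "a \<in> P" "b \<in> P" "g \<in> P" "d \<in> P"
  shows "h v a b g d \<in> NN"
proof -
  \<comment> \<open>The exchange of a and g is composed of three exchanges with the first index;
    \<open>ex\<close> rewrites the intermediate terms so that they cancel.\<close>
  have ac: "h v a b g d + h v g b a d \<in> NN" if P: "v \<in> P" "a \<in> P" "b \<in> P" "g \<in> P" "d \<in> P" for v a b g d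
  proof -
    have 1: "h v a b g d + h a v b g d \<in> NN" by (rule sw) (use P in auto)
    have 2: "h a g d v b + h g a d v b \<in> NN" by (rule sw) (use P in auto)
    have 3: "h g v b a d + h v g b a d \<in> NN" by (rule sw) (use P in auto)
    have "(h v a b g d + h a v b g d) + (h a g d v b + h g a d v b) + (h g v b a d + h v g b a d) \<in> NN"
      by (intro NN_add 1 2 3)
    moreover have "h a g d v b = - h a v b g d" "h g a d v b = - h g v b a d"
      by (rule ex)+
    ultimately show ?thesis by (simp add: algebra_simps)
  qed
  \<comment> \<open>The second instance exchanges b and d. One of its terms cancels against the
    exchange of a and g, the other is minus the original by \<open>ex\<close>, so twice
    \<open>h\<close> remains.\<close>
  have "(h v a b g d + h v g b a d) - (h v b g d a + h v d g b a) \<in> NN"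
    by (intro NN_diff ac P)
  moreover have "h v b g d a = h v g b a d"
    by (simp add: ab[of v g b] cd[of v _ _ a d])
  moreover have "h v d g b a = - h v a b g d"
    by (simp add: ex[of v b a d g] ab[of v a b] cd[of v _ _ g d])
  ultimately have "h v a b g d + h v a b g d \<in> NN" by simp
  then show ?thesis by (rule NN_twice)
qed

text \<open>One-forms anticommute, which supplies the sign for the exchange of the pairs;
  \<open>XQL_NN\<close> supplies the swap with the first index.\<close>

lemma XQLL_NN:
  assumes "v \<in> P" "a \<in> P" "b \<in> P" "c' \<in> P" "d \<in> P"
  shows "X * (Q v * (L a b * L c' d)) \<in> NN"
proof (rule pair_exchange_NN[where h = "\<lambda>v a b c d. X * (Q v * (L a b * L c d))", OF _ _ _ _ assms])
  fix v a b c' d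
  show "X * (Q v * (L b a * L c' d)) = - (X * (Q v * (L a b * L c' d)))" by (subst L_swap) simp
  show "X * (Q v * (L a b * L d c')) = - (X * (Q v * (L a b * L c' d)))" by (subst L_swap[of d]) simp
  show "X * (Q v * (L c' d * L a b)) = - (X * (Q v * (L a b * L c' d)))" by (subst Lop_Lop) simp
  assume "v \<in> P" "a \<in> P" "b \<in> P"
  then have "(X * (Q v * L a b) + X * (Q a * L v b)) * L c' d \<in> NN"
    by (intro NN_right Alg_L XQL_NN)
  then show "X * (Q v * (L a b * L c' d)) + X * (Q a * (L v b * L c' d)) \<in> NN"
    by (simp add: distrib_right mult.assoc)
qed

text \<open>Contraction takes X Q L L to degree six and the extra factor \<open>L e f\<close>
  restores seven, so the terms where the contraction meets an L are scalar multiples of the known X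
  Q L L. The hits on X and Q leave the factors 3 and 2.\<close>

lemma QQLLL_XLLLL_aux:
  assumes "u \<in> P" "v \<in> P" "a \<in> P" "b \<in> P" "c' \<in> P" "d \<in> P" "e \<in> P" "f \<in> P"
  defines "Y \<equiv> L a b * (L c' d * L e f)"
  shows "(Q u * (Q v * Y) + Q u * (Q v * Y) + Q u * (Q v * Y)) - (X * (L v u * Y) + X * (L v u * Y)) \<in> NN"
    (is "?G \<in> NN")
proof -
  let ?A = "X * (Q v * (L a b * L c' d))"
  let ?K = "ka (c a b u) * (X * (Q v * (L c' d * L e f))) - ka (c c' d u) * (X * (Q v * (L a b * L e f)))"
  have eq: "(io u * ?A + ?A * io u) * L e f = ?G - ?K"
    using assms by (simp add: io_rules normal_order algebra_simps)
  have "(io u * ?A + ?A * io u) * L e f + ?K \<in> NN"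
    using assms by (intro NN_add NN_diff NN_right[OF NN_io] NN_left Alg_ka Alg_L XQLL_NN)
  then show ?thesis unfolding eq by simp
qed

text \<open>Adding the relation with u and v exchanged cancels the X terms, since
  \<open>L v u\<close> is skew while the product of the two Q is symmetric; six copies
  remain.\<close>

lemma QQLLL_NN:
  assumes "u \<in> P" "v \<in> P" "a \<in> P" "b \<in> P" "c' \<in> P" "d \<in> P" "e \<in> P" "f \<in> P"
  shows "Q u * (Q v * (L a b * (L c' d * L e f))) \<in> NN"
proof -
  let ?Y = "L a b * (L c' d * L e f)"
  let ?A = "Q u * (Q v * ?Y)"
  have "Q v * (Q u * ?Y) = ?A"
    by (simp add: mult.assoc[symmetric] Qop_Qop[of P c v P c u])
  moreover have "X * (L u v * ?Y) = - (X * (L v u * ?Y))"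
    by (subst L_swap) simp
  ultimately have "?A + ?A + ?A + (?A + ?A + ?A) \<in> NN"
    using NN_add[OF QQLLL_XLLLL_aux[OF assms] QQLLL_XLLLL_aux[OF assms(2,1,3-8)]]
    by (simp add: algebra_simps)
  moreover have "of_nat (Suc 5) = (1 + 1 + 1 + (1 + 1 + 1) :: 'r extop)"
    by simp
  ultimately have "of_nat (Suc 5) * ?A \<in> NN"
    by (simp only: distrib_right mult_1_left)
  then show ?thesis by (rule NN_div)
qed

lemma XLLLL_NN:
  assumes "u \<in> P" "v \<in> P" "a \<in> P" "b \<in> P" "c' \<in> P" "d \<in> P" "e \<in> P" "f \<in> P"
  shows "X * (L u v * (L a b * (L c' d * L e f))) \<in> NN"
proof -
  let ?A = "Q v * (Q u * (L a b * (L c' d * L e f)))"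
  let ?B = "X * (L u v * (L a b * (L c' d * L e f)))"
  have "(?A + ?A + ?A) - ((?A + ?A + ?A) - (?B + ?B)) \<in> NN"
    using assms by (intro NN_diff[OF _ QQLLL_XLLLL_aux] NN_add QQLLL_NN)
  then have "?B + ?B \<in> NN" by simp
  then show ?thesis by (rule NN_twice)
qed

text \<open>The same device applied to Q Q L L L: the contraction with w hits each Q once with
  factor 2, and the factor \<open>L i j\<close> makes the stray terms \<open>?K\<close> multiples of
  Q Q L L L again.\<close>

lemma QLLLLL_swap:
  assumes "u \<in> P" "v \<in> P" "w \<in> P" "a \<in> P" "b \<in> P" "c' \<in> P" "d \<in> P" "e \<in> P" "f \<in> P" "i \<in> P" "j \<in> P"
  defines "Y \<equiv> L a b * (L c' d * (L e f * L i j))"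
  shows "Q v * (L u w * Y) + Q u * (L v w * Y) \<in> NN" (is "?G \<in> NN")
proof -
  let ?A = "Q u * (Q v * (L a b * (L c' d * L e f)))"
  let ?K = "ka (c a b w) * (Q u * (Q v * (L c' d * (L e f * L i j))))
    - ka (c c' d w) * (Q u * (Q v * (L a b * (L e f * L i j))))
    + ka (c e f w) * (Q u * (Q v * (L a b * (L c' d * L i j))))"
  have eq: "(io w * ?A + ?A * io w) * L i j = ?G + ?G + ?K"
    using assms by (simp add: io_rules normal_order algebra_simps)
  have "(io w * ?A + ?A * io w) * L i j - ?K \<in> NN"
    using assms by (intro NN_add NN_diff NN_right[OF NN_io] NN_left Alg_ka Alg_L QQLLL_NN)
  then have "?G + ?G \<in> NN" unfolding eq by simp
  then show ?thesis by (rule NN_twice)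
qed

lemma QLLLLL_NN:
  assumes "v \<in> P" "a \<in> P" "b \<in> P" "c' \<in> P" "d \<in> P" "e \<in> P" "f \<in> P" "i \<in> P" "j \<in> P" "k \<in> P" "l \<in> P"
  shows "Q v * (L a b * (L c' d * (L e f * (L i j * L k l)))) \<in> NN"
proof (rule pair_exchange_NN[where h = "\<lambda>v a b c d. Q v * (L a b * (L c d * (L e f * (L i j * L k l))))",
      OF _ _ _ _ assms(1-5)])
  fix v a b c' d
  let ?Y = "L e f * (L i j * L k l)"
  show "Q v * (L b a * (L c' d * ?Y)) = - (Q v * (L a b * (L c' d * ?Y)))" by (subst L_swap) simp
  show "Q v * (L a b * (L d c' * ?Y)) = - (Q v * (L a b * (L c' d * ?Y)))" by (subst L_swap[of d]) simp
  show "Q v * (L c' d * (L a b * ?Y)) = - (Q v * (L a b * (L c' d * ?Y)))"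
    by (subst assoc_rule[OF Lop_Lop]) (simp add: mult.assoc)
  assume "v \<in> P" "a \<in> P" "b \<in> P" "c' \<in> P" "d \<in> P"
  then show "Q v * (L a b * (L c' d * ?Y)) + Q a * (L v b * (L c' d * ?Y)) \<in> NN"
    using assms by (intro QLLLLL_swap)
qed

lemma LLLLLLL_NN:
  assumes "v \<in> P" "w \<in> P" "a \<in> P" "b \<in> P" "c' \<in> P" "d \<in> P" "e \<in> P" "f \<in> P" "i \<in> P" "j \<in> P" "k \<in> P" "l \<in> P"
    "s \<in> P" "t \<in> P"
  shows "L v w * (L a b * (L c' d * (L e f * (L i j * (L k l * L s t))))) \<in> NN" (is "?G \<in> NN")
proof -
  let ?A = "Q v * (L a b * (L c' d * (L e f * (L i j * L k l))))"
  let ?K = "ka (c a b w) * (Q v * (L c' d * (L e f * (L i j * (L k l * L s t)))))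
    - ka (c c' d w) * (Q v * (L a b * (L e f * (L i j * (L k l * L s t)))))
    + ka (c e f w) * (Q v * (L a b * (L c' d * (L i j * (L k l * L s t)))))
    - ka (c i j w) * (Q v * (L a b * (L c' d * (L e f * (L k l * L s t)))))
    + ka (c k l w) * (Q v * (L a b * (L c' d * (L e f * (L i j * L s t)))))"
  have eq: "(io w * ?A + ?A * io w) * L s t = ?G + ?G + ?K"
    using assms by (simp add: io_rules normal_order algebra_simps)
  have "(io w * ?A + ?A * io w) * L s t - ?K \<in> NN"
    using assms by (intro NN_add NN_diff NN_right[OF NN_io] NN_left Alg_ka Alg_L QLLLLL_NN)
  then have "?G + ?G \<in> NN" unfolding eq by simp
  then show ?thesis by (rule NN_twice)
qed

end

text \<open>Words are kept as syntax because the degree and the indices of a product cannot be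
  recovered from the operator it denotes.\<close>

datatype extgen = GX | GQ nat | GL nat nat

fun gop :: "nat set \<Rightarrow> (nat \<Rightarrow> nat \<Rightarrow> nat \<Rightarrow> 'r::comm_ring_1) \<Rightarrow> extgen \<Rightarrow> 'r extop" where
  "gop P c GX = Xop P c"
| "gop P c (GQ u) = Qop P c u"
| "gop P c (GL u v) = Lop P c u v"

fun gdeg :: "extgen \<Rightarrow> nat" where
  "gdeg GX = 3"
| "gdeg (GQ u) = 2"
| "gdeg (GL u v) = 1"

fun gind :: "extgen \<Rightarrow> nat set" where
  "gind GX = {}"
| "gind (GQ u) = {u}"
| "gind (GL u v) = {u, v}"

definition gprod :: "nat set \<Rightarrow> (nat \<Rightarrow> nat \<Rightarrow> nat \<Rightarrow> 'r::comm_ring_1) \<Rightarrow> extgen list \<Rightarrow> 'r extop" where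
  "gprod P c gs = prod_list (map (gop P c) gs)"

section \<open>Normal ordering of words of degree seven\<close>

context cubic_ideal
begin

definition nprod :: "nat \<Rightarrow> nat list \<Rightarrow> (nat \<times> nat) list \<Rightarrow> 'r extop" where
  "nprod k qs ls = X ^ k * (prod_list (map Q qs) * prod_list (map (\<lambda>(u, v). L u v) ls))"

lemma Q_Xpow: "Q u * X ^ k = X ^ k * Q u"
  by (induction k) (simp_all add: assoc_rule[OF Q_X] mult.assoc)

lemma L_Xpow: "L u v * X ^ k = X ^ k * L u v \<or> L u v * X ^ k = - (X ^ k * L u v)"
proof (induction k)
  case (Suc k)
  have "L u v * X ^ Suc k = - (X * (L u v * X ^ k))"
    by (simp add: assoc_rule[OF L_X] mult.assoc)
  then show ?case using Suc by (auto simp: mult.assoc)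
qed simp

lemma L_Qs: "L u v * prod_list (map Q qs) = prod_list (map Q qs) * L u v"
  by (induction qs) (simp_all add: assoc_rule[OF L_Q] mult.assoc)

lemma gprod_nprod:
  assumes "\<forall>g\<in>set gs. gind g \<subseteq> P"
  shows "\<exists>k qs ls. (gprod P c gs = nprod k qs ls \<or> gprod P c gs = - nprod k qs ls)
    \<and> 3 * k + 2 * length qs + length ls = sum_list (map gdeg gs)
    \<and> set qs \<subseteq> P \<and> set ls \<subseteq> P \<times> P"
  using assms
proof (induction gs)
  case Nil
  show ?case
    by (rule exI[of _ 0], rule exI[of _ "[]"], rule exI[of _ "[]"]) (simp add: gprod_def nprod_def)
next
  case (Cons g gs)
  then obtain k qs ls where IH: "gprod P c gs = nprod k qs ls \<or> gprod P c gs = - nprod k qs ls"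
    and deg: "3 * k + 2 * length qs + length ls = sum_list (map gdeg gs)"
    and ind: "set qs \<subseteq> P" "set ls \<subseteq> P \<times> P"
    by auto
  have step: "\<exists>k' qs' ls'. (gprod P c (g # gs) = nprod k' qs' ls' \<or> gprod P c (g # gs) = - nprod k' qs' ls')
    \<and> 3 * k' + 2 * length qs' + length ls' = sum_list (map gdeg (g # gs))
    \<and> set qs' \<subseteq> P \<and> set ls' \<subseteq> P \<times> P"
    if "gop P c g * nprod k qs ls = nprod k' qs' ls' \<or> gop P c g * nprod k qs ls = - nprod k' qs' ls'"
      "3 * k' + 2 * length qs' + length ls' = gdeg g + (3 * k + 2 * length qs + length ls)"
      "set qs' \<subseteq> P" "set ls' \<subseteq> P \<times> P" for k' qs' ls'
  proof -
    have "gprod P c (g # gs) = gop P c g * gprod P c gs" by (simp add: gprod_def)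
    then have "gprod P c (g # gs) = nprod k' qs' ls' \<or> gprod P c (g # gs) = - nprod k' qs' ls'"
      using IH that(1) by auto
    then show ?thesis using that deg by (intro exI[of _ k'] exI[of _ qs'] exI[of _ ls']) simp
  qed
  show ?case
  proof (cases g)
    case GX
    show ?thesis
      by (rule step[of "Suc k" qs ls]) (use ind GX in \<open>simp_all add: nprod_def mult.assoc\<close>)
  next
    case (GQ u)
    have "Q u * nprod k qs ls = nprod k (u # qs) ls"
      by (simp add: nprod_def assoc_rule[OF Q_Xpow] mult.assoc)
    then show ?thesis
      by (intro step[of k "u # qs" ls]) (use ind GQ Cons.prems in simp_all)
  next
    case (GL u v)
    have "L u v * nprod k qs ls = nprod k qs ((u, v) # ls) \<or> L u v * nprod k qs ls = - nprod k qs ((u, v) # ls)"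
      using L_Xpow[of u v k]
    proof
      assume "L u v * X ^ k = X ^ k * L u v"
      from assoc_rule[OF this] show ?thesis by (simp add: nprod_def assoc_rule[OF L_Qs] mult.assoc)
    next
      assume "L u v * X ^ k = - (X ^ k * L u v)"
      from assoc_rule[OF this] show ?thesis by (simp add: nprod_def assoc_rule[OF L_Qs] mult.assoc)
    qed
    then show ?thesis
      by (intro step[of k qs "(u, v) # ls"]) (use ind GL Cons.prems in simp_all)
  qed
qed

lemma QQQL_NN: "u \<in> P \<Longrightarrow> v \<in> P \<Longrightarrow> w \<in> P \<Longrightarrow> Q u * (Q v * (Q w * L a b)) \<in> NN"
  using NN_right[OF QQQ_NN Alg_L] by (simp add: mult.assoc)

lemma nprod_NN:
  assumes deg: "3 * k + 2 * length qs + length ls = 7" and ind: "set qs \<subseteq> P" "set ls \<subseteq> P \<times> P"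
  shows "nprod k qs ls \<in> NN"
proof -
  have k: "k = 0 \<or> k = 1 \<or> k = 2" using deg by auto
  \<comment> \<open>The solutions of 3k + 2q + l = 7. For k = 2 the square of the odd operator X
    vanishes, and three factors Q give a multiple of a cubic; the other six shapes are the relations
    proved above.\<close>
  consider "k = 2" | "k = 1" "length qs = 2" "length ls = 0" | "k = 1" "length qs = 1" "length ls = 2"
    | "k = 1" "length qs = 0" "length ls = 4" | "k = 0" "length qs = 3" "length ls = 1"
    | "k = 0" "length qs = 2" "length ls = 3" | "k = 0" "length qs = 1" "length ls = 5"
    | "k = 0" "length qs = 0" "length ls = 7"
  proof -
    have "length qs \<le> 3" using deg by simp
    then have "length qs = 0 \<or> length qs = 1 \<or> length qs = 2 \<or> length qs = 3" by arith
    then show ?thesis using that k deg by auto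
  qed
  then show ?thesis
  proof cases
    case 1
    have "X * X + X * X = 0" using Xop_Xop[of P c P c] by (simp only: eq_neg_iff_add_eq_0)
    then have "X * X \<in> NN" using NN_twice[of "X * X"] NN_0 by (simp only:)
    moreover have "length qs = 0" "length ls = 1" using 1 deg by presburger+
    ultimately show ?thesis
      using 1 by (auto simp: nprod_def length_Suc_conv numeral_2_eq_2 mult.assoc[symmetric] intro!: NN_right Alg_L)
  next
    case 2
    then show ?thesis using ind by (auto simp: nprod_def length_Suc_conv numeral_eq_Suc intro!: XQQ_NN)
  next
    case 3
    then show ?thesis using ind by (auto simp: nprod_def length_Suc_conv numeral_eq_Suc intro!: XQLL_NN)
  next
    case 4
    then show ?thesis using ind by (auto simp: nprod_def length_Suc_conv numeral_eq_Suc intro!: XLLLL_NN)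
  next
    case 5
    then show ?thesis using ind
      by (auto simp: nprod_def length_Suc_conv numeral_eq_Suc mult.assoc intro!: QQQL_NN)
  next
    case 6
    then show ?thesis using ind by (auto simp: nprod_def length_Suc_conv numeral_eq_Suc mult.assoc intro!: QQLLL_NN)
  next
    case 7
    then show ?thesis using ind by (auto simp: nprod_def length_Suc_conv numeral_eq_Suc intro!: QLLLLL_NN)
  next
    case 8
    then show ?thesis using ind by (auto simp: nprod_def length_Suc_conv numeral_eq_Suc intro!: LLLLLLL_NN)
  qed
qed

lemma gprod_NN:
  assumes "\<forall>g\<in>set gs. gind g \<subseteq> P" "sum_list (map gdeg gs) = 7"
  shows "gprod P c gs \<in> NN"
proof -
  obtain k qs ls where "gprod P c gs = nprod k qs ls \<or> gprod P c gs = - nprod k qs ls"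
    and "3 * k + 2 * length qs + length ls = 7" "set qs \<subseteq> P" "set ls \<subseteq> P \<times> P"
    using gprod_nprod[OF assms(1)] assms(2) by auto
  then show ?thesis using nprod_NN[of k qs ls] by (auto simp: NN_uminus_iff)
qed

end

section \<open>The ideal of cubics and its stability under gl(W)\<close>

text \<open>Multipliers range over all polynomials, whatever their letters; the retraction to n
  letters later brings them into \<open>polyring n\<close>.\<close>

inductive_set cubJ :: "nat \<Rightarrow> 'a::comm_ring_1 mpoly3 set" for N where
  gen: "u < N \<Longrightarrow> v < N \<Longrightarrow> w < N \<Longrightarrow>
    app (Qop {..<N} wv u * (Qop {..<N} wv v * Qop {..<N} wv w)) vac S \<in> cubJ N"
| add: "p \<in> cubJ N \<Longrightarrow> q \<in> cubJ N \<Longrightarrow> p + q \<in> cubJ N"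
| mult: "p \<in> cubJ N \<Longrightarrow> r * p \<in> cubJ N"
| zero: "0 \<in> cubJ N"

lemma const3_inverse_mult:
  "const3 (inverse (of_nat (Suc k))) * (of_nat (Suc k) * p) = (p :: 'a::field_char_0 mpoly3)"
proof -
  have "const3 (inverse (of_nat (Suc k))) * (of_nat (Suc k) * p)
      = const3 (inverse (of_nat (Suc k)) * of_nat (Suc k)) * p"
    by (simp only: const3_simps const3_of_nat mult.assoc)
  also have "inverse (of_nat (Suc k)) * of_nat (Suc k) = (1 :: 'a)"
    by (rule left_inverse) (simp del: of_nat_Suc)
  finally show ?thesis by (simp add: const3_simps)
qed

interpretation cub: cubic_ideal "wv :: nat \<Rightarrow> nat \<Rightarrow> nat \<Rightarrow> 'a::field_char_0 mpoly3" "{..<N}" "cubJ N" for N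
proof
  show "x \<in> cubJ N" if "of_nat (Suc k) * x \<in> cubJ N" for k and x :: "'a mpoly3"
    using cubJ.mult[OF that, of "const3 (inverse (of_nat (Suc k)))"] by (simp only: const3_inverse_mult)
  show "app (Qop {..<N} wv u * (Qop {..<N} wv v * Qop {..<N} wv w)) vac S \<in> (cubJ N :: 'a mpoly3 set)"
    if "u \<in> {..<N}" "v \<in> {..<N}" "w \<in> {..<N}" for u v w S
    by (rule cubJ.gen) (use that in auto)
qed (auto intro: cubJ.intros wv_swap12 wv_swap23)

definition Eo :: "nat \<Rightarrow> nat \<Rightarrow> 'a::comm_ring_1 mpoly3 extop" where
  "Eo a b = lf (Eop a b)"

lemma app_Eo: "app (Eo a b) f S = Eop a b (f S)"
  unfolding Eo_def by (rule app_lf) (rule Eop_add)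

lemma Eop_esgn: "Eop a b (esgn x S * p) = esgn x S * Eop a b p"
proof -
  have "esgn x S = (1 :: 'a mpoly3) \<or> esgn x S = (- 1 :: 'a mpoly3)"
    by (simp add: esgn_def minus_one_power_iff)
  then show ?thesis by (auto simp: Eop_uminus)
qed

lemma Eo_th: "Eo a b * th x = th x * Eo a b"
  by (rule extop_eqI) (simp add: app_Eo app_th Eop_esgn)

lemma Eo_io: "Eo a b * io x = io x * Eo a b"
  by (rule extop_eqI) (simp add: app_Eo app_io Eop_esgn)

lemma Eo_pr: "Eo a b * pr A = pr A * Eo a b"
  by (rule extop_eqI) (simp add: app_Eo app_pr)

lemma Eo_ka: "Eo a b * ka r = ka r * Eo a b + ka (Eop a b r)"
  by (rule extop_eqI) (simp add: app_Eo app_ka fun_apply Eop_mult)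

lemma Eo_vac [simp]: "app (Eo a b) vac = 0"
  by (auto simp: fun_eq_iff app_Eo vac_def fun_apply)

lemma Eo_Eo: "Eo a b * Eo c d = Eo c d * Eo a b + (if b = c then Eo a d else 0) - (if d = a then Eo c b else 0)"
proof (rule extop_eqI)
  fix f :: "nat set \<Rightarrow> 'a mpoly3" and S
  show "app (Eo a b * Eo c d) f S =
      app (Eo c d * Eo a b + (if b = c then Eo a d else 0) - (if d = a then Eo c b else 0)) f S"
    using Eop_commutator[of a b c d "f S"] by (auto simp: app_Eo fun_apply algebra_simps)
qed

text \<open>\<open>Eo\<close> differentiates coefficients and leaves the exterior letters alone.
  Hence the last term: for k = b the index in the coefficient is replaced by a while its letter
  stays b.\<close>

lemma Eo_Lop:
  assumes "finite P"
  shows "(Eo a b :: 'a::comm_ring_1 mpoly3 extop) * Lop P wv u v = Lop P wv u v * Eo a b + (if u = b then Lop P wv a v else 0)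
    + (if v = b then Lop P wv u a else 0) + (if b \<in> P then th b * ka (wv u v a) else 0)"
proof -
  have "Eo a b * (th k * ka (wv u v k)) = th k * ka (wv u v k :: 'a mpoly3) * Eo a b
    + ((if u = b then th k * ka (wv a v k) else 0) + (if v = b then th k * ka (wv u a k) else 0)
    + (if k = b then th b * ka (wv u v a) else 0))" for k
  proof -
    have "Eo a b * (th k * ka (wv u v k)) = th k * (Eo a b * ka (wv u v k))"
      by (simp add: mult.assoc[symmetric] Eo_th)
    also have "\<dots> = th k * ka (wv u v k) * Eo a b + th k * ka (Eop a b (wv u v k))"
      by (simp add: Eo_ka distrib_left mult.assoc)
    also have "th k * ka (Eop a b (wv u v k)) = (if u = b then th k * ka (wv a v k) else 0)
      + (if v = b then th k * ka (wv u a k) else 0) + (if k = b then th b * ka (wv u v a) else 0)"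
      by (simp add: Eop_wv ka_add[symmetric] distrib_left)
    finally show ?thesis .
  qed
  then show ?thesis
    using assms by (simp add: Lop_def sum_distrib_left sum_distrib_right sum.distrib add.assoc)
qed

lemma sum_th_Lop: "(\<Sum>j\<in>P. th j * Lop P wv j a) = - Qop P wv a"
proof -
  have "Lop P wv j a = - (Lop P wv a j :: 'a mpoly3 extop)" for j
    by (simp add: Lop_def wv_swap12[of j a] ka_uminus sum_negf)
  then show ?thesis by (simp add: Qop_def sum_negf)
qed

lemma sum_th_ka: "(\<Sum>j\<in>P. th j * (th b * ka (wv u j a))) = th b * Lop P wv u a"
proof -
  have "th j * (th b * ka (wv u j a)) = th b * (th j * ka (wv u a j :: 'a mpoly3))" for j
    by (subst th_th_assoc) (simp add: wv_swap23[of u j a] ka_uminus)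
  then show ?thesis by (simp add: Lop_def sum_distrib_left)
qed

lemma Eo_Qop:
  assumes "finite P"
  shows "(Eo a b :: 'a::comm_ring_1 mpoly3 extop) * Qop P wv u = Qop P wv u * Eo a b + (if u = b then Qop P wv a else 0)
    + (if b \<in> P then th b * Lop P wv u a + th b * Lop P wv u a else 0)"
proof -
  have step: "Eo a b * (th j * Lop P wv u j) = th j * Lop P wv u j * (Eo a b :: 'a mpoly3 extop) + ((if u = b then th j * Lop P wv a j else 0)
    + ((if j = b then th b * Lop P wv u a else 0) + (if b \<in> P then th j * (th b * ka (wv u j a)) else 0)))" for j
  proof -
    have "Eo a b * (th j * Lop P wv u j) = th j * (Eo a b * Lop P wv u j)"
      by (simp add: mult.assoc[symmetric] Eo_th)
    then show ?thesis
      by (rule trans) (simp add: Eo_Lop[OF assms(1)] distrib_left mult.assoc add.assoc)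
  qed
  have "(Eo a b :: 'a mpoly3 extop) * Qop P wv u = (\<Sum>j\<in>P. Eo a b * (th j * Lop P wv u j))"
    by (simp add: Qop_def sum_distrib_left)
  also have "\<dots> = (\<Sum>j\<in>P. th j * Lop P wv u j * Eo a b) + ((if u = b then Qop P wv a else 0)
    + ((if b \<in> P then th b * Lop P wv u a else 0) + (if b \<in> P then \<Sum>j\<in>P. th j * (th b * ka (wv u j a)) else 0)))"
    using assms(1) by (simp only: step sum.distrib) (simp add: Qop_def)
  finally show ?thesis by (simp add: Qop_def sum_distrib_right sum_th_ka add.assoc)
qed

lemma Eo_Xop_fresh:
  assumes "finite P" "b \<notin> P"
  shows "(Eo a b :: 'a::comm_ring_1 mpoly3 extop) * Xop P wv = Xop P wv * Eo a b"
proof -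
  have "Eo a b * (th j * Qop P wv j) = th j * Qop P wv j * (Eo a b :: 'a mpoly3 extop)" if "j \<in> P" for j
  proof -
    have "Eo a b * (th j * Qop P wv j) = th j * (Eo a b * Qop P wv j)"
      by (simp add: mult.assoc[symmetric] Eo_th)
    also have "\<dots> = th j * (Qop P wv j * Eo a b)"
      using that assms by (subst Eo_Qop) auto
    finally show ?thesis by (simp add: mult.assoc)
  qed
  then show ?thesis by (simp add: Xop_def sum_distrib_left sum_distrib_right)
qed

definition cubic :: "nat \<Rightarrow> nat \<Rightarrow> nat \<Rightarrow> nat \<Rightarrow> nat set \<Rightarrow> 'a::comm_ring_1 mpoly3" where
  "cubic N u v w S = app (Qop {..<N} wv u * (Qop {..<N} wv v * Qop {..<N} wv w)) vac S"

lemma cubic_in_cubJ: "u < N \<Longrightarrow> v < N \<Longrightarrow> w < N \<Longrightarrow> cubic N u v w S \<in> cubJ N"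
  unfolding cubic_def by (rule cubJ.gen)

text \<open>The surplus term of each factor is \<open>th b\<close> times its contraction by a, as in
  \<open>io_Q\<close>; together they form \<open>th b\<close> times the commutator of
  \<open>io a\<close> with the whole product. At \<open>vac\<close> the right-hand
  \<open>io a\<close> vanishes, so gl(W) sends cubics to sums of cubics up to sign.\<close>

lemma Eo_QQQ:
  assumes "a < N" "b < N"
  defines "Q \<equiv> Qop {..<N} (wv :: _ \<Rightarrow> _ \<Rightarrow> _ \<Rightarrow> 'a::field_char_0 mpoly3)"
  shows "Eo a b * (Q u * (Q v * Q w)) = Q u * (Q v * Q w) * Eo a b
    + (if u = b then Q a else 0) * (Q v * Q w) + Q u * ((if v = b then Q a else 0) * Q w)
    + Q u * (Q v * (if w = b then Q a else 0))
    + th b * (io a * (Q u * (Q v * Q w)) - Q u * (Q v * Q w) * io a)"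
proof -
  define D where "D u = (if u = b then Q a else 0)" for u
  let ?L = "Lop {..<N} (wv :: _ \<Rightarrow> _ \<Rightarrow> _ \<Rightarrow> 'a mpoly3)"
  have E: "Eo a b * Q u = Q u * Eo a b + D u + (th b * ?L u a + th b * ?L u a)" for u
    unfolding Q_def D_def using assms(1,2) by (subst Eo_Qop) auto
  have I: "io a * Q u = ?L u a + ?L u a + Q u * io a" for u
    unfolding Q_def by (rule cub.io_Q_sum) (use assms(1) in simp)
  have T: "Q u * th b = th b * Q u" for u unfolding Q_def by (rule Qop_th)
  show ?thesis unfolding D_def[symmetric]
    by (simp add: E I T assoc_rule[OF E] assoc_rule[OF I] assoc_rule[OF T] algebra_simps)
qed

lemma app_th_io_cubic: "app (th b * io a) (cubic N u v w) S =
    (if b \<in> S \<and> a \<notin> S - {b} then esgn b S * (esgn a (S - {b}) * cubic N u v w (insert a (S - {b}))) else 0)"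
  by (simp add: app_th app_io)

lemma Eop_cubic:
  assumes "a < N" "b < N"
  shows "Eop a b (cubic N u v w S :: 'a::field_char_0 mpoly3) = (if u = b then cubic N a v w S else 0)
    + (if v = b then cubic N u a w S else 0) + (if w = b then cubic N u v a S else 0)
    + app (th b * io a) (cubic N u v w) S"
proof -
  let ?Q = "Qop {..<N} (wv :: _ \<Rightarrow> _ \<Rightarrow> _ \<Rightarrow> 'a mpoly3)"
  have "Eop a b (cubic N u v w S) = app (Eo a b * (?Q u * (?Q v * ?Q w))) vac S"
    by (simp add: app_Eo cubic_def)
  also have "\<dots> = (if u = b then cubic N a v w S else 0)
    + (if v = b then cubic N u a w S else 0) + (if w = b then cubic N u v a S else 0)
    + app (th b * io a) (app (?Q u * (?Q v * ?Q w)) vac) S"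
    unfolding Eo_QQQ[OF assms] by (simp add: fun_apply cubic_def)
  also have "app (?Q u * (?Q v * ?Q w)) vac = cubic N u v w"
    by (simp add: fun_eq_iff cubic_def)
  finally show ?thesis .
qed

lemma cubJ_Eop:
  fixes p :: "'a::field_char_0 mpoly3"
  assumes "p \<in> cubJ N" "a < N" "b < N"
  shows "Eop a b p \<in> cubJ N"
  using assms(1)
proof (induction rule: cubJ.induct)
  case (gen u v w S)
  have "Eop a b (cubic N u v w S :: 'a mpoly3) \<in> cubJ N"
    unfolding Eop_cubic[OF assms(2,3)] app_th_io_cubic
    using gen assms by (auto intro!: cubJ.add cubJ.zero cubJ.mult cubic_in_cubJ)
  then show ?case by (simp only: cubic_def)
qed (auto simp: Eop_add Eop_mult intro: cubJ.intros)

definition cubM :: "nat \<Rightarrow> (nat set \<Rightarrow> 'a::field_char_0 mpoly3) set" where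
  "cubM N = {f. \<forall>S. f S \<in> cubJ N}"

lemma cubM_MJ: "cubM N = cubic_ideal.MJ (cubJ N)"
  by (simp add: cubM_def cub.MJ_def)

lemmas cubM_0 = cub.MJ_0[folded cubM_MJ]
lemmas cubM_add = cub.MJ_add[folded cubM_MJ]
lemmas cubM_diff = cub.MJ_diff[folded cubM_MJ]
lemmas cubM_sum = cub.MJ_sum[folded cubM_MJ]
lemmas cubM_th = cub.MJ_th[folded cubM_MJ]
lemmas cubM_io = cub.MJ_io[folded cubM_MJ]
lemmas cubM_ka = cub.MJ_ka[folded cubM_MJ]
lemmas cubM_pr = cub.MJ_pr[folded cubM_MJ]

lemma cubM_Eo: "f \<in> cubM N \<Longrightarrow> a < N \<Longrightarrow> b < N \<Longrightarrow> app (Eo a b) f \<in> cubM N"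
  by (auto simp: cubM_def app_Eo intro: cubJ_Eop)

section \<open>Alternating polarization\<close>

text \<open>Because the letters of A anticommute, iterated operators Top antisymmetrize the polarizations that
  replace old letters by letters of A.\<close>

definition Top :: "nat set \<Rightarrow> nat \<Rightarrow> 'a::comm_ring_1 mpoly3 extop" where
  "Top A b = (\<Sum>a\<in>A. th a * Eo a b)"

lemma cubM_Top: "f \<in> cubM N \<Longrightarrow> A \<subseteq> {..<N} \<Longrightarrow> b < N \<Longrightarrow> app (Top A b) f \<in> cubM N"
  by (auto simp: Top_def app_sum_op intro!: cubM_sum cubM_th cubM_Eo)

lemma Top_vac: "app (Top A b) vac = 0"
  by (simp add: Top_def app_sum_op)

lemma Top_ka: "Top A b * ka r = ka r * Top A b + (\<Sum>a\<in>A. th a * ka (Eop a b r))"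
proof -
  have "th a * Eo a b * ka r = ka r * (th a * Eo a b) + th a * ka (Eop a b r)" for a
    by (simp add: mult.assoc Eo_ka distrib_left assoc_rule[OF th_ka])
  then show ?thesis by (simp add: Top_def sum_distrib_left sum_distrib_right sum.distrib)
qed

text \<open>A polarized index becomes a letter: L turns into Q, Q into X, and X, which has no free
  index, contributes nothing. The condition on b removes the surplus term of
  \<open>Eo_Lop\<close>.\<close>

lemma Top_Lop:
  assumes "finite A" "b \<notin> A"
  shows "Top A b * Lop A wv u v = - (Lop A wv u v * Top A b)
    - (if u = b then Qop A wv v else 0) + (if v = b then Qop A wv u else (0 :: 'a::comm_ring_1 mpoly3 extop))"
proof -
  have "th a * Eo a b * Lop A wv u v = - (Lop A wv u v * (th a * Eo a b))
    + ((if u = b then th a * Lop A wv a v else 0) + (if v = b then th a * Lop A wv u a else (0 :: 'a mpoly3 extop)))" for a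
    using assms by (simp add: mult.assoc Eo_Lop distrib_left assoc_rule[OF Lop_th] add.assoc)
  then have "Top A b * Lop A wv u v = - (Lop A wv u v * Top A b)
    + ((if u = b then \<Sum>a\<in>A. th a * Lop A wv a v else 0) + (if v = b then \<Sum>a\<in>A. th a * Lop A wv u a else (0 :: 'a mpoly3 extop)))"
    by (simp add: Top_def sum_distrib_left sum_distrib_right sum.distrib sum_subtractf)
  then show ?thesis by (simp add: sum_th_Lop Qop_def[symmetric])
qed

lemma Top_Qop:
  assumes "finite A" "b \<notin> A"
  shows "Top A b * Qop A wv u = Qop A wv u * Top A b + (if u = b then Xop A wv else (0 :: 'a::comm_ring_1 mpoly3 extop))"
proof -
  have "th a * Eo a b * Qop A wv u = Qop A wv u * (th a * Eo a b)
    + (if u = b then th a * Qop A wv a else (0 :: 'a mpoly3 extop))" for a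
  proof -
    have "Eo a b * Qop A wv u = Qop A wv u * Eo a b + (if u = b then Qop A wv a else (0 :: 'a mpoly3 extop))"
      using assms by (subst Eo_Qop) auto
    then show ?thesis by (simp add: mult.assoc distrib_left assoc_rule[OF Qop_th])
  qed
  then show ?thesis by (simp add: Top_def Xop_def sum_distrib_left sum_distrib_right sum.distrib)
qed

lemma Top_Xop:
  assumes "finite A" "b \<notin> A"
  shows "Top A b * Xop A wv = - (Xop A wv * (Top A b :: 'a::comm_ring_1 mpoly3 extop))"
proof -
  have "th a * Eo a b * Xop A wv = - (Xop A wv * (th a * (Eo a b :: 'a mpoly3 extop)))" for a
    using assms by (simp add: mult.assoc Eo_Xop_fresh assoc_rule[OF Xop_th])
  then show ?thesis by (simp add: Top_def sum_distrib_left sum_distrib_right sum_negf)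
qed

text \<open>What k alternating polarizations can produce: indices and scalars involve only the old
  letters below n, the exterior letters are the fresh ones, and the degree counts the
  polarizations.\<close>

inductive_set avec :: "nat \<Rightarrow> nat \<Rightarrow> nat \<Rightarrow> (nat set \<Rightarrow> 'a::comm_ring_1 mpoly3) set" for n N k where
  prod: "r \<in> polyring n \<Longrightarrow> \<forall>g\<in>set gs. gind g \<subseteq> {..<n} \<Longrightarrow> sum_list (map gdeg gs) = k \<Longrightarrow>
    app (ka r) (app (gprod {n..<N} wv gs) vac) \<in> avec n N k"
| add: "f \<in> avec n N k \<Longrightarrow> g \<in> avec n N k \<Longrightarrow> f + g \<in> avec n N k"
| zero: "0 \<in> avec n N k"

lemma gop_ka: "gop P c g * ka r = ka r * gop P c g"
  by (cases g) (simp_all add: Lop_ka Qop_ka Xop_ka)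

lemma avec_ka: "f \<in> avec n N k \<Longrightarrow> s \<in> polyring n \<Longrightarrow> app (ka s) f \<in> avec n N k"
proof (induction rule: avec.induct)
  case (prod r gs)
  show ?case
    using avec.prod[of "s * r", OF polyring_mult[OF prod(4,1)] prod(2,3)]
    by (simp add: ka_mult[symmetric])
qed (simp_all add: avec.intros)

lemma avec_uminus: "f \<in> avec n N k \<Longrightarrow> - f \<in> avec n N k"
  using avec_ka[OF _ polyring_const[of "- 1"], of f n N k] by (simp add: const3_simps ka_uminus)

lemma avec_diff: "f \<in> avec n N k \<Longrightarrow> g \<in> avec n N k \<Longrightarrow> f - g \<in> avec n N k"
  using avec.add[OF _ avec_uminus[of g]] by fastforce

lemma avec_gop: "f \<in> avec n N k \<Longrightarrow> gind g \<subseteq> {..<n} \<Longrightarrow> gdeg g + k = l \<Longrightarrow> app (gop {n..<N} wv g) f \<in> avec n N l"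
proof (induction rule: avec.induct)
  case (prod r gs)
  have "app (gop {n..<N} wv g) (app (ka r) (app (gprod {n..<N} wv gs) vac))
      = app (ka r) (app (gprod {n..<N} wv (g # gs)) vac)"
    by (simp add: gprod_def flip: app_simps(6)) (simp add: gop_ka mult.assoc[symmetric] del: app_simps)
  moreover have "\<dots> \<in> avec n N l"
    by (rule avec.prod) (use prod in auto)
  ultimately show ?case by simp
qed (simp_all add: avec.intros)

text \<open>By the Leibniz rule only variables matter, and a variable containing b polarizes, up to
  sign, to the one-form of its other two indices.\<close>

lemma avec_Top_ka:
  assumes "r \<in> polyring n"
  shows "(\<Sum>a\<in>{n..<N}. app (th a) (app (ka (Eop a b r)) vac)) \<in> avec n N 1"
  using assms
proof (induction r rule: polyring_induct)
  case (const c)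
  then show ?case by (simp add: avec.zero)
next
  case (var v)
  obtain i j k where v: "v = (i, j, k)" by (cases v)
  with var have ijk: "i < n" "j < n" "k < n" by (auto simp: valid_var_def)
  let ?L = "Lop {n..<N} (wv :: _ \<Rightarrow> _ \<Rightarrow> _ \<Rightarrow> 'a mpoly3)"
  have L: "app (?L x y) vac \<in> avec n N 1" if "x < n" "y < n" for x y
    using avec.prod[of 1 n "[GL x y]" 1 N] polyring_const[of 1 n] that by (simp add: gprod_def const3_simps)
  have w: "wv a j k = (wv j k a :: 'a mpoly3)" "wv i a k = - (wv i k a :: 'a mpoly3)" for a
    using wv_swap12[of a j k, where 'a = 'a] wv_swap23[of j a k, where 'a = 'a] wv_swap23[of i a k, where 'a = 'a]
    by simp_all
  have "(\<Sum>a\<in>{n..<N}. app (th a) (app (ka (Eop a b (Var3 v))) vac))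
      = app (\<Sum>a\<in>{n..<N}. th a * ka (Eop a b (Var3 v))) vac"
    by (simp add: app_sum_op)
  also have "(\<Sum>a\<in>{n..<N}. th a * ka (Eop a b (Var3 v)))
      = (if i = b then ?L j k else 0) - (if j = b then ?L i k else 0) + (if k = b then ?L i j else 0)"
    by (simp add: v Eop_Var3 Evar_def ka_add[symmetric] w distrib_left sum.distrib Lop_def ka_uminus sum_negf)
  finally show ?case using L ijk
    by (auto intro!: avec.add avec_diff avec_uminus avec.zero)
next
  case (add p q)
  have "(\<Sum>a\<in>{n..<N}. app (th a) (app (ka (Eop a b (p + q))) vac))
    = (\<Sum>a\<in>{n..<N}. app (th a) (app (ka (Eop a b p)) vac)) + (\<Sum>a\<in>{n..<N}. app (th a) (app (ka (Eop a b q)) vac))"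
    by (simp add: Eop_add ka_add[symmetric] sum.distrib)
  then show ?case using add by (simp add: avec.add)
next
  case (mult p q)
  have "app (th a) (app (ka (Eop a b (p * q))) vac) = app (ka p) (app (th a) (app (ka (Eop a b q)) vac))
    + app (ka q) (app (th a) (app (ka (Eop a b p)) vac))" for a
  proof -
    have "th a * ka (Eop a b (p * q)) = ka p * (th a * ka (Eop a b q)) + ka q * (th a * ka (Eop a b p))"
      by (simp add: Eop_mult ka_add[symmetric] th_ka assoc_rule[OF ka_mult] distrib_left mult.commute[of q])
    then have "app (th a * ka (Eop a b (p * q))) vac
      = app (ka p * (th a * ka (Eop a b q)) + ka q * (th a * ka (Eop a b p))) vac" by simp
    then show ?thesis by simp
  qed
  then have "(\<Sum>a\<in>{n..<N}. app (th a) (app (ka (Eop a b (p * q))) vac))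
    = app (ka p) (\<Sum>a\<in>{n..<N}. app (th a) (app (ka (Eop a b q)) vac))
    + app (ka q) (\<Sum>a\<in>{n..<N}. app (th a) (app (ka (Eop a b p)) vac))"
    by (simp add: sum.distrib app_sum)
  then show ?case using mult by (simp add: avec.add avec_ka)
qed

lemma avec_Top:
  assumes "f \<in> avec n N k" "b < n"
  shows "app (Top {n..<N} b) f \<in> avec n N (Suc k)"
  using assms(1)
proof (induction rule: avec.induct)
  case (prod r gs)
  let ?T = "Top {n..<N} b :: 'a mpoly3 extop" and ?G = "gop {n..<N} wv :: extgen \<Rightarrow> 'a mpoly3 extop"
  have b: "b \<notin> {n..<N}" using assms(2) by simp
  note TL = Top_Lop[OF _ b, where 'a = 'a] and TQ = Top_Qop[OF _ b, where 'a = 'a] and TX = Top_Xop[OF _ b, where 'a = 'a]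
  from prod(2,3) show ?case
  proof (induction gs arbitrary: k)
    case Nil
    have "app ?T (app (ka r) vac) = app (?T * ka r) vac" by simp
    also have "\<dots> = (\<Sum>a\<in>{n..<N}. app (th a) (app (ka (Eop a b r)) vac))"
      by (simp only: Top_ka) (simp add: Top_vac app_sum_op)
    also have "\<dots> \<in> avec n N 1" by (rule avec_Top_ka[OF prod(1)])
    finally show ?case using Nil by (simp add: gprod_def)
  next
    case (Cons g gs)
    let ?F = "app (ka r) (app (gprod {n..<N} wv gs) vac)"
    let ?k = "sum_list (map gdeg gs)"
    have F: "?F \<in> avec n N ?k" by (rule avec.prod) (use prod Cons in auto)
    have TF: "app ?T ?F \<in> avec n N (Suc ?k)" by (rule Cons.IH) (use Cons in auto)
    have g: "gind g \<subseteq> {..<n}" using Cons by auto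
    have k: "k = gdeg g + ?k" using Cons by auto
    have "ka r * gprod {n..<N} wv (g # gs) = ?G g * (ka r * gprod {n..<N} wv gs)"
      by (simp add: gprod_def gop_ka mult.assoc[symmetric])
    then have "app (ka r * gprod {n..<N} wv (g # gs)) vac = app (?G g * (ka r * gprod {n..<N} wv gs)) vac"
      by simp
    then have "app ?T (app (ka r) (app (gprod {n..<N} wv (g # gs)) vac)) = app (?T * ?G g) ?F"
      by simp
    also have "\<dots> \<in> avec n N (Suc k)"
    proof (cases g)
      case GX
      have "app (?T * ?G g) ?F = - app (?G g) (app ?T ?F)" using GX by (simp only: gop.simps TX finite_atLeastLessThan) simp
      then show ?thesis using TF g k by (simp only:) (auto intro!: avec_uminus avec_gop)
    next
      case (GQ u)
      have "app (?T * ?G g) ?F = app (?G g) (app ?T ?F) + (if u = b then app (?G GX) ?F else 0)"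
        using GQ by (simp only: gop.simps TQ finite_atLeastLessThan) simp
      moreover have "app (?G g) (app ?T ?F) \<in> avec n N (Suc k)" "app (?G GX) ?F \<in> avec n N (Suc k)"
        by (rule avec_gop[OF TF], use g k in simp, use k in simp)
          (rule avec_gop[OF F], simp, use k GQ in simp)
      ultimately show ?thesis by (auto intro!: avec.add avec.zero simp del: app_simps gop.simps)
    next
      case (GL u v)
      have "app (?T * ?G g) ?F = - app (?G g) (app ?T ?F) - (if u = b then app (?G (GQ v)) ?F else 0)
          + (if v = b then app (?G (GQ u)) ?F else 0)"
        using GL by (simp only: gop.simps TL finite_atLeastLessThan) simp
      moreover have "app (?G g) (app ?T ?F) \<in> avec n N (Suc k)"
        by (rule avec_gop[OF TF], use g k in simp, use k in simp)
      moreover have "app (?G (GQ u)) ?F \<in> avec n N (Suc k)" "app (?G (GQ v)) ?F \<in> avec n N (Suc k)"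
        by (rule avec_gop[OF F]; use k g GL in simp)+
      ultimately show ?thesis
        by (auto intro!: avec.add avec.zero avec_diff avec_uminus simp del: app_simps gop.simps)
    qed
    finally show ?case .
  qed
qed (simp_all add: avec.intros)

lemma pr_gop:
  assumes "P' = P - B" "finite P"
  shows "pr B * gop P c g = gop P' c g * pr B"
proof -
  have sum: "pr B * (\<Sum>a\<in>P. th a * F a) = (\<Sum>a\<in>P'. th a * G a) * pr B"
    if "\<And>a. a \<in> P' \<Longrightarrow> pr B * F a = G a * pr B" for F G :: "nat \<Rightarrow> 'a extop"
  proof -
    have "pr B * (\<Sum>a\<in>P. th a * F a) = (\<Sum>a\<in>P. if a \<in> B then 0 else th a * (pr B * F a))"
      unfolding sum_distrib_left by (rule sum.cong) (simp_all add: assoc_rule[OF pr_th] mult.assoc)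
    also have "\<dots> = (\<Sum>a\<in>P'. th a * (pr B * F a))"
      by (rule sum.mono_neutral_cong_right) (use assms in auto)
    also have "\<dots> = (\<Sum>a\<in>P'. th a * G a) * pr B"
      by (simp add: that sum_distrib_right mult.assoc)
    finally show ?thesis .
  qed
  have L: "pr B * Lop P c u v = Lop P' c u v * pr B" for u v
    unfolding Lop_def by (rule sum) (rule pr_ka)
  have Q: "pr B * Qop P c u = Qop P' c u * pr B" for u
    unfolding Qop_def by (rule sum) (rule L)
  have X: "pr B * Xop P c = Xop P' c * pr B"
    unfolding Xop_def by (rule sum) (rule Q)
  show ?thesis by (cases g) (simp_all add: L Q X)
qed

lemma pr_gprod:
  assumes "P' = P - B" "finite P"
  shows "pr B * gprod P c gs = gprod P' c gs * pr B"
  by (induction gs) (simp_all add: gprod_def assoc_rule[OF pr_gop[OF assms]] mult.assoc)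

text \<open>The degree-seven relations use all letters below N, \<open>avec\<close> only the fresh
  ones. Deleting the old letters by \<open>pr\<close> turns one product into the other and merely
  sets some coefficients to zero.\<close>

lemma avec_7:
  assumes "f \<in> avec n N 7" "n \<le> N"
  shows "f \<in> (cubM N :: (nat set \<Rightarrow> 'a::field_char_0 mpoly3) set)"
  using assms(1)
proof (induction rule: avec.induct)
  case (prod r gs)
  have "pr {..<n} * gprod {..<N} wv gs = gprod {n..<N} wv gs * (pr {..<n} :: 'a mpoly3 extop)"
    by (rule pr_gprod) auto
  then have "app (pr {..<n} * gprod {..<N} wv gs) vac = app (gprod {n..<N} wv gs * (pr {..<n} :: 'a mpoly3 extop)) vac"
    by (simp only:)
  then have eq: "app (gprod {n..<N} wv gs) vac = app (pr {..<n} :: 'a mpoly3 extop) (app (gprod {..<N} wv gs) vac)"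
    by simp
  have "gprod {..<N} wv gs \<in> (cubic_ideal.NN (cubJ N) :: 'a mpoly3 extop set)"
    by (rule cub.gprod_NN) (use prod assms(2) in fastforce)+
  then have "app (gprod {..<N} wv gs) vac \<in> (cubM N :: (nat set \<Rightarrow> 'a mpoly3) set)"
    using M0.ka[of "1 :: 'a mpoly3"] unfolding cub.NN_def cubM_MJ by simp
  then show ?case unfolding eq by (intro cubM_ka cubM_pr)
qed (simp_all add: cubM_add cubM_0)

section \<open>The Capelli argument\<close>

text \<open>At a subset S of A with \<open>length bs\<close> elements the coefficient is, up to
  sign, the alternating sum of the polarizations over all bijections from the positions of
  \<open>bs\<close> to S.\<close>

definition polar :: "nat set \<Rightarrow> nat list \<Rightarrow> 'a::comm_ring_1 mpoly3 \<Rightarrow> nat set \<Rightarrow> 'a mpoly3" where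
  "polar A bs v = foldr (\<lambda>b. app (Top A b)) bs (app (ka v) vac)"

lemma polar_Nil: "polar A [] v = app (ka v) vac"
  and polar_Cons: "polar A (b # bs) v = app (Top A b) (polar A bs v)"
  by (simp_all add: polar_def)

lemma Top_insert: "finite A \<Longrightarrow> a \<notin> A \<Longrightarrow> Top (insert a A) b = th a * Eo a b + Top A b"
  by (simp add: Top_def)

lemma th_Top: "th a * Top A b = - (Top A b * (th a :: 'a::comm_ring_1 mpoly3 extop))"
proof -
  have "th a * (th x * Eo x b) = - (th x * Eo x b * (th a :: 'a mpoly3 extop))" for x
    by (subst th_th_assoc) (simp add: mult.assoc Eo_th)
  then show ?thesis by (simp add: Top_def sum_distrib_left sum_distrib_right sum_negf)
qed

lemma pr_Top:
  assumes "finite A" "a \<notin> A"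
  shows "pr {a} * Top (insert a A) b = Top A b * (pr {a} :: 'a::comm_ring_1 mpoly3 extop)"
proof -
  have step: "pr {a} * (th x * Eo x b) = (if x = a then 0 else th x * Eo x b * (pr {a} :: 'a mpoly3 extop))" for x
    by (simp add: mult.assoc Eo_pr assoc_rule[OF pr_th])
  have "pr {a} * Top A b = Top A b * (pr {a} :: 'a mpoly3 extop)"
    unfolding Top_def sum_distrib_left sum_distrib_right
    by (rule sum.cong) (use assms in \<open>auto simp: step\<close>)
  then show ?thesis using step[of a] assms by (simp add: Top_insert distrib_left)
qed

lemma io_Top:
  assumes "finite A" "a \<in> A"
  shows "io a * Top A b = Eo a b - Top A b * (io a :: 'a::comm_ring_1 mpoly3 extop)"
proof -
  have "io a * (th x * Eo x b) = (if x = a then Eo a b else 0) - th x * Eo x b * (io a :: 'a mpoly3 extop)" for x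
    by (simp add: assoc_rule[OF io_th] left_diff_distrib mult.assoc Eo_io)
  then show ?thesis using assms
    by (simp add: Top_def sum_distrib_left sum_distrib_right sum_subtractf)
qed

lemma Eo_Top:
  assumes "finite A"
  shows "Eo c d * Top A b = Top A b * (Eo c d :: 'a::comm_ring_1 mpoly3 extop) + (if d \<in> A then th d * Eo c b else 0) - (if b = c then Top A d else 0)"
proof -
  have step: "Eo c d * (th x * Eo x b) = th x * Eo x b * Eo c d + (if d = x then th d * Eo c b else 0)
    - (if b = c then th x * Eo x d else (0 :: 'a mpoly3 extop))" for x
    by (simp add: assoc_rule[OF Eo_th] mult.assoc Eo_Eo[of c d x b] distrib_left right_diff_distrib)
  have "Eo c d * Top A b = (\<Sum>x\<in>A. Eo c d * (th x * (Eo x b :: 'a mpoly3 extop)))"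
    by (simp add: Top_def sum_distrib_left)
  also have "\<dots> = (\<Sum>x\<in>A. th x * Eo x b * Eo c d) + (\<Sum>x\<in>A. if d = x then th d * Eo c b else 0)
      - (\<Sum>x\<in>A. if b = c then th x * Eo x d else (0 :: 'a mpoly3 extop))"
    by (simp only: step sum.distrib sum_subtractf)
  also have "\<dots> = Top A b * Eo c d + (if d \<in> A then th d * Eo c b else 0) - (if b = c then Top A d else 0)"
    using assms by (simp add: Top_def sum_distrib_right)
  finally show ?thesis .
qed

lemma pr_polar:
  assumes "finite A" "a \<notin> A"
  shows "app (pr {a}) (polar (insert a A) bs v) = polar A bs v"
proof (induction bs)
  case Nil
  have "app (pr {a} * ka v) vac = app (ka v * pr {a}) vac" by (simp only: pr_ka)
  then show ?case by (simp add: polar_Nil)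
next
  case (Cons b bs)
  have "app (pr {a} * Top (insert a A) b) (polar (insert a A) bs v) = app (Top A b * pr {a}) (polar (insert a A) bs v)"
    by (simp only: pr_Top[OF assms])
  then show ?case using Cons by (simp add: polar_Cons)
qed

lemma io_polar_Nil: "app (io a) (polar A [] v) = 0"
proof -
  have "app (io a * ka v) vac = app (ka v * io a) vac" by (simp only: io_ka)
  then show ?thesis by (simp add: polar_Nil)
qed

lemma io_polar_Cons:
  assumes "finite A" "a \<notin> A"
  shows "app (io a) (polar (insert a A) (b # bs) v)
    = app (Eo a b) (polar A bs v) - app (Top A b) (app (io a) (polar (insert a A) bs v))"
proof -
  let ?Z = "polar (insert a A) bs v"
  have "app (io a) (polar (insert a A) (b # bs) v) = app (pr {a} * (io a * Top (insert a A) b)) ?Z"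
    by (simp only: assoc_rule[OF pr_io]) (simp add: polar_Cons)
  also have "io a * Top (insert a A) b = Eo a b - Top (insert a A) b * io a"
    using assms by (intro io_Top) auto
  also have "pr {a} * (Eo a b - Top (insert a A) b * io a) = Eo a b * pr {a} - Top A b * (pr {a} * io a)"
    by (simp add: right_diff_distrib Eo_pr assoc_rule[OF pr_Top[OF assms]] mult.assoc)
  also have "app \<dots> ?Z = app (Eo a b) (app (pr {a}) ?Z) - app (Top A b) (app (io a) ?Z)"
    by (simp only: pr_io app_simps)
  finally show ?thesis by (simp only: pr_polar[OF assms])
qed

lemma Eo_polar:
  assumes "finite A" "d \<notin> A" "c \<notin> set bs"
  shows "app (Eo c d) (polar A bs v) = polar A bs (Eop c d v)"
  using assms(3)
proof (induction bs)
  case Nil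
  have "app (Eo c d * ka v) vac = app (ka v * Eo c d + ka (Eop c d v)) vac" by (simp only: Eo_ka)
  then show ?case by (simp add: polar_Nil)
next
  case (Cons b bs)
  have "Eo c d * Top A b = Top A b * (Eo c d :: 'a mpoly3 extop)"
    using Cons assms by (simp add: Eo_Top)
  then have "app (Eo c d * Top A b) (polar A bs v) = app (Top A b * Eo c d) (polar A bs v)" by (simp only:)
  then show ?case using Cons by (simp add: polar_Cons)
qed

lemma polar_0 [simp]: "polar A bs 0 = 0"
  by (induction bs) (simp_all add: polar_Nil polar_Cons)

lemma polar_of_nat: "polar A bs (of_nat l * v) = app (of_nat l) (polar A bs v)"
proof (induction bs)
  case Nil
  show ?case by (simp add: polar_Nil ka_mult[symmetric] ka_of_nat)
next
  case (Cons b bs)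
  have "Top A b * of_nat l = of_nat l * (Top A b :: 'a mpoly3 extop)" by (rule mult_of_nat_commute[symmetric])
  then have "app (Top A b * of_nat l) (polar A bs v) = app (of_nat l * Top A b) (polar A bs v)" by (simp only:)
  then show ?case using Cons by (simp add: polar_Cons)
qed

lemma polar_cubM:
  assumes "v \<in> cubJ N" "A \<subseteq> {..<N}" "set bs \<subseteq> {..<N}"
  shows "polar A bs v \<in> (cubM N :: (nat set \<Rightarrow> 'a::field_char_0 mpoly3) set)"
  using assms(3)
proof (induction bs)
  case Nil
  show ?case using assms(1) cubJ.mult[OF assms(1), of "vac _"]
    by (simp add: polar_Nil cubM_def app_ka mult.commute)
qed (use assms in \<open>simp add: polar_Cons cubM_Top\<close>)

context
  fixes n N a :: nat and A :: "nat set" and v :: "'a::field_char_0 mpoly3"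
  assumes A: "finite A" "a \<notin> A" "A \<subseteq> {n..<N}" "n \<le> a" "a < N" and v: "v \<in> polyring n"
begin

private abbreviation "Y bs \<equiv> polar A bs v"
text \<open>Collects the terms of the larger polarization in which the letter a was used, with a
  stripped from the form.\<close>

private abbreviation "W bs \<equiv> app (io a) (polar (insert a A) bs v)"

lemma W_Nil: "W [] = 0"
  by (rule io_polar_Nil)

lemma W_Cons: "W (b # bs) = app (Eo a b) (Y bs) - app (Top A b) (W bs)"
  by (rule io_polar_Cons) (use A in auto)

lemma Eo_fresh_Y: "c \<notin> set bs \<Longrightarrow> app (Eo c a) (Y bs) = 0"
  using A v by (simp add: Eo_polar Eop_fresh)

text \<open>The letter a does not occur in \<open>Y bs\<close>, so of the commutator relation only
  E_cb survives: b moved to a and then a to c is b moved to c.\<close>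

lemma Eo_Eo_Y:
  assumes "c \<notin> set bs" "a \<notin> set bs"
  shows "app (Eo c a) (app (Eo a b) (Y bs)) = app (Eo c b) (Y bs)"
proof -
  have "app (Eo c a * Eo a b) (Y bs) = app (Eo a b * Eo c a + Eo c b - (if b = c then Eo a a else 0)) (Y bs)"
    by (simp only: Eo_Eo[of c a a b] simp_thms if_True)
  then show ?thesis using assms by (auto simp: Eo_fresh_Y)
qed

text \<open>In each term one letter of \<open>bs\<close> sits at a; sending a into A completes the
  alternation, so every position contributes one copy of \<open>Y bs\<close>. The sign in
  \<open>W_Cons\<close> is cancelled by the one in \<open>th_Top\<close>.\<close>

lemma capelli_diagonal:
  "set bs \<subseteq> {..<n} \<Longrightarrow> app (Top A a) (W bs) = app (of_nat (length bs)) (Y bs)"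
proof (induction bs)
  case Nil
  show ?case by (simp add: W_Nil)
next
  case (Cons b bs)
  have step: "app (th x) (app (Eo x a) (W (b # bs)))
      = app (th x) (app (Eo x b) (Y bs)) + app (Top A b) (app (th x) (app (Eo x a) (W bs)))" if x: "x \<in> A" for x
  proof -
    have "n \<le> x" using x A by auto
    then have "x \<notin> set bs" "a \<notin> set bs" "b \<noteq> x" using A Cons by auto
    then have "app (Eo x a) (app (Eo a b) (Y bs)) = app (Eo x b) (Y bs)"
      by (intro Eo_Eo_Y)
    moreover have "Eo x a * Top A b = Top A b * (Eo x a :: 'a mpoly3 extop)"
      using A \<open>b \<noteq> x\<close> by (simp add: Eo_Top)
    then have "app (th x) (app (Eo x a * Top A b) (W bs)) = app (th x) (app (Top A b * Eo x a) (W bs))" by (simp only:)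
    moreover have "app (th x * Top A b) (app (Eo x a) (W bs)) = app (- (Top A b * th x)) (app (Eo x a) (W bs))"
      by (simp only: th_Top)
    ultimately show ?thesis by (simp add: W_Cons)
  qed
  have "app (Top A a) (W (b # bs)) = (\<Sum>x\<in>A. app (th x) (app (Eo x a) (W (b # bs))))"
    by (simp add: Top_def app_sum_op)
  also have "\<dots> = (\<Sum>x\<in>A. app (th x) (app (Eo x b) (Y bs)))
      + app (Top A b) (\<Sum>x\<in>A. app (th x) (app (Eo x a) (W bs)))"
    by (simp add: step sum.distrib app_sum)
  also have "\<dots> = app (Top A b) (Y bs) + app (Top A b) (app (Top A a) (W bs))"
    by (simp add: Top_def app_sum_op)
  also have "app (Top A a) (W bs) = app (of_nat (length bs)) (Y bs)"
    using Cons by simp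
  also have "app (Top A b) (app (of_nat (length bs)) (Y bs)) = app (of_nat (length bs)) (app (Top A b) (Y bs))"
    using mult_of_nat_commute[of "length bs" "Top A b :: 'a mpoly3 extop"] by (metis app_simps(6))
  finally show ?case by (simp add: polar_Cons)
qed

text \<open>Sending a to c replaces some b of \<open>bs\<close> by c, that is, applies E_cb to v.
  The result lies in the ideal by hypothesis and stays there under the remaining
  polarizations.\<close>

lemma capelli_offdiagonal:
  assumes "c < n"
  shows "set bs \<subseteq> {..<n} \<Longrightarrow> c \<notin> set bs \<Longrightarrow> (\<And>b. b \<in> set bs \<Longrightarrow> Eop c b v \<in> cubJ N) \<Longrightarrow>
    app (Eo c a) (W bs) \<in> cubM N"
proof (induction bs)
  case Nil
  show ?case by (simp add: W_Nil cubM_0)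
next
  case (Cons b bs)
  have "a \<notin> set bs" "b \<notin> A" "b \<noteq> c" "b < n" using A Cons by auto
  have "app (Eo c a) (app (Eo a b) (Y bs)) = app (Eo c b) (Y bs)"
    using Cons \<open>a \<notin> set bs\<close> by (intro Eo_Eo_Y) auto
  also have "\<dots> = polar A bs (Eop c b v)"
    using Cons A \<open>b \<notin> A\<close> by (intro Eo_polar) auto
  finally have "app (Eo c a) (app (Eo a b) (Y bs)) = polar A bs (Eop c b v)" .
  moreover have "Eo c a * Top A b = Top A b * (Eo c a :: 'a mpoly3 extop)"
    using A \<open>b \<noteq> c\<close> by (simp add: Eo_Top)
  then have "app (Eo c a * Top A b) (W bs) = app (Top A b * Eo c a) (W bs)" by (simp only:)
  ultimately have "app (Eo c a) (W (b # bs)) = polar A bs (Eop c b v) - app (Top A b) (app (Eo c a) (W bs))"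
    by (simp add: W_Cons)
  also have "\<dots> \<in> cubM N"
  proof (intro cubM_diff cubM_Top polar_cubM)
    show "app (Eo c a) (W bs) \<in> cubM N" using Cons by auto
  qed (use Cons A \<open>b < n\<close> in auto)
  finally show ?case .
qed

text \<open>A round trip from c to the fresh letter a and back. Where c itself went to a, the weight
  returns l copies of \<open>Y bs\<close>; where another letter went to a,
  \<open>capelli_diagonal\<close> gives \<open>length bs\<close> more; the rest is in the ideal.
  Both counts enter with the same sign, so the total can be cancelled.\<close>

lemma capelli_step:
  assumes bs: "set (c # bs) \<subseteq> {..<n}" "c \<notin> set bs"
    and raise: "\<And>b. b \<in> set bs \<Longrightarrow> Eop c b v \<in> cubJ N"
    and weight: "Eop c c v = of_nat l * v"
    and polar: "polar (insert a A) (c # bs) v \<in> cubM N" and pos: "l + length bs > 0"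
  shows "polar A bs v \<in> cubM N"
proof -
  have anot: "a \<notin> set bs" and cA: "c \<notin> A" and c: "c < n" using A bs by auto
  have "app (Eo c a) (app (Eo a c) (Y bs)) = app (Eo c c) (Y bs)"
    using bs anot by (intro Eo_Eo_Y) auto
  also have "\<dots> = app (of_nat l) (Y bs)"
    using A bs cA by (simp add: Eo_polar weight polar_of_nat)
  finally have 1: "app (Eo c a) (app (Eo a c) (Y bs)) = app (of_nat l) (Y bs)" .
  have "Eo c a * Top A c = Top A c * Eo c a - (Top A a :: 'a mpoly3 extop)"
    using A by (simp add: Eo_Top)
  then have "app (Eo c a * Top A c) (W bs) = app (Top A c * Eo c a - Top A a) (W bs)" by (simp only:)
  then have 2: "app (Eo c a) (app (Top A c) (W bs))
      = app (Top A c) (app (Eo c a) (W bs)) - app (of_nat (length bs)) (Y bs)"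
    using bs by (simp add: capelli_diagonal)
  have "app (Eo c a) (W (c # bs))
      = app (of_nat (l + length bs)) (Y bs) - app (Top A c) (app (Eo c a) (W bs))"
    by (simp add: W_Cons 1 2)
  moreover have "app (Eo c a) (W (c # bs)) \<in> cubM N"
    using polar A c by (intro cubM_Eo cubM_io) auto
  moreover have "app (Top A c) (app (Eo c a) (W bs)) \<in> cubM N"
    using A c bs raise by (intro cubM_Top capelli_offdiagonal) auto
  ultimately have "app (of_nat (l + length bs)) (Y bs) \<in> cubM N"
    using cubM_add by fastforce
  moreover obtain k where "l + length bs = Suc k" using pos by (cases "l + length bs") auto
  ultimately have "of_nat (Suc k) * Y bs S \<in> cubJ N" for S
    by (simp add: cubM_def app_of_nat del: of_nat_Suc of_nat_add)
  then show ?thesis unfolding cubM_def using cub.J_div by blast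
qed

end

text \<open>N provides one fresh letter for each of the seven. The full polarization is in the ideal
  by \<open>avec_7\<close>, and \<open>capelli_step\<close> takes back one fresh letter at a time
  until v remains. Removing the head c involves only E_cb for later b, hence the ordered hypothesis
  \<open>raise\<close>.\<close>

theorem capelli:
  fixes v :: "'a::field_char_0 mpoly3"
  assumes v: "v \<in> polyring n" and bs: "set bs \<subseteq> {..<n}" "distinct bs" "length bs = 7" and N: "N = n + 7"
    and raise: "sorted_wrt (\<lambda>c b. Eop c b v \<in> cubJ N) bs"
    and weight: "\<And>b. b \<in> set bs \<Longrightarrow> Eop b b v = of_nat (l b) * v" "\<And>b. b \<in> set bs \<Longrightarrow> l b > 0"
  shows "v \<in> cubJ N"
proof -
  have desc: "v \<in> cubJ N" if "polar {n..<n + length cs} cs v \<in> cubM N" "set cs \<subseteq> set bs" "distinct cs"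
    "sorted_wrt (\<lambda>c b. Eop c b v \<in> cubJ N) cs" "length cs \<le> 7" for cs
    using that
  proof (induction cs)
    case Nil
    then have "app (ka v) vac {} \<in> cubJ N" by (simp add: polar_Nil cubM_def)
    then show ?case by (simp add: app_ka vac_def)
  next
    case (Cons c cs)
    let ?a = "n + length cs"
    have ins: "{n..<n + length (c # cs)} = insert ?a {n..<?a}" by auto
    have "polar {n..<?a} cs v \<in> cubM N"
    proof (rule capelli_step[where a = ?a and c = c and l = "l c"])
      show "polar (insert ?a {n..<?a}) (c # cs) v \<in> cubM N" using Cons.prems(1) unfolding ins .
      show "Eop c c v = of_nat (l c) * v" "0 < l c + length cs" using Cons weight by auto
      show "Eop c b v \<in> cubJ N" if "b \<in> set cs" for b using Cons that by auto
      show "set (c # cs) \<subseteq> {..<n}" using Cons.prems(2) bs(1) by blast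
    qed (use v N Cons in auto)
    then show ?case using Cons by auto
  qed
  have "polar {n..<N} cs v \<in> avec n N (length cs)" if "set cs \<subseteq> {..<n}" for cs
    using that
  proof (induction cs)
    case Nil
    show ?case using avec.prod[OF v, of "[]" 0 N] by (simp add: polar_Nil gprod_def)
  qed (simp add: polar_Cons avec_Top)
  from this[of bs] have "polar {n..<N} bs v \<in> cubM N"
    using avec_7[of "polar {n..<N} bs v" n N] bs N by simp
  then show ?thesis using desc[of bs] bs raise N by simp
qed

section \<open>The cubics vanish on the secant variety\<close>

context unital_hom
begin

lemma hom_esgn: "h (esgn a S) = esgn a S"
  by (simp add: esgn_def hom_power hom_uminus hom_one)

lemma hom_th: "(\<lambda>S. h (app (th a) f S)) = app (th a) (\<lambda>S. h (f S))"
  by (auto simp: fun_eq_iff app_th hom_mult hom_esgn hom_zero)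

lemma hom_Lop: "(\<lambda>S. h (app (Lop P c u v) f S)) = app (Lop P (\<lambda>i j k. h (c i j k)) u v) (\<lambda>S. h (f S))"
  by (auto simp: fun_eq_iff Lop_def app_sum_op sum_fun_apply app_th app_ka hom_sum hom_mult hom_esgn hom_zero
      intro!: sum.cong)

lemma hom_Qop: "(\<lambda>S. h (app (Qop P c u) f S)) = app (Qop P (\<lambda>i j k. h (c i j k)) u) (\<lambda>S. h (f S))"
proof -
  have "(\<lambda>S. h (app (Qop P c u) f S)) = (\<Sum>j\<in>P. (\<lambda>S. h (app (th j) (app (Lop P c u j) f) S)))"
    by (auto simp: fun_eq_iff Qop_def app_sum_op sum_fun_apply hom_sum)
  also have "\<dots> = (\<Sum>j\<in>P. app (th j) (app (Lop P (\<lambda>i j k. h (c i j k)) u j) (\<lambda>S. h (f S))))"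
    by (simp only: hom_th hom_Lop)
  also have "\<dots> = app (Qop P (\<lambda>i j k. h (c i j k)) u) (\<lambda>S. h (f S))"
    by (simp add: Qop_def app_sum_op)
  finally show ?thesis .
qed

lemma hom_QQQ: "h (app (Qop P c u * (Qop P c v * Qop P c w)) vac S)
  = app (Qop P (\<lambda>i j k. h (c i j k)) u * (Qop P (\<lambda>i j k. h (c i j k)) v * Qop P (\<lambda>i j k. h (c i j k)) w)) vac S"
proof -
  have vac: "(\<lambda>S. h (vac S)) = vac" by (auto simp: fun_eq_iff vac_def hom_zero hom_one)
  show ?thesis
    using fun_cong[OF hom_Qop[of P c u "app (Qop P c v) (app (Qop P c w) vac)"], of S]
    by (simp add: hom_Qop vac)
qed

end

section \<open>Contractions of a decomposable three-form\<close>

lemma ka_diff: "ka (r - s) = ka r - ka s"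
  by (rule extop_eqI) (simp add: app_ka fun_apply left_diff_distrib)

definition evec :: "nat set \<Rightarrow> (nat \<Rightarrow> 'r::comm_ring_1) \<Rightarrow> 'r extop" where
  "evec P f = (\<Sum>j\<in>P. th j * ka (f j))"

lemma evec_Lop: "evec P f = Lop P (\<lambda>_ _. f) 0 0"
  by (simp add: evec_def Lop_def)

lemma evec_evec: "evec P f * evec P g = - (evec P g * evec P f)"
  by (simp add: evec_Lop Lop_Lop[of P "\<lambda>_ _. f" 0 0 P "\<lambda>_ _. g"])

lemma evec_ka: "evec P f * ka r = ka r * evec P f"
  by (simp add: evec_Lop Lop_ka)

lemma evec_square: "evec P f * evec P f = (0 :: 'a::field_char_0 extop)"
proof (rule extop_eqI)
  fix g :: "nat set \<Rightarrow> 'a" and S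
  have "app (evec P f * evec P f) g S = app (- (evec P f * evec P f)) g S"
    by (simp only: evec_evec[of P f f, symmetric])
  then have "app (evec P f * evec P f) g S = - app (evec P f * evec P f) g S"
    by (simp add: fun_apply)
  then show "app (evec P f * evec P f) g S = app 0 g S"
    by (simp add: fun_apply)
qed

lemma evec_mult: "evec P f * evec P g = (\<Sum>j\<in>P. \<Sum>k\<in>P. th j * (th k * ka (f j * g k)))"
proof -
  have "th j * ka (f j) * (th k * ka (g k)) = th j * (th k * ka (f j * g k))" for j k
    by (simp add: mult.assoc assoc_rule[OF th_ka[symmetric]] ka_mult)
  then show ?thesis by (simp add: evec_def sum_product)
qed

definition pl :: "(nat \<Rightarrow> 'a::comm_ring_1) \<Rightarrow> (nat \<Rightarrow> 'a) \<Rightarrow> (nat \<Rightarrow> 'a) \<Rightarrow> nat \<Rightarrow> nat \<Rightarrow> nat \<Rightarrow> 'a" where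
  "pl u v w i j k = pluecker u v w (i, j, k)"

lemma Qop_pl: "Qop P (pl u v w) s =
    ka (u s) * (evec P v * evec P w - evec P w * evec P v)
    - ka (v s) * (evec P u * evec P w - evec P w * evec P u)
    + ka (w s) * (evec P u * evec P v - evec P v * evec P u)"
proof -
  define D where "D f g = (\<Sum>j\<in>P. \<Sum>k\<in>P. th j * (th k * ka (f j * g k)))" for f g :: "nat \<Rightarrow> 'a"
  have ka_D: "ka r * D f g = (\<Sum>j\<in>P. \<Sum>k\<in>P. th j * (th k * ka (r * (f j * g k))))" for r f g
    by (simp add: D_def sum_distrib_left assoc_rule[OF th_ka[symmetric]] mult.assoc ka_mult
        flip: th_ka)
  have "Qop P (pl u v w) s = (\<Sum>j\<in>P. \<Sum>k\<in>P. th j * (th k * ka (pl u v w s j k)))"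
    by (simp add: Qop_def Lop_def sum_distrib_left)
  also have "\<dots> = (\<Sum>j\<in>P. \<Sum>k\<in>P. th j * (th k * ka (u s * (v j * w k))) - th j * (th k * ka (u s * (w j * v k)))
      - th j * (th k * ka (v s * (u j * w k))) + th j * (th k * ka (v s * (w j * u k)))
      + th j * (th k * ka (w s * (u j * v k))) - th j * (th k * ka (w s * (v j * u k))))"
  proof -
    have "pl u v w s j k = u s * (v j * w k) - u s * (w j * v k) - v s * (u j * w k) + v s * (w j * u k)
      + w s * (u j * v k) - w s * (v j * u k)" for j k
      by (simp add: pl_def pluecker_def algebra_simps)
    then show ?thesis by (simp add: ka_add[symmetric] ka_diff distrib_left right_diff_distrib)
  qed
  also have "\<dots> = ka (u s) * D v w - ka (u s) * D w v - ka (v s) * D u w + ka (v s) * D w u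
      + ka (w s) * D u v - ka (w s) * D v u"
    by (simp add: ka_D sum.distrib sum_subtractf)
  finally show ?thesis
    by (simp add: evec_mult D_def[symmetric] right_diff_distrib)
qed

text \<open>Both factors are two-forms in the same three vectors, and a four-form in three vectors
  is zero.\<close>

lemma Qop_pl_Qop_pl: "Qop P (pl u v w) s * Qop P (pl u v w) t = (0 :: 'a::field_char_0 extop)"
proof -
  let ?a = "evec P u" and ?b = "evec P v" and ?c = "evec P w"
  note ba = evec_evec[of P v u] and ca = evec_evec[of P w u] and cb = evec_evec[of P w v]
  note sq = evec_square[of P u] evec_square[of P v] evec_square[of P w]
  have Q: "Qop P (pl u v w) s = ka (u s) * (?b * ?c + ?b * ?c) - ka (v s) * (?a * ?c + ?a * ?c)
      + ka (w s) * (?a * ?b + ?a * ?b)" for s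
    unfolding Qop_pl ba ca cb by simp
  show ?thesis unfolding Q
    by (simp add: algebra_simps ba ca cb sq evec_ka assoc_rule[OF ba] assoc_rule[OF ca] assoc_rule[OF cb]
        assoc_rule[OF evec_ka] assoc_rule[OF sq(1)] assoc_rule[OF sq(2)] assoc_rule[OF sq(3)])
qed

lemma evalp_wv:
  assumes "\<And>i j k. x (i, j, k) = pl u v w i j k + pl u' v' w' i j k"
  shows "evalp x (wv i j k) = pl u v w i j k + pl u' v' w' i j k"
proof -
  interpret ev: unital_hom "evalp x" by (rule unital_hom_evalp)
  show ?thesis
  proof (rule alternating3_eqI[where f = "\<lambda>i j k. evalp x (wv i j k)"])
    fix i j k :: nat
    show "evalp x (wv j i k) = - evalp x (wv i j k)" by (simp add: wv_swap12[of j i] ev.hom_uminus)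
    show "evalp x (wv i k j) = - evalp x (wv i j k)" by (simp add: wv_swap23[of i k] ev.hom_uminus)
    show "evalp x (wv i i k) = 0" by (simp add: wv_same ev.hom_zero)
    show "i < j \<Longrightarrow> j < k \<Longrightarrow> evalp x (wv i j k) = pl u v w i j k + pl u' v' w' i j k"
      by (simp add: wv_sorted assms)
  qed (simp_all add: pl_def pluecker_def algebra_simps)
qed

lemma secant_coneE:
  assumes "x \<in> secant_cone"
  obtains u v w u' v' w' where "\<forall>i j k. x (i, j, k) = pl u v w i j k + pl u' v' w' i j k"
proof -
  obtain u v w u' v' w' where "x = (\<lambda>t. pluecker u v w t + pluecker u' v' w' t)"
    using assms unfolding secant_cone_def by blast
  then show thesis by (intro that[of u v w u' v' w']) (simp add: pl_def)
qed

definition vanishes :: "'a::comm_ring_1 mpoly3 \<Rightarrow> bool" where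
  "vanishes p \<longleftrightarrow> (\<forall>x\<in>secant_cone. evalp x p = 0)"

text \<open>Each of the three factors is a sum over the two decomposables. In every term of the
  product two factors come from the same one and multiply to zero by
  \<open>Qop_pl_Qop_pl\<close>.\<close>

lemma vanishes_cubic: "vanishes (cubic N s t r S :: 'a::field_char_0 mpoly3)"
  unfolding vanishes_def
proof
  fix x :: "var3 \<Rightarrow> 'a"
  assume "x \<in> secant_cone"
  then obtain u v w u' v' w' where "\<forall>i j k. x (i, j, k) = pl u v w i j k + pl u' v' w' i j k"
    by (rule secant_coneE)
  then have x: "x (i, j, k) = pl u v w i j k + pl u' v' w' i j k" for i j k
    by blast
  interpret ev: unital_hom "evalp x" by (rule unital_hom_evalp)
  let ?P = "{..<N}"
  define D D' where "D = Qop ?P (pl u v w)" and "D' = Qop ?P (pl u' v' w')"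
  have Q: "Qop ?P (\<lambda>i j k. evalp x (wv i j k)) s = D s + D' s" for s
    by (simp add: evalp_wv[OF x] D_def D'_def Qop_def Lop_def ka_add[symmetric] distrib_left sum.distrib)
  have comm: "D' s * D t = D t * D' s" for s t unfolding D_def D'_def by (rule Qop_Qop)
  have sq: "D s * D t = 0" "D' s * D' t = 0" for s t
    unfolding D_def D'_def by (rule Qop_pl_Qop_pl)+
  have "(D s + D' s) * ((D t + D' t) * (D r + D' r)) = 0"
    by (simp add: algebra_simps comm assoc_rule[OF comm] sq assoc_rule[OF sq(1)] assoc_rule[OF sq(2)])
  then show "evalp x (cubic N s t r S) = 0"
    unfolding cubic_def ev.hom_QQQ Q by (simp only: app_simps fun_apply)
qed

lemma vanishes_cubJ: "p \<in> cubJ N \<Longrightarrow> vanishes (p :: 'a::field_char_0 mpoly3)"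
proof (induction rule: cubJ.induct)
  case (gen u v w S)
  show ?case using vanishes_cubic[of N u v w S] by (simp only: cubic_def)
qed (simp_all add: vanishes_def unital_hom.hom_add[OF unital_hom_evalp]
    unital_hom.hom_mult[OF unital_hom_evalp] unital_hom.hom_zero[OF unital_hom_evalp])

section \<open>The vanishing ideal is stable under gl(W)\<close>

lemma unital_hom_pconst: "unital_hom (\<lambda>c. [:c:])"
  by standard (simp_all add: one_pCons)

lemma coeff_mult_1: "coeff (p * q) 1 = coeff p 0 * coeff q 1 + coeff p 1 * coeff q 0"
  by (simp add: coeff_mult)

text \<open>The chain rule in algebraic form: the first two coefficients of a product obey the same
  rules as value and derivation, so constants and variables suffice.\<close>

lemma psubst_poly_coeffs:
  assumes "\<And>v. coeff (X v) 0 = x v" "\<And>v. coeff (X v) 1 = evalp x (\<delta> v)"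
  shows "coeff (psubst (\<lambda>c. [:c:]) X p) 0 = evalp x p \<and> coeff (psubst (\<lambda>c. [:c:]) X p) 1 = evalp x (pderivation \<delta> p)"
proof -
  interpret pc: unital_hom "\<lambda>c. [:c:]" by (rule unital_hom_pconst)
  interpret ev: unital_hom "evalp x" by (rule unital_hom_evalp)
  show ?thesis
  proof (induction p rule: mpoly3_induct)
    case (const c)
    show ?case by (simp add: pc.psubst_const pderivation_const ev.hom_zero)
  next
    case (var v)
    show ?case using assms by (simp add: pc.psubst_Var3 pderivation_Var3)
  next
    case (add p q)
    then show ?case by (simp add: pc.psubst_add pderivation_add ev.hom_add)
  next
    case (mult p q)
    then show ?case
      by (simp add: pc.psubst_mult pderivation_mult ev.hom_add ev.hom_mult coeff_mult_1[unfolded One_nat_def] coeff_mult_0)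
  qed
qed

lemma poly_psubst: "poly (psubst (\<lambda>c. [:c:]) X p) t = evalp (\<lambda>v. poly (X v) t) p"
proof -
  interpret pc: unital_hom "\<lambda>c. [:c:]" by (rule unital_hom_pconst)
  interpret ev: unital_hom "evalp (\<lambda>v. poly (X v) t)" by (rule unital_hom_evalp)
  show ?thesis
    by (induction p rule: mpoly3_induct)
      (simp_all add: pc.psubst_const pc.psubst_Var3 pc.psubst_add pc.psubst_mult ev.hom_add ev.hom_mult)
qed

lemma derivation_vanishes:
  fixes X :: "var3 \<Rightarrow> 'a::field_char_0 poly"
  assumes "\<And>v. coeff (X v) 1 = evalp (\<lambda>v. coeff (X v) 0) (\<delta> v)"
    and "\<And>t. evalp (\<lambda>v. poly (X v) t) p = 0"
  shows "evalp (\<lambda>v. coeff (X v) 0) (pderivation \<delta> p) = 0"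
proof -
  have "psubst (\<lambda>c. [:c:]) X p = 0"
    using assms(2) by (subst poly_all_0_iff_0[symmetric]) (simp add: poly_psubst)
  then show ?thesis
    using psubst_poly_coeffs[of X "\<lambda>v. coeff (X v) 0" \<delta> p] assms(1) by simp
qed

lemma vanishes_Eop:
  assumes "vanishes (p :: 'a::field_char_0 mpoly3)"
  shows "vanishes (Eop a b p)"
  unfolding vanishes_def
proof
  fix x :: "var3 \<Rightarrow> 'a"
  assume "x \<in> secant_cone"
  then obtain u v w u' v' w' where "\<forall>i j k. x (i, j, k) = pl u v w i j k + pl u' v' w' i j k"
    by (rule secant_coneE)
  then have x: "x (i, j, k) = pl u v w i j k + pl u' v' w' i j k" for i j k
    by blast
  interpret ev: unital_hom "evalp x" by (rule unital_hom_evalp)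
  \<comment> \<open>In each of the six vectors coordinate b receives t times coordinate a. The
    velocity of this motion is \<open>Evar a b\<close> on coordinates, and sums of two decomposables
    stay such for every t.\<close>
  define U where "U f i = [:f i, if i = b then f a else 0:]" for f :: "nat \<Rightarrow> 'a" and i
  define X where "X = (\<lambda>(i, j, k). pl (U u) (U v) (U w) i j k + pl (U u') (U v') (U w') i j k)"
  have c0: "coeff (U f i) 0 = f i" and c1: "coeff (U f i) (Suc 0) = (if i = b then f a else 0)" for f i
    by (simp_all add: U_def)
  have pl0: "coeff (pl (U f) (U g) (U h) i j k) 0 = pl f g h i j k" for f g h i j k
    by (simp add: pl_def pluecker_def coeff_mult_0 c0)
  have pl1: "coeff (pl (U f) (U g) (U h) i j k) 1 = (if i = b then pl f g h a j k else 0)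
      + (if j = b then pl f g h i a k else 0) + (if k = b then pl f g h i j a else 0)" for f g h i j k
    by (simp add: pl_def pluecker_def coeff_mult_1[unfolded One_nat_def] coeff_mult_0 c0 c1 algebra_simps)
  have X0: "(\<lambda>v. coeff (X v) 0) = x"
    by (auto simp: fun_eq_iff X_def pl0 x)
  have "evalp (\<lambda>v. coeff (X v) 0) (pderivation (Evar a b) p) = 0"
  proof (rule derivation_vanishes)
    fix v' :: var3
    obtain i j k where "v' = (i, j, k)" by (cases v')
    then show "coeff (X v') 1 = evalp (\<lambda>v. coeff (X v) 0) (Evar a b v')"
      unfolding X0 by (simp add: X_def pl1[unfolded One_nat_def] Evar_def ev.hom_add ev.hom_zero
          if_distrib[of "evalp x"] evalp_wv[OF x] cong: if_cong)
  next
    fix t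
    have "(\<lambda>v. poly (X v) t) = (\<lambda>s. pluecker (\<lambda>i. poly (U u i) t) (\<lambda>i. poly (U v i) t) (\<lambda>i. poly (U w i) t) s
        + pluecker (\<lambda>i. poly (U u' i) t) (\<lambda>i. poly (U v' i) t) (\<lambda>i. poly (U w' i) t) s)"
      by (auto simp: fun_eq_iff X_def pl_def pluecker_def)
    then have "(\<lambda>v. poly (X v) t) \<in> secant_cone"
      unfolding secant_cone_def by blast
    then show "evalp (\<lambda>v. poly (X v) t) p = 0" using assms by (simp add: vanishes_def)
  qed
  then show "evalp x (Eop a b p) = 0" by (simp only: X0 Eop_pderivation)
qed

section \<open>Diagonal operators and weights\<close>

lemma mon_deriv_diagonal:
  assumes "\<And>v. v \<in> ky m \<Longrightarrow> \<delta> v = of_nat (d v) * Var3 v"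
  shows "mon_deriv \<delta> m = of_nat (\<Sum>v\<in>ky m. lk m v * d v) * monom m"
proof -
  have "of_nat (lk m v) * monom (m - sg v 1) * \<delta> v = of_nat (lk m v * d v) * monom m" if v: "v \<in> ky m" for v
  proof -
    have "(m - sg v 1) + sg v 1 = m"
      by (rule poly_mapping_eqI)
        (use v in \<open>auto simp: lookup_add lookup_minus lookup_single when_def in_keys_iff\<close>)
    then have "monom m = monom (m - sg v 1) * (Var3 v :: 'a mpoly3)"
      by (metis monom_mult monom_single)
    then show ?thesis using assms[OF v] by (simp add: mult_ac)
  qed
  then show ?thesis by (simp add: mon_deriv_def sum_distrib_right)
qed

lemma lookup_pderivation_diagonal:
  assumes "\<And>m. m \<in> ky p \<Longrightarrow> mon_deriv \<delta> m = of_nat (D m) * monom m"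
  shows "lk (pderivation \<delta> p) m = of_nat (D m) * lk p m"
proof -
  have "pderivation \<delta> p = (\<Sum>m\<in>ky p. sg m (of_nat (D m) * lk p m))"
    unfolding pderivation_def
    by (rule sum.cong) (simp_all add: assms single_eq_const_monom const3_simps const3_of_nat mult_ac)
  then have "lk (pderivation \<delta> p) m = (\<Sum>m'\<in>ky p. if m' = m then of_nat (D m') * lk p m' else 0)"
    by (simp add: lookup_sum lookup_single when_def)
  then show ?thesis
    by (auto simp: not_in_keys_iff_lookup_eq_zero)
qed

lemma Evar_diagonal:
  assumes "valid_var n v"
  shows "Evar a a v = of_nat (case v of (i, j, k) \<Rightarrow> (if i = a then 1 else 0) + (if j = a then 1 else 0)
    + (if k = a then 1 else 0)) * Var3 v"
  using assms by (auto simp: valid_var_def Evar_def wv_sorted split: prod.splits)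

lemma lookup_Eop_diagonal:
  assumes "p \<in> polyring n"
  shows "lk (Eop a a p) m = of_nat (weight m a) * lk p m"
  unfolding Eop_pderivation weight_def
  by (rule lookup_pderivation_diagonal, rule mon_deriv_diagonal, rule Evar_diagonal)
    (use assms in \<open>auto simp: polyring_def\<close>)

lemma lookup_const_mult: "lk (const3 c * p) m = c * lk p m"
  by (simp add: const3_def mult_map_scale_conv_mult[symmetric] Poly_Mapping.map.rep_eq when_def)

lemma Eop_diagonal:
  assumes "p \<in> polyring n" "\<And>m. m \<in> ky p \<Longrightarrow> weight m a = l"
  shows "Eop a a p = of_nat l * p"
proof (rule poly_mapping_eqI)
  fix m
  have "lk (of_nat l * p) m = of_nat l * lk p m"
    by (simp add: const3_of_nat[symmetric] lookup_const_mult)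
  then show "lk (Eop a a p) m = lk (of_nat l * p) m"
    using assms by (cases "m \<in> ky p") (auto simp: lookup_Eop_diagonal[OF assms(1)] not_in_keys_iff_lookup_eq_zero)
qed


text \<open>Iterating this shift separates the eigenspaces of a diagonal operator on a stable space.\<close>

lemma keys_diagonal_shift:
  fixes p q :: "'a::field_char_0 mpoly3"
  assumes "\<And>m. lk q m = of_nat (D m) * lk p m"
  shows "ky (q - of_nat c * p) = {m \<in> ky p. D m \<noteq> c}"
proof -
  have "lk (q - of_nat c * p) m = (of_nat (D m) - of_nat c) * lk p m" for m
    by (simp add: lookup_minus assms const3_of_nat[symmetric] lookup_const_mult left_diff_distrib)
  then show ?thesis by (auto simp: in_keys_iff)
qed

text \<open>The Euler operator of a variable v, shifted by the exponent of v in one monomial,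
  preserves vanishing; it discards that monomial but not one with another exponent. Induction
  descends to a single monomial, detected at the all-ones point.\<close>

lemma evalp_zero_imp_zero:
  fixes p :: "'a::field_char_0 mpoly3"
  assumes "\<And>x. evalp x p = 0"
  shows "p = 0"
  using assms
proof (induction "card (ky p)" arbitrary: p rule: less_induct)
  case less
  show ?case
  proof (rule ccontr)
    assume "p \<noteq> 0"
    then obtain m where m: "m \<in> ky p" by (metis ex_in_conv keys_eq_empty)
    show False
    proof (cases "ky p = {m}")
      case True
      then have "evalp (\<lambda>_. 1) p = lk p m" by (simp add: evalp_def)
      then show False using less.prems m by (simp add: in_keys_iff)
    next
      case False
      then obtain m' where m': "m' \<in> ky p" "m' \<noteq> m" using m by auto
      then obtain v where v: "lk m' v \<noteq> lk m v" by (metis poly_mapping_eqI)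
      let ?\<delta> = "\<lambda>w. if w = v then Var3 v else 0 :: 'a mpoly3"
      let ?q = "pderivation ?\<delta> p" and ?c = "lk m v"
      have lk: "lk ?q m = of_nat (lk m v) * lk p m" for m
      proof (rule lookup_pderivation_diagonal[where D = "\<lambda>m. lk m v"])
        fix m
        have "mon_deriv ?\<delta> m = of_nat (\<Sum>w\<in>ky m. lk m w * (if w = v then 1 else 0)) * monom m"
          by (rule mon_deriv_diagonal) auto
        also have "(\<Sum>w\<in>ky m. lk m w * (if w = v then 1 else 0)) = lk m v"
          by (simp add: if_distrib[of "times _"] not_in_keys_iff_lookup_eq_zero cong: if_cong)
        finally show "mon_deriv ?\<delta> m = of_nat (lk m v) * monom m" .
      qed
      have "evalp x ?q = 0" for x
      proof -
        interpret ev: unital_hom "evalp x" by (rule unital_hom_evalp)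
        let ?X = "\<lambda>w. [:x w, if w = v then x v else 0:]"
        have "evalp (\<lambda>w. coeff (?X w) 0) ?q = 0"
          by (rule derivation_vanishes) (auto simp: less.prems ev.hom_zero)
        then show ?thesis by simp
      qed
      then have "evalp x (?q - of_nat ?c * p) = 0" for x
        using less.prems by (simp add: unital_hom.hom_diff[OF unital_hom_evalp] unital_hom.hom_mult[OF unital_hom_evalp])
      moreover have keys: "ky (?q - of_nat ?c * p) = {m' \<in> ky p. lk m' v \<noteq> ?c}"
        by (rule keys_diagonal_shift) (rule lk)
      then have "card (ky (?q - of_nat ?c * p)) < card (ky p)"
        using m by (intro psubset_card_mono) auto
      ultimately have "?q - of_nat ?c * p = 0" using less.hyps by blast
      then have "{m' \<in> ky p. lk m' v \<noteq> ?c} = {}" using keys by simp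
      then show False using m' v by blast
    qed
  qed
qed

section \<open>Three-forms in six variables\<close>

lemma pl_expand:
  fixes t :: "'a::comm_ring_1"
  shows "pl (\<lambda>i. u i + t * u' i) (\<lambda>i. v i + t * v' i) (\<lambda>i. w i + t * w' i) i j k =
    pl u v w i j k + t * ((pl u' v w i j k + pl u v' w i j k + pl u v w' i j k)
      + t * ((pl u' v' w i j k + pl u' v w' i j k + pl u v' w' i j k) + t * pl u' v' w' i j k))"
  by (simp add: pl_def pluecker_def algebra_simps)

text \<open>Near e_0 e_1 e_2 + e_3 e_4 e_5 the secant variety is parametrized to first order by the other
  eighteen coordinates: a perturbation of order t of the six vectors realizes, up to higher order,
  prescribed values of order t of these coordinates.\<close>

lemma secant_curve:
  fixes y :: "var3 \<Rightarrow> 'a::field_char_0"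
  assumes b: "sorted_wrt (<) [b0, b1, b2, b3, b4, b5 :: nat]"
    and nz: "y (b0, b1, b2) \<noteq> 0" "y (b3, b4, b5) \<noteq> 0"
  defines "g \<equiv> \<lambda>v. if v = (b0, b1, b2) \<or> v = (b3, b4, b5) then 0 else 1 :: nat"
  shows "\<exists>Y. (\<forall>v. poly (Y v) 0 = y v) \<and> (\<forall>t. \<exists>x\<in>secant_cone. \<forall>i j k. i < j \<longrightarrow> j < k \<longrightarrow>
    {i, j, k} \<subseteq> {b0, b1, b2, b3, b4, b5} \<longrightarrow> x (i, j, k) = t ^ g (i, j, k) * poly (Y (i, j, k)) t)"
proof -
  define a d where "a = y (b0, b1, b2)" and "d = y (b3, b4, b5)"
  define e :: "nat \<Rightarrow> nat \<Rightarrow> 'a" where "e s i = (if i = s then 1 else 0)" for s i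
  define u where "u i = a * e b0 i" for i
  define v where "v = e b1"
  define w where "w = e b2"
  \<comment> \<open>These solve the linear part. In \<open>pl u' v w\<close> the coordinate (b1, b2,
    i) is \<open>u' i\<close>; the terms with \<open>v'\<close> and \<open>w'\<close> carry the
    factor a of \<open>u\<close>, hence the divisions, and the minus sign comes from moving i past
    b2. The second block is analogous.\<close>
  define u' where "u' i = (if i \<in> {b3, b4, b5} then y (b1, b2, i) else 0)" for i
  define v' where "v' i = (if i \<in> {b3, b4, b5} then - y (b0, b2, i) / a else 0)" for i
  define w' where "w' i = (if i \<in> {b3, b4, b5} then y (b0, b1, i) / a else 0)" for i
  define p where "p i = d * e b3 i" for i
  define q where "q = e b4"
  define r where "r = e b5"
  define p' where "p' i = (if i \<in> {b0, b1, b2} then y (i, b4, b5) else 0)" for i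
  define q' where "q' i = (if i \<in> {b0, b1, b2} then - y (i, b3, b5) / d else 0)" for i
  define r' where "r' i = (if i \<in> {b0, b1, b2} then y (i, b3, b4) / d else 0)" for i
  define c0 where "c0 i j k = pl u v w i j k + pl p q r i j k" for i j k
  define c1 where "c1 i j k = (pl u' v w i j k + pl u v' w i j k + pl u v w' i j k)
    + (pl p' q r i j k + pl p q' r i j k + pl p q r' i j k)" for i j k
  define c2 where "c2 i j k = (pl u' v' w i j k + pl u' v w' i j k + pl u v' w' i j k)
    + (pl p' q' r i j k + pl p' q r' i j k + pl p q' r' i j k)" for i j k
  define c3 where "c3 i j k = pl u' v' w' i j k + pl p' q' r' i j k" for i j k
  \<comment> \<open>The curve, divided by t in the eighteen coordinates that vanish at the base
    point; so every constant coefficient is the prescribed value of \<open>y\<close>.\<close>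
  define Y where "Y = (\<lambda>(i, j, k). if g (i, j, k) = 0 then [:y (i, j, k), c1 i j k, c2 i j k, c3 i j k:]
    else [:y (i, j, k), c2 i j k, c3 i j k:])"
  have ne: "b0 < b1" "b0 < b2" "b0 < b3" "b0 < b4" "b0 < b5" "b1 < b2" "b1 < b3" "b1 < b4" "b1 < b5"
    "b2 < b3" "b2 < b4" "b2 < b5" "b3 < b4" "b3 < b5" "b4 < b5"
    using b by auto
  have neq: "b0 \<noteq> b1" "b0 \<noteq> b2" "b0 \<noteq> b3" "b0 \<noteq> b4" "b0 \<noteq> b5" "b1 \<noteq> b2" "b1 \<noteq> b3" "b1 \<noteq> b4" "b1 \<noteq> b5"
    "b2 \<noteq> b3" "b2 \<noteq> b4" "b2 \<noteq> b5" "b3 \<noteq> b4" "b3 \<noteq> b5" "b4 \<noteq> b5"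
    using ne by auto
  have ad: "a \<noteq> 0" "d \<noteq> 0" using nz by (simp_all add: a_def d_def)
  have cases: "(i, j, k) \<in> {(b0,b1,b2), (b0,b1,b3), (b0,b1,b4), (b0,b1,b5), (b0,b2,b3), (b0,b2,b4), (b0,b2,b5),
      (b0,b3,b4), (b0,b3,b5), (b0,b4,b5), (b1,b2,b3), (b1,b2,b4), (b1,b2,b5), (b1,b3,b4), (b1,b3,b5), (b1,b4,b5),
      (b2,b3,b4), (b2,b3,b5), (b2,b4,b5), (b3,b4,b5)}"
    if "i < j" "j < k" "{i, j, k} \<subseteq> {b0, b1, b2, b3, b4, b5}" for i j k
  proof -
    have "i \<in> {b0, b1, b2, b3, b4, b5}" "j \<in> {b0, b1, b2, b3, b4, b5}" "k \<in> {b0, b1, b2, b3, b4, b5}"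
      using that by auto
    then show ?thesis using that(1,2) by (elim insertE emptyE) (simp_all add: ne[THEN less_not_sym])
  qed
  have main: "if g (i, j, k) = 0 then c0 i j k = y (i, j, k) else c0 i j k = 0 \<and> c1 i j k = y (i, j, k)"
    if "i < j" "j < k" "{i, j, k} \<subseteq> {b0, b1, b2, b3, b4, b5}" for i j k
    using cases[OF that]
    by (elim insertE emptyE)
      (simp_all add: g_def c0_def c1_def pl_def pluecker_def u_def v_def w_def u'_def v'_def w'_def
        p_def q_def r_def p'_def q'_def r'_def e_def neq neq[symmetric] ad, simp_all add: a_def d_def)
  have "poly (Y v) 0 = y v" for v
    by (cases v) (simp add: Y_def)
  moreover have "\<exists>x\<in>secant_cone. \<forall>i j k. i < j \<longrightarrow> j < k \<longrightarrow>
    {i, j, k} \<subseteq> {b0, b1, b2, b3, b4, b5} \<longrightarrow> x (i, j, k) = t ^ g (i, j, k) * poly (Y (i, j, k)) t" for t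
  proof -
    define x where "x = (\<lambda>s. pluecker (\<lambda>i. u i + t * u' i) (\<lambda>i. v i + t * v' i) (\<lambda>i. w i + t * w' i) s
      + pluecker (\<lambda>i. p i + t * p' i) (\<lambda>i. q i + t * q' i) (\<lambda>i. r i + t * r' i) s)"
    have x: "x (i, j, k) = c0 i j k + t * (c1 i j k + t * (c2 i j k + t * c3 i j k))" for i j k
    proof -
      have "x (i, j, k) = pl (\<lambda>i. u i + t * u' i) (\<lambda>i. v i + t * v' i) (\<lambda>i. w i + t * w' i) i j k
        + pl (\<lambda>i. p i + t * p' i) (\<lambda>i. q i + t * q' i) (\<lambda>i. r i + t * r' i) i j k"
        by (simp add: x_def pl_def)
      then show ?thesis unfolding pl_expand c0_def c1_def c2_def c3_def
        by (simp add: distrib_left add_ac)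
    qed
    have "x \<in> secant_cone" unfolding x_def secant_cone_def by blast
    moreover have "x (i, j, k) = t ^ g (i, j, k) * poly (Y (i, j, k)) t"
      if "i < j" "j < k" "{i, j, k} \<subseteq> {b0, b1, b2, b3, b4, b5}" for i j k
    proof (cases "g (i, j, k) = 0")
      case True
      then show ?thesis using main[OF that] by (simp add: x Y_def)
    next
      case False
      moreover have "g (i, j, k) \<le> 1" by (simp add: g_def)
      ultimately have "g (i, j, k) = 1" by linarith
      then show ?thesis using main[OF that] by (simp add: x Y_def)
    qed
    ultimately show ?thesis by blast
  qed
  ultimately show ?thesis by blast
qed

lemma poly_meval: "poly (meval Y m) t = meval (\<lambda>v. poly (Y v) t) m"
  by (simp add: meval_def poly_prod)

lemma Var3_nonzero: "Var3 v \<noteq> (0 :: 'a::comm_ring_1 mpoly3)"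
proof
  assume "Var3 v = (0 :: 'a mpoly3)"
  then have "lk (Var3 v :: 'a mpoly3) (sg v 1) = 0" by simp
  then show False by (simp add: Var3_def)
qed

text \<open>Substituting the curve into p and dividing by the lowest power of t leaves, at t = 0,
  the part q of p of least degree in the eighteen coordinates. It vanishes where two coordinates are
  nonzero, hence everywhere once multiplied by them, which is impossible for a nonzero least
  part.\<close>

lemma vanishes_six_letters_imp_zero:
  fixes p :: "'a::field_char_0 mpoly3"
  assumes van: "vanishes p" and B: "finite B" "card B \<le> 6"
    and vars: "\<And>m i j k. m \<in> ky p \<Longrightarrow> (i, j, k) \<in> ky m \<Longrightarrow> i < j \<and> j < k \<and> {i, j, k} \<subseteq> B"
  shows "p = 0"
proof (rule ccontr)
  assume "p \<noteq> 0"
  then have kyp: "ky p \<noteq> {}" by simp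
  \<comment> \<open>Fewer than six letters are padded to exactly six, so that the two blocks of
    three exist.\<close>
  have "infinite (UNIV - B)" using B by (simp add: Diff_infinite_finite)
  then obtain C where C: "finite C" "card C = 6 - card B" "C \<subseteq> UNIV - B"
    by (metis infinite_arbitrarily_large)
  define bs where "bs = sorted_list_of_set (B \<union> C)"
  have "card (B \<union> C) = 6"
    using B C by (subst card_Un_disjoint) auto
  then have len: "length bs = 6" and sbs: "set bs = B \<union> C" and sorted: "sorted_wrt (<) bs"
    using B C by (auto simp: bs_def)
  obtain b0 b1 b2 b3 b4 b5 where bs: "bs = [b0, b1, b2, b3, b4, b5]"
    using len by (auto simp: numeral_eq_Suc length_Suc_conv)
  define g :: "var3 \<Rightarrow> nat" where "g = (\<lambda>v. if v = (b0, b1, b2) \<or> v = (b3, b4, b5) then 0 else 1)"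
  define G where "G m = (\<Sum>v\<in>ky m. g v * lk m v)" for m
  define k where "k = Min (G ` ky p)"
  have kle: "k \<le> G m" if "m \<in> ky p" for m
    using that by (simp add: k_def)
  define K where "K = {m \<in> ky p. G m = k}"
  have finK: "finite K" by (simp add: K_def)
  define q where "q = (\<Sum>m\<in>K. sg m (lk p m))"
  have evq: "evalp y q = (\<Sum>m\<in>K. lk p m * meval y m)" for y
    unfolding q_def evalp_psubst
    by (simp add: unital_hom.psubst_sum[OF unital_hom_id] unital_hom.psubst_single[OF unital_hom_id])
  have van_q: "evalp y q = 0" if nz: "y (b0, b1, b2) \<noteq> 0" "y (b3, b4, b5) \<noteq> 0" for y
  proof -
    obtain Y where Y0: "\<And>v. poly (Y v) 0 = y v" and Yt: "\<And>t. \<exists>x\<in>secant_cone. \<forall>i j k. i < j \<longrightarrow> j < k \<longrightarrow>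
      {i, j, k} \<subseteq> {b0, b1, b2, b3, b4, b5} \<longrightarrow> x (i, j, k) = t ^ g (i, j, k) * poly (Y (i, j, k)) t"
      using secant_curve[of b0 b1 b2 b3 b4 b5 y] sorted[unfolded bs] nz unfolding g_def by blast
    define r where "r = (\<Sum>m\<in>ky p. [:lk p m:] * [:0, 1:] ^ (G m - k) * meval Y m)"
    have "poly ([:0, 1:] ^ k * r) t = 0" for t
    proof -
      obtain x where x: "x \<in> secant_cone" and xt: "\<And>i j k. i < j \<Longrightarrow> j < k \<Longrightarrow>
        {i, j, k} \<subseteq> {b0, b1, b2, b3, b4, b5} \<Longrightarrow> x (i, j, k) = t ^ g (i, j, k) * poly (Y (i, j, k)) t"
        using Yt[of t] by blast
      have "meval x m = t ^ G m * meval (\<lambda>v. poly (Y v) t) m" if m: "m \<in> ky p" for m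
      proof -
        have "x v = t ^ g v * poly (Y v) t" if v: "v \<in> ky m" for v
        proof -
          obtain i j k where ijk: "v = (i, j, k)" by (cases v)
          have "{i, j, k} \<subseteq> {b0, b1, b2, b3, b4, b5}"
            using vars[OF m, of i j k] v ijk sbs bs by auto
          then show ?thesis using xt vars[OF m, of i j k] v ijk by auto
        qed
        then show ?thesis
          by (simp add: meval_def G_def power_mult_distrib prod.distrib power_mult[symmetric] power_sum)
      qed
      then have "evalp x p = (\<Sum>m\<in>ky p. lk p m * (t ^ G m * meval (\<lambda>v. poly (Y v) t) m))"
        by (simp add: evalp_psubst psubst_def)
      also have "\<dots> = (\<Sum>m\<in>ky p. t ^ k * (lk p m * t ^ (G m - k) * meval (\<lambda>v. poly (Y v) t) m))"
        by (rule sum.cong) (simp_all add: kle mult_ac power_add[symmetric])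
      also have "\<dots> = poly ([:0, 1:] ^ k * r) t"
        by (simp add: r_def poly_sum poly_meval sum_distrib_left mult_ac)
      finally show ?thesis using van x by (simp add: vanishes_def)
    qed
    then have "[:0, 1:] ^ k * r = 0" by (simp add: poly_all_0_iff_0[symmetric])
    then have "r = 0" by simp
    then have "0 = poly r 0" by simp
    also have "\<dots> = (\<Sum>m\<in>ky p. if G m = k then lk p m * meval y m else 0)"
      unfolding r_def poly_sum
      by (rule sum.cong) (use kle in \<open>force simp: poly_meval Y0\<close>)+
    also have "\<dots> = evalp y q"
      unfolding evq K_def by (simp add: sum.If_cases Int_def)
    finally show ?thesis ..
  qed
  have "evalp y (q * Var3 (b0, b1, b2) * Var3 (b3, b4, b5)) = 0" for y
    using van_q[of y] by (auto simp: unital_hom.hom_mult[OF unital_hom_evalp])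
  then have "q * Var3 (b0, b1, b2) * Var3 (b3, b4, b5) = 0" by (rule evalp_zero_imp_zero)
  then have "q = 0" using Var3_nonzero by (metis mult_eq_0_iff)
  obtain m where m: "m \<in> K"
    using Min_in[of "G ` ky p"] kyp unfolding K_def k_def by fastforce
  then have "lk q m = lk p m"
    using finK by (simp add: q_def lookup_sum lookup_single when_def)
  then show False using m \<open>q = 0\<close> by (auto simp: K_def in_keys_iff)
qed

section \<open>The vanishing ideal is generated by the cubics\<close>

lemma weight_pos: "(i, j, k) \<in> ky m \<Longrightarrow> weight m i > 0 \<and> weight m j > 0 \<and> weight m k > 0"
  unfolding weight_def
  by (auto intro!: sum_pos2[of _ "(i, j, k)"] simp: in_keys_iff)

lemma weight_fresh: "\<forall>v\<in>ky m. valid_var n v \<Longrightarrow> n \<le> c \<Longrightarrow> weight m c = 0"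
  unfolding weight_def by (auto simp: valid_var_def split: prod.splits)

text \<open>Weights are eigenvalues of the diagonal operators, and the commutator tells how E_ij
  shifts them. The additive form avoids truncated subtraction.\<close>

lemma weight_Eop:
  fixes p :: "'a::field_char_0 mpoly3"
  assumes p: "p \<in> polyring n" and l: "\<And>m. m \<in> ky p \<Longrightarrow> weight m = l" and ij: "i < n" "j < n" "i \<noteq> j"
    and m: "m \<in> ky (Eop i j p)"
  shows "weight m c + (if c = j then 1 else 0) = l c + (if c = i then 1 else 0)"
proof -
  have "Eop c c p = of_nat (l c) * p"
    by (rule Eop_diagonal[OF p]) (simp add: l)
  then have "Eop i j (Eop c c p) = of_nat (l c) * Eop i j p"
    by (simp add: const3_of_nat[symmetric] Eop_smult)
  then have "Eop c c (Eop i j p) = of_nat (l c) * Eop i j p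
      + (if c = i then Eop i j p else 0) - (if c = j then Eop i j p else 0)"
    using Eop_commutator[of c c i j p] by (auto simp: algebra_simps)
  then have "lk (Eop c c (Eop i j p)) m = of_nat (l c) * lk (Eop i j p) m
      + (if c = i then lk (Eop i j p) m else 0) - (if c = j then lk (Eop i j p) m else 0)"
    by (simp add: lookup_add lookup_minus const3_of_nat[symmetric] lookup_const_mult)
  then have "(of_nat (weight m c) + (if c = j then 1 else 0)) * lk (Eop i j p) m
      = (of_nat (l c) + (if c = i then 1 else 0)) * lk (Eop i j p) m"
    using lookup_Eop_diagonal[OF Eop_polyring[OF p ij(1)], of c j m] by (auto simp: algebra_simps)
  moreover have "lk (Eop i j p) m \<noteq> 0" using m by (simp add: in_keys_iff)
  ultimately have "(of_nat (weight m c) + (if c = j then 1 else 0) :: 'a) = of_nat (l c) + (if c = i then 1 else 0)"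
    by simp
  then have "(of_nat (weight m c + (if c = j then 1 else 0)) :: 'a) = of_nat (l c + (if c = i then 1 else 0))"
    by (simp split: if_splits)
  then show ?thesis by (simp only: of_nat_eq_iff)
qed

lemma homogeneous_vanishes_imp_cubJ:
  fixes p :: "'a::field_char_0 mpoly3"
  assumes "p \<in> polyring n" "vanishes p" "\<And>m. m \<in> ky p \<Longrightarrow> weight m = l"
  shows "p \<in> cubJ (n + 7)"
  using assms
\<comment> \<open>E_ij with i < j moves one unit of weight from j to i and lowers this sum by j - i,
  so raised vectors fall under the induction hypothesis.\<close>
proof (induction "\<Sum>c<n. c * l c" arbitrary: p l rule: less_induct)
  case less
  note p = less.prems(1) and van = less.prems(2) and l = less.prems(3)
  show ?case
  proof (cases "p = 0")
    case False
    then obtain m where m: "m \<in> ky p" by (metis ex_in_conv keys_eq_empty)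
    have l0: "l c = 0" if "n \<le> c" for c
      using weight_fresh[of m n c] m p that l[OF m] by (auto simp: polyring_def)
    define B where "B = {c. l c > 0}"
    have B: "B \<subseteq> {..<n}" using l0 by (auto simp: B_def) (metis not_le less_irrefl)
    then have finB: "finite B" by (rule finite_subset) simp
    show ?thesis
    proof (cases "card B \<le> 6")
      case True
      have "i < j \<and> j < k \<and> {i, j, k} \<subseteq> B" if m': "m' \<in> ky p" and v: "(i, j, k) \<in> ky m'" for m' i j k
        using weight_pos[OF v] l[OF m'] p m' v by (auto simp: B_def polyring_def valid_var_def)
      then have "p = 0" by (rule vanishes_six_letters_imp_zero[OF van finB True])
      then show ?thesis by (simp add: cubJ.zero)
    next
      case False
      have raise: "Eop i j p \<in> cubJ (n + 7)" if ij: "i < j" "j < n" for i j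
      proof (cases "Eop i j p = 0")
        case False
        then obtain m' where m': "m' \<in> ky (Eop i j p)" by (metis ex_in_conv keys_eq_empty)
        have w: "weight m'' c + (if c = j then 1 else 0) = l c + (if c = i then 1 else 0)"
          if "m'' \<in> ky (Eop i j p)" for m'' c
          by (rule weight_Eop[OF p l]) (use ij that in auto)
        have "(\<Sum>c<n. c * weight m' c) + j = (\<Sum>c<n. c * (weight m' c + (if c = j then 1 else 0)))"
          using ij by (simp add: distrib_left sum.distrib if_distrib[of "(*) _"] cong: if_cong)
        also have "\<dots> = (\<Sum>c<n. c * (l c + (if c = i then 1 else 0)))"
          by (simp only: w[OF m'])
        also have "\<dots> = (\<Sum>c<n. c * l c) + i"
          using ij by (simp add: distrib_left sum.distrib if_distrib[of "(*) _"] cong: if_cong)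
        finally have "(\<Sum>c<n. c * weight m' c) < (\<Sum>c<n. c * l c)" using ij by linarith
        then show ?thesis
        proof (rule less.hyps)
          show "Eop i j p \<in> polyring n" using p ij by (intro Eop_polyring) auto
          show "vanishes (Eop i j p)" using van by (rule vanishes_Eop)
          show "weight m'' = weight m'" if "m'' \<in> ky (Eop i j p)" for m''
            using w[OF that] w[OF m'] by (metis add_right_cancel ext)
        qed
      qed (simp add: cubJ.zero)
      \<comment> \<open>The increasing order turns every E_cb demanded by \<open>capelli\<close>
        into a raising operator.\<close>
      define bs where "bs = take 7 (sorted_list_of_set B)"
      have bsB: "set bs \<subseteq> B" unfolding bs_def using finB set_take_subset by fastforce
      have "sorted_wrt (<) bs" unfolding bs_def using finB by (intro sorted_wrt_take) simp
      then have srt: "sorted_wrt (\<lambda>c b. Eop c b p \<in> cubJ (n + 7)) bs"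
        by (rule sorted_wrt_mono_rel[rotated]) (use bsB B raise in auto)
      show ?thesis
      proof (rule capelli[OF p _ _ _ refl srt])
        show "set bs \<subseteq> {..<n}" using bsB B by auto
        show "distinct bs" by (simp add: bs_def)
        show "length bs = 7" using False finB by (simp add: bs_def)
        show "Eop b b p = of_nat (l b) * p" for b
          by (rule Eop_diagonal[OF p]) (simp add: l)
        show "0 < l b" if "b \<in> set bs" for b using bsB that by (auto simp: B_def)
      qed
    qed
  qed (simp add: cubJ.zero)
qed

text \<open>If two weights differ at a, subtracting from E_aa either of the two eigenvalues removes
  a weight, so both shifts of p are in the ideal by induction. Their difference is a nonzero scalar
  multiple of p.\<close>

lemma vanishes_imp_cubJ:
  fixes p :: "'a::field_char_0 mpoly3"
  assumes "p \<in> polyring n" "vanishes p"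
  shows "p \<in> cubJ (n + 7)"
  using assms
proof (induction "card (weight ` ky p)" arbitrary: p rule: less_induct)
  case less
  note p = less.prems(1) and van = less.prems(2)
  show ?case
  proof (cases "\<exists>l. weight ` ky p \<subseteq> {l}")
    case True
    then obtain l where "weight ` ky p \<subseteq> {l}" by blast
    then show ?thesis by (intro homogeneous_vanishes_imp_cubJ[OF p van, of l]) auto
  next
    case False
    then obtain m m' where m: "m \<in> ky p" "m' \<in> ky p" "weight m \<noteq> weight m'" by blast
    then obtain a where a: "weight m a \<noteq> weight m' a" by auto
    have shift: "Eop a a p - of_nat (weight m0 a) * p \<in> cubJ (n + 7)" if m0: "m0 \<in> ky p" for m0
    proof (rule less.hyps)
      let ?q = "Eop a a p - of_nat (weight m0 a) * p"
      have keys: "ky ?q = {m \<in> ky p. weight m a \<noteq> weight m0 a}"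
        by (rule keys_diagonal_shift) (rule lookup_Eop_diagonal[OF p])
      then show "?q \<in> polyring n" using p by (auto simp: polyring_def)
      show "vanishes ?q"
        using van vanishes_Eop[OF van, of a a]
        by (simp add: vanishes_def unital_hom.hom_diff[OF unital_hom_evalp] unital_hom.hom_mult[OF unital_hom_evalp])
      have "weight m0 \<in> weight ` ky p" "weight m0 \<notin> weight ` ky ?q"
        using m0 by (auto simp: keys)
      moreover have "weight ` ky ?q \<subseteq> weight ` ky p" by (auto simp: keys)
      ultimately show "card (weight ` ky ?q) < card (weight ` ky p)"
        by (intro psubset_card_mono) auto
    qed
    define c where "c = (of_nat (weight m' a) - of_nat (weight m a) :: 'a)"
    have "c \<noteq> 0" using a by (simp add: c_def)
    have "const3 c * p = (Eop a a p - of_nat (weight m a) * p) - (Eop a a p - of_nat (weight m' a) * p)"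
      by (simp add: c_def const3_simps const3_of_nat algebra_simps)
    also have "\<dots> \<in> cubJ (n + 7)" by (intro cub.J_diff shift m)
    finally have "const3 (inverse c) * (const3 c * p) \<in> cubJ (n + 7)" by (rule cubJ.mult)
    moreover have "const3 (inverse c) * (const3 c * p) = p"
      using \<open>c \<noteq> 0\<close> by (simp add: mult.assoc[symmetric] const3_simps(4)[symmetric]) (simp add: const3_simps)
    ultimately show ?thesis by simp
  qed
qed

section \<open>The cubics form the module of highest weight (3,1,1,1,1,1,1)\<close>

lemma cubic_swap: "(cubic N u v w S :: 'a::comm_ring_1 mpoly3) = cubic N v u w S"
  "(cubic N u v w S :: 'a mpoly3) = cubic N u w v S"
proof -
  let ?Q = "Qop {..<N} wv :: nat \<Rightarrow> 'a mpoly3 extop"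
  have "?Q u * (?Q v * ?Q w) = ?Q v * (?Q u * ?Q w)"
    by (simp add: mult.assoc[symmetric] Qop_Qop[of "{..<N}" wv u "{..<N}" wv v])
  moreover have "?Q u * (?Q v * ?Q w) = ?Q u * (?Q w * ?Q v)"
    by (simp only: Qop_Qop[of "{..<N}" wv v "{..<N}" wv w])
  ultimately show "cubic N u v w S = (cubic N v u w S :: 'a mpoly3)" "cubic N u v w S = (cubic N u w v S :: 'a mpoly3)"
    unfolding cubic_def by (simp_all only:)
qed

text \<open>Q attaches two letters one after the other; three predicates allow a property that
  counts letters to change at each stage.\<close>

lemma Qop_invariant:
  assumes step: "\<And>f a r. V f \<Longrightarrow> a \<in> P \<Longrightarrow> r \<in> C \<Longrightarrow> V' (app (th a) (app (ka r) f))"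
    and zero': "V' 0" and add': "\<And>f g. V' f \<Longrightarrow> V' g \<Longrightarrow> V' (f + g)"
    and step': "\<And>f a. V' f \<Longrightarrow> a \<in> P \<Longrightarrow> V'' (app (th a) f)"
    and zero'': "V'' 0" and add'': "\<And>f g. V'' f \<Longrightarrow> V'' g \<Longrightarrow> V'' (f + g)"
    and c: "\<And>j k. j \<in> P \<Longrightarrow> k \<in> P \<Longrightarrow> c u j k \<in> C" and f: "V f"
  shows "V'' (app (Qop P c u) f)"
proof -
  have sum': "V' (sum F A)" if "\<And>x. x \<in> A \<Longrightarrow> V' (F x)" for F and A :: "nat set"
    using that by (induction A rule: infinite_finite_induct) (simp_all add: zero' add')
  have sum'': "V'' (sum F A)" if "\<And>x. x \<in> A \<Longrightarrow> V'' (F x)" for F and A :: "nat set"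
    using that by (induction A rule: infinite_finite_induct) (simp_all add: zero'' add'')
  have "V' (app (Lop P c u j) f)" if "j \<in> P" for j
    unfolding Lop_def app_sum_op by (rule sum') (use that f in \<open>auto intro!: step c\<close>)
  then show ?thesis
    unfolding Qop_def app_sum_op by (intro sum'') (auto intro!: step')
qed

lemma polyring_esgn: "p \<in> polyring n \<Longrightarrow> esgn a S * p \<in> polyring n"
  by (auto simp: esgn_def minus_one_power_iff polyring_uminus)

lemma cubic_polyring:
  assumes "u < n" "v < n" "w < n"
  shows "(cubic n u v w S :: 'a::comm_ring_1 mpoly3) \<in> polyring n"
proof -
  let ?V = "\<lambda>f :: nat set \<Rightarrow> 'a mpoly3. \<forall>S. f S \<in> polyring n"
  have Q: "?V (app (Qop {..<n} wv u) f)" if "?V f" "u < n" for f u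
    by (rule Qop_invariant[where V = ?V and V' = ?V and V'' = ?V and C = "polyring n"])
      (use that in \<open>auto simp: fun_apply app_th app_ka intro!: polyring_0 polyring_add polyring_esgn polyring_mult polyring_wv\<close>)
  have "?V vac" using polyring_const[of 1 n] by (auto simp: vac_def polyring_0 const3_simps)
  then show ?thesis unfolding cubic_def using assms by (simp add: Q)
qed

lemma cubic_support:
  assumes "cubic n u v w S \<noteq> (0 :: 'a::comm_ring_1 mpoly3)"
  shows "S \<subseteq> {..<n} \<and> card S = 6"
proof -
  let ?V = "\<lambda>d (f :: nat set \<Rightarrow> 'a mpoly3). \<forall>S. f S \<noteq> 0 \<longrightarrow> S \<subseteq> {..<n} \<and> card S = d"
  have th: "?V (Suc d) (app (th a) f)" if f: "?V d f" and a: "a < n" for d a f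
  proof (intro allI impI)
    fix S assume nz: "app (th a) f S \<noteq> 0"
    then have "a \<in> S" "f (S - {a}) \<noteq> 0" by (auto simp: app_th split: if_splits)
    then have "S - {a} \<subseteq> {..<n}" "card (S - {a}) = d" using f by auto
    moreover have "S = insert a (S - {a})" using \<open>a \<in> S\<close> by auto
    moreover have "finite (S - {a})" using \<open>S - {a} \<subseteq> {..<n}\<close> by (rule finite_subset) simp
    ultimately show "S \<subseteq> {..<n} \<and> card S = Suc d"
      using a by (metis Diff_iff card_insert_disjoint insertI1 insert_subset lessThan_iff)
  qed
  have addV: "?V k (f + g)" if "?V k f" "?V k g" for k f g
    using that by (metis fun_apply(1) add.right_neutral)
  have Q: "?V (Suc (Suc d)) (app (Qop {..<n} wv u) f)" if "?V d f" for d f u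
  proof (rule Qop_invariant[where V = "?V d" and V' = "?V (Suc d)" and V'' = "?V (Suc (Suc d))" and C = UNIV])
    show "?V (Suc d) (app (th a) (app (ka r) f))" if "?V d f" "a \<in> {..<n}" for f a r
    proof (rule th)
      show "?V d (app (ka r) f)" using that(1) by (metis app_ka mult_zero_right)
    qed (use that in auto)
    show "?V (Suc (Suc d)) (app (th a) f)" if "?V (Suc d) f" "a \<in> {..<n}" for f a
      by (rule th) (use that in auto)
    show "?V (Suc d) (f + g)" if "?V (Suc d) f" "?V (Suc d) g" for f g by (rule addV[OF that])
    show "?V (Suc (Suc d)) (f + g)" if "?V (Suc (Suc d)) f" "?V (Suc (Suc d)) g" for f g by (rule addV[OF that])
  qed (use that in \<open>auto simp: fun_apply\<close>)
  have "?V 0 vac" by (auto simp: vac_def)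
  from Q[OF Q[OF Q[OF this, of w], of v], of u] show ?thesis
    using assms by (simp add: cubic_def numeral_eq_Suc)
qed

text \<open>Since \<open>Lop\<close> with indices 0 0 is zero, contraction by 0 commutes with Q_0
  and then kills the unit; so the letter 0 does not occur in the six-form.\<close>

lemma cubic_000_zero:
  assumes "0 \<in> S" "0 < n"
  shows "cubic n 0 0 0 S = (0 :: 'a::field_char_0 mpoly3)"
proof -
  let ?Q = "Qop {..<n} wv 0 :: 'a mpoly3 extop"
  have "Lop {..<n} wv 0 0 = (0 :: 'a mpoly3 extop)" by (simp add: Lop_def wv_same)
  then have io: "io 0 * ?Q = ?Q * io 0" using cub.io_Q[of 0 n 0, where 'a = 'a] assms(2) by simp
  have "io 0 * (?Q * (?Q * ?Q)) = ?Q * (?Q * ?Q) * io 0"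
    by (simp add: io assoc_rule[OF io] mult.assoc)
  then have "app (io 0 * (?Q * (?Q * ?Q))) vac (S - {0}) = app (?Q * (?Q * ?Q) * io 0) vac (S - {0})"
    by (simp only:)
  then have "esgn 0 (S - {0}) * cubic n 0 0 0 S = (0 :: 'a mpoly3)"
    using assms(1) by (simp add: app_io cubic_def fun_apply insert_absorb)
  then show ?thesis by (metis esgn_square' mult_zero_right)
qed

text \<open>Three indices 0 and the letters 1 to 6 make up the weight. Raising leaves the indices
  alone and can only replace a letter a+1 by a, which is already present unless a = 0, where
  \<open>cubic_000_zero\<close> applies.\<close>

lemma hw316_cubic:
  assumes "n \<ge> 7"
  shows "hw316 n (cubic n 0 0 0 {1..6} :: 'a::field_char_0 mpoly3)"
proof -
  let ?p = "cubic n 0 0 0 {1..6} :: 'a mpoly3"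
  have poly: "?p \<in> polyring n" using assms by (intro cubic_polyring) auto
  have "weight m c = lam316 c" if m: "m \<in> ky ?p" for m c
  proof (cases "c < n")
    case True
    have "Eop c c ?p = of_nat (lam316 c) * ?p"
      using True by (auto simp: Eop_cubic app_th_io_cubic lam316_def insert_absorb esgn_remove esgn_insert algebra_simps
          simp del: app_simps)
    then have "of_nat (weight m c) * lk ?p m = of_nat (lam316 c) * lk ?p m"
      using lookup_Eop_diagonal[OF poly, of c m] by (auto simp: const3_of_nat[symmetric] lookup_const_mult)
    then show ?thesis using m by (simp add: in_keys_iff)
  next
    case False
    then show ?thesis using weight_fresh[of m n c] poly m assms by (auto simp: polyring_def lam316_def)
  qed
  moreover have "Eop a (Suc a) ?p = 0" if "Suc a < n" for a
  proof -
    have "Eop a (Suc a) ?p = (if Suc a \<in> {1..6} \<and> a \<notin> {1..6} - {Suc a} then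
        esgn (Suc a) {1..6} * (esgn a ({1..6} - {Suc a}) * cubic n 0 0 0 (insert a ({1..6} - {Suc a}))) else 0)"
      using that by (subst Eop_cubic) (auto simp: app_th_io_cubic simp del: app_simps)
    also have "\<dots> = 0"
    proof (cases "a = 0")
      case True
      then show ?thesis using assms by (simp add: cubic_000_zero)
    qed auto
    finally show ?thesis .
  qed
  ultimately show ?thesis using poly by (auto simp: hw316_def)
qed

section \<open>All cubics lie in the highest weight module\<close>

context
  fixes n :: nat and H :: "'a::field_char_0 mpoly3 set"
  assumes n: "n \<ge> 7" and H: "H = S316 n"
begin

lemma S316_cubic_hw: "cubic n 0 0 0 {1..6} \<in> H"
  unfolding H by (rule S316.hw[OF hw316_cubic[OF n]])

lemma S316_zero: "0 \<in> H"
  using S316.smult[OF S316_cubic_hw[unfolded H], of 0] by (simp add: const3_simps H)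

lemma S316_uminus: "p \<in> H \<Longrightarrow> - p \<in> H"
  unfolding H using S316.smult[of p n "- 1"] by (simp add: const3_simps)

lemma S316_diff: "p \<in> H \<Longrightarrow> q \<in> H \<Longrightarrow> p - q \<in> H"
  using S316.add[of p n "- q"] S316_uminus[of q] by (simp add: H)

lemma S316_esgn: "p \<in> H \<Longrightarrow> esgn a S * p \<in> H"
  by (auto simp: esgn_def minus_one_power_iff S316_uminus)

lemma S316_div: "of_nat (Suc k) * p \<in> H \<Longrightarrow> p \<in> H"
  unfolding H using S316.smult[of "of_nat (Suc k) * p" n "inverse (of_nat (Suc k))"]
  by (simp only: const3_inverse_mult)

lemma S316_cubic_000: "cubic n 0 0 0 S \<in> H"
proof -
  have main: "cubic n 0 0 0 S \<in> H" if "S \<subseteq> {1..<n}" "card S = 6" for S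
    using that
  proof (induction "card (S - {1..6})" arbitrary: S rule: less_induct)
    case less
    have fin: "finite S" using less.prems(1) by (rule finite_subset) simp
    show ?case
    proof (cases "S \<subseteq> {1..6}")
      case True
      then have "S = {1..6}" by (intro card_subset_eq) (simp_all add: less.prems(2))
      then show ?thesis using S316_cubic_hw by simp
    next
      case False
      then obtain t where t: "t \<in> S" "t \<notin> {1..6}" by blast
      have "\<not> {1..6} \<subseteq> S"
      proof
        assume "{1..6} \<subseteq> S"
        then have "{1..6} = S" by (rule card_subset_eq[OF fin]) (simp add: less.prems(2))
        with t show False by blast
      qed
      then obtain s where s: "s \<in> {1..6}" "s \<notin> S" by blast
      \<comment> \<open>E_ts puts t in place of s and leads from \<open>S'\<close> back to S up to
        sign; as s is nonzero, the three indices 0 are not affected.\<close>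
      define S' where "S' = insert s (S - {t})"
      have "cubic n 0 0 0 S' \<in> H"
      proof (rule less.hyps)
        show "S' \<subseteq> {1..<n}" using less.prems(1) s n by (auto simp: S'_def)
        show "card S' = 6" using less.prems(2) s t fin by (simp add: S'_def)
        have "S' - {1..6} = (S - {1..6}) - {t}" using s by (auto simp: S'_def)
        then show "card (S' - {1..6}) < card (S - {1..6})"
          using card_Diff1_less[of "S - {1..6}" t] fin t by simp
      qed
      moreover have tn: "t < n" "s < n" "s \<noteq> 0" "t \<noteq> s" using t s less.prems(1) n by auto
      ultimately have "Eop t s (cubic n 0 0 0 S') \<in> H" unfolding H by (intro S316.act)
      moreover have "Eop t s (cubic n 0 0 0 S' :: 'a mpoly3) = esgn s S' * (esgn t (S' - {s}) * cubic n 0 0 0 S)"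
      proof -
        have "insert t (S' - {s}) = S" "t \<notin> S' - {s}" "s \<in> S'" using s t by (auto simp: S'_def)
        then show ?thesis using tn by (simp add: Eop_cubic app_th_io_cubic del: app_simps)
      qed
      ultimately have "esgn s S' * (esgn t (S' - {s}) * cubic n 0 0 0 S) \<in> H" by (simp only:)
      then have "esgn t (S' - {s}) * (esgn s S' * (esgn s S' * (esgn t (S' - {s}) * cubic n 0 0 0 S))) \<in> H"
        by (rule S316_esgn[OF S316_esgn])
      then show ?thesis by (simp only: esgn_square')
    qed
  qed
  show ?thesis
  proof (cases "cubic n 0 0 0 S = (0 :: 'a mpoly3)")
    case False
    then have S: "S \<subseteq> {..<n}" "card S = 6" using cubic_support by blast+
    have "0 \<notin> S"
    proof
      assume "0 \<in> S"
      then have "cubic n 0 0 0 S = (0 :: 'a mpoly3)" by (rule cubic_000_zero) (use n in simp)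
      with False show False ..
    qed
    have "S \<subseteq> {1..<n}"
    proof
      fix x assume "x \<in> S"
      then have "x < n" using S(1) by auto
      moreover have "x \<noteq> 0" using \<open>x \<in> S\<close> \<open>0 \<notin> S\<close> by metis
      ultimately show "x \<in> {1..<n}" by simp
    qed
    then show ?thesis using S(2) by (rule main)
  qed (simp add: S316_zero)
qed

lemma S316_th_io_cubic:
  assumes "\<And>S. cubic n u v w S \<in> H"
  shows "app (th b * io a) (cubic n u v w) S \<in> H"
  unfolding app_th_io_cubic by (simp add: S316_zero S316_esgn assms)

text \<open>Applying \<open>E\<^sub>x\<^sub>0\<close> to a cubic polarizes one of its zero indices to x, up to cubics already treated.\<close>

lemma S316_polarize:
  assumes x: "x < n" and mem: "\<And>S. cubic n u v w S \<in> H"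
  shows "(if u = 0 then cubic n x v w S else 0) + (if v = 0 then cubic n u x w S else 0)
    + (if w = 0 then cubic n u v x S else 0) \<in> H"
proof -
  have E: "Eop x 0 (cubic n u v w S) \<in> H"
    using mem x n unfolding H by (intro S316.act) auto
  have eq: "Eop x 0 (cubic n u v w S :: 'a mpoly3) - app (th 0 * io x) (cubic n u v w) S
    = (if u = 0 then cubic n x v w S else 0) + (if v = 0 then cubic n u x w S else 0)
    + (if w = 0 then cubic n u v x S else 0)"
    using x n by (subst Eop_cubic) auto
  show ?thesis
    unfolding eq[symmetric] by (intro S316_diff E S316_th_io_cubic mem)
qed

text \<open>The indices leave 0 one at a time. By symmetry in the indices, the new cubic appears
  with multiplicity 3, then 2, then 1, and these integers are divided out.\<close>

lemma S316_cubic: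
  assumes "u < n" "v < n" "w < n"
  shows "cubic n u v w S \<in> H"
proof -
  have 1: "cubic n x 0 0 S \<in> H" if x: "x < n" for x S
  proof (cases "x = 0")
    case False
    have "cubic n x 0 0 S + cubic n 0 x 0 S + cubic n 0 0 x S \<in> H"
      using S316_polarize[OF x S316_cubic_000] by simp
    moreover have "cubic n 0 x 0 S = (cubic n x 0 0 S :: 'a mpoly3)" "cubic n 0 0 x S = (cubic n x 0 0 S :: 'a mpoly3)"
      using cubic_swap(1)[of n 0 x 0 S, where 'a = 'a] cubic_swap(2)[of n 0 0 x S, where 'a = 'a] by simp_all
    ultimately have "of_nat (Suc 2) * cubic n x 0 0 S \<in> H"
      by (simp add: algebra_simps)
    then show ?thesis by (rule S316_div)
  qed (simp add: S316_cubic_000)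
  have 2: "cubic n x y 0 S \<in> H" if x: "x < n" and y: "y < n" for x y S
  proof (cases "x = 0")
    case True
    have "cubic n 0 y 0 S = (cubic n y 0 0 S :: 'a mpoly3)" by (rule cubic_swap)
    then show ?thesis using True 1[OF y] by simp
  next
    case False
    have "cubic n x y 0 S + cubic n x 0 y S \<in> H"
      using S316_polarize[OF y 1[OF x]] False by simp
    moreover have "cubic n x 0 y S = (cubic n x y 0 S :: 'a mpoly3)" by (rule cubic_swap)
    ultimately have "of_nat (Suc 1) * cubic n x y 0 S \<in> H"
      by (simp add: algebra_simps)
    then show ?thesis by (rule S316_div)
  qed
  show ?thesis
  proof (cases "u = 0 \<or> v = 0")
    case True
    then show ?thesis
    proof
      assume "u = 0"
      then have "cubic n u v w S = (cubic n v w 0 S :: 'a mpoly3)"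
        using cubic_swap(1)[of n 0 v w S, where 'a = 'a] cubic_swap(2)[of n v 0 w S, where 'a = 'a] by simp
      then show ?thesis using 2 assms by simp
    next
      assume "v = 0"
      then have "cubic n u v w S = (cubic n u w 0 S :: 'a mpoly3)"
        using cubic_swap(2)[of n u 0 w S, where 'a = 'a] by simp
      then show ?thesis using 2 assms by simp
    qed
  next
    case False
    then show ?thesis using S316_polarize[OF assms(3) 2[OF assms(1,2)]] by simp
  qed
qed

end

section \<open>The highest weight module lies in the secant ideal\<close>

lemma hw316_raise:
  assumes hw: "hw316 n p" and "i < j" "j < n"
  shows "Eop i j p = 0"
  using assms(2,3)
proof (induction j)
  case (Suc j)
  show ?case
  proof (cases "i = j")
    case True
    then show ?thesis using hw Suc by (simp add: hw316_def)
  next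
    case False
    then have "Eop i j p = 0" "Eop j (Suc j) p = 0" using Suc hw by (auto simp: hw316_def)
    then show ?thesis using Eop_commutator[of i j j "Suc j" p] Suc.prems by auto
  qed
qed simp

text \<open>The letters 0 to 6 all have positive weight and every raising operator gives zero, so
  \<open>capelli\<close> applies to any such vector.\<close>

lemma hw316_vanishes:
  fixes p :: "'a::field_char_0 mpoly3"
  assumes "hw316 n p" "n \<ge> 7"
  shows "vanishes p"
proof -
  have p: "p \<in> polyring n" and w: "\<And>m. m \<in> ky p \<Longrightarrow> weight m = lam316"
    using assms(1) by (auto simp: hw316_def)
  have srt: "sorted_wrt (\<lambda>c b. Eop c b p \<in> cubJ (n + 7)) [0..<7]"
    by (rule sorted_wrt_mono_rel[OF _ sorted_wrt_upt])
      (use assms in \<open>auto simp: hw316_raise cubJ.zero\<close>)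
  have "p \<in> cubJ (n + 7)"
  proof (rule capelli[OF p _ _ _ refl srt, where l = lam316])
    show "Eop b b p = of_nat (lam316 b) * p" for b
      by (rule Eop_diagonal[OF p]) (simp add: w)
  qed (use assms(2) in \<open>auto simp: lam316_def\<close>)
  then show ?thesis by (rule vanishes_cubJ)
qed

lemma S316_secant_ideal:
  fixes p :: "'a::field_char_0 mpoly3"
  assumes "p \<in> S316 n" "n \<ge> 7"
  shows "p \<in> polyring n \<and> vanishes p"
  using assms(1)
proof (induction rule: S316.induct)
  case (hw p)
  then show ?case using hw316_vanishes[OF hw assms(2)] by (auto simp: hw316_def)
next
  case (add p q)
  then show ?case by (auto simp: polyring_add vanishes_def unital_hom.hom_add[OF unital_hom_evalp])
next
  case (smult p c)
  then show ?case
    by (auto simp: polyring_mult polyring_const vanishes_def unital_hom.hom_mult[OF unital_hom_evalp])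
next
  case (act p a b)
  then show ?case by (auto simp: Eop_polyring vanishes_Eop)
qed

section \<open>Retraction to the first n letters\<close>

text \<open>Disposes of the seven auxiliary letters: it fixes polynomials in n letters and maps each
  cubic in N letters to a cubic in n letters or to zero.\<close>

definition retr :: "nat \<Rightarrow> 'a::comm_ring_1 mpoly3 \<Rightarrow> 'a mpoly3" where
  "retr n = psubst const3 (\<lambda>v. if valid_var n v then Var3 v else 0)"

lemma unital_hom_retr: "unital_hom (retr n)"
  unfolding retr_def by (rule unital_hom.psubst_hom[OF unital_hom_const3])

lemma retr_Var3: "retr n (Var3 v) = (if valid_var n v then Var3 v else 0)"
  unfolding retr_def by (rule unital_hom.psubst_Var3[OF unital_hom_const3])

lemma retr_const: "retr n (const3 c) = const3 c"
  unfolding retr_def by (rule unital_hom.psubst_const[OF unital_hom_const3])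

lemma retr_polyring: "retr n p \<in> polyring n"
  by (induction p rule: mpoly3_induct)
    (auto simp: retr_Var3 retr_const unital_hom.hom_add[OF unital_hom_retr] unital_hom.hom_mult[OF unital_hom_retr]
      polyring_const polyring_Var3 polyring_0 polyring_add polyring_mult)

lemma retr_id: "p \<in> polyring n \<Longrightarrow> retr n p = p"
  by (induction p rule: polyring_induct)
    (simp_all add: retr_Var3 retr_const unital_hom.hom_add[OF unital_hom_retr] unital_hom.hom_mult[OF unital_hom_retr])

lemma retr_wv: "retr n (wv i j k) = (if i < n \<and> j < n \<and> k < n then wv i j k else 0)"
  by (auto simp: wv_def retr_Var3 unital_hom.hom_uminus[OF unital_hom_retr] unital_hom.hom_zero[OF unital_hom_retr]
      valid_var_def)

lemma retr_cubic:
  assumes "n \<le> N"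
  shows "retr n (cubic N u v w S) = (if u < n \<and> v < n \<and> w < n then cubic n u v w S else (0 :: 'a::comm_ring_1 mpoly3))"
proof -
  let ?c = "\<lambda>i j k. retr n (wv i j k) :: 'a mpoly3"
  have L: "Lop {..<N} ?c u v = (if u < n \<and> v < n then Lop {..<n} wv u v else 0)" for u v
  proof (cases "u < n \<and> v < n")
    case True
    then have "Lop {..<N} ?c u v = Lop {..<n} wv u v"
      unfolding Lop_def retr_wv by (intro sum.mono_neutral_cong_right) (use assms in auto)
    then show ?thesis using True by simp
  qed (auto simp: Lop_def retr_wv)
  have Q: "Qop {..<N} ?c u = (if u < n then Qop {..<n} wv u else 0)" for u
  proof (cases "u < n")
    case True
    then have "Qop {..<N} ?c u = Qop {..<n} wv u"
      unfolding Qop_def L by (intro sum.mono_neutral_cong_right) (use assms in auto)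
    then show ?thesis using True by simp
  qed (simp add: Qop_def L)
  show ?thesis
    unfolding cubic_def unital_hom.hom_QQQ[OF unital_hom_retr] Q by (auto simp: fun_apply)
qed

section \<open>Generators of the secant ideal\<close>

lemma ideal_gen_zero: "0 \<in> ideal_gen R G"
  unfolding ideal_gen_def by (auto intro!: exI[of _ "{}"])

lemma ideal_gen_base: "g \<in> G \<Longrightarrow> 1 \<in> R \<Longrightarrow> g \<in> ideal_gen R G"
  unfolding ideal_gen_def by (auto intro!: exI[of _ "{g}"] exI[of _ "\<lambda>_. 1"])

lemma ideal_gen_mult:
  assumes R: "\<And>r s. r \<in> R \<Longrightarrow> s \<in> R \<Longrightarrow> r * s \<in> R" and "p \<in> ideal_gen R G" "r \<in> R"
  shows "r * p \<in> ideal_gen R G"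
proof -
  obtain F c where F: "finite F" "F \<subseteq> G" "\<forall>g\<in>F. c g \<in> R" and p: "p = (\<Sum>g\<in>F. c g * g)"
    using assms(2) unfolding ideal_gen_def by auto
  have "r * p = (\<Sum>g\<in>F. (r * c g) * g)" by (simp add: p sum_distrib_left mult.assoc)
  moreover have "\<forall>g\<in>F. r * c g \<in> R" using F R assms(3) by blast
  ultimately show ?thesis using F(1,2) unfolding ideal_gen_def mem_Collect_eq
    by (intro exI[of _ F] exI[of _ "\<lambda>g. r * c g"] conjI)
qed

lemma ideal_gen_add:
  assumes R: "0 \<in> R" "\<And>r s. r \<in> R \<Longrightarrow> s \<in> R \<Longrightarrow> r + s \<in> R"
    and "p \<in> ideal_gen R G" "q \<in> ideal_gen R G"
  shows "p + q \<in> ideal_gen R G"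
proof -
  obtain F c where F: "finite F" "F \<subseteq> G" "\<forall>g\<in>F. c g \<in> R" and p: "p = (\<Sum>g\<in>F. c g * g)"
    using assms(3) unfolding ideal_gen_def by auto
  obtain F' c' where F': "finite F'" "F' \<subseteq> G" "\<forall>g\<in>F'. c' g \<in> R" and q: "q = (\<Sum>g\<in>F'. c' g * g)"
    using assms(4) unfolding ideal_gen_def by auto
  define e where "e g = (if g \<in> F then c g else 0) + (if g \<in> F' then c' g else 0)" for g
  have "(\<Sum>g\<in>F \<union> F'. e g * g) = (\<Sum>g\<in>F \<union> F'. if g \<in> F then c g * g else 0) + (\<Sum>g\<in>F \<union> F'. if g \<in> F' then c' g * g else 0)"
    unfolding sum.distrib[symmetric] by (rule sum.cong) (auto simp: e_def distrib_right)
  also have "(\<Sum>g\<in>F \<union> F'. if g \<in> F then c g * g else 0) = p"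
    unfolding p by (rule sum.mono_neutral_cong_right) (use F F' in auto)
  also have "(\<Sum>g\<in>F \<union> F'. if g \<in> F' then c' g * g else 0) = q"
    unfolding q by (rule sum.mono_neutral_cong_right) (use F F' in auto)
  finally have "p + q = (\<Sum>g\<in>F \<union> F'. e g * g)" ..
  moreover have "\<forall>g\<in>F \<union> F'. e g \<in> R" using F F' R by (auto simp: e_def)
  moreover have "finite (F \<union> F')" "F \<union> F' \<subseteq> G" using F F' by auto
  ultimately show ?thesis unfolding ideal_gen_def mem_Collect_eq
    by (intro exI[of _ "F \<union> F'"] exI[of _ e] conjI)
qed

lemma retr_cubJ:
  fixes p :: "'a::field_char_0 mpoly3"
  assumes "p \<in> cubJ N" "n \<le> N" "n \<ge> 7"
  shows "retr n p \<in> ideal_gen (polyring n) (S316 n)"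
  using assms(1)
proof (induction rule: cubJ.induct)
  case (gen u v w S)
  have "retr n (cubic N u v w S :: 'a mpoly3) \<in> ideal_gen (polyring n) (S316 n)"
    using polyring_const[of 1 n] S316_cubic[OF assms(3) refl]
    by (auto simp: retr_cubic[OF assms(2)] const3_simps intro!: ideal_gen_zero ideal_gen_base)
  then show ?case by (simp only: cubic_def)
next
  case (add p q)
  then show ?case
    unfolding unital_hom.hom_add[OF unital_hom_retr] by (intro ideal_gen_add) (auto simp: polyring_0 polyring_add)
next
  case (mult p r)
  then show ?case
    unfolding unital_hom.hom_mult[OF unital_hom_retr]
    by (intro ideal_gen_mult) (auto simp: polyring_mult retr_polyring)
next
  case zero
  then show ?case by (simp add: unital_hom.hom_zero[OF unital_hom_retr] ideal_gen_zero)
qed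

theorem theorem1p2:
  fixes n :: nat
  assumes "alg_closed TYPE('a::field_char_0)"
    and "n \<ge> 7"
  shows "(secant_ideal n :: 'a mpoly3 set) = ideal_gen (polyring n) (S316 n)"
proof (intro set_eqI iffI)
  fix p :: "'a mpoly3"
  assume "p \<in> secant_ideal n"
  then have p: "p \<in> polyring n" "vanishes p" by (auto simp: secant_ideal_def vanishes_def)
  \<comment> \<open>The expression of p by cubics involves n + 7 letters; the retraction moves it to
    n letters and fixes p.\<close>
  have "retr n p \<in> ideal_gen (polyring n) (S316 n)"
    by (rule retr_cubJ[OF vanishes_imp_cubJ[OF p]]) (use assms in auto)
  then show "p \<in> ideal_gen (polyring n) (S316 n)" using p by (simp add: retr_id)
next
  fix p :: "'a mpoly3"
  assume "p \<in> ideal_gen (polyring n) (S316 n)"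
  then obtain F c where F: "F \<subseteq> S316 n" "\<forall>g\<in>F. c g \<in> polyring n" and p: "p = (\<Sum>g\<in>F. c g * g)"
    unfolding ideal_gen_def by auto
  have g: "g \<in> polyring n \<and> vanishes g" if "g \<in> F" for g
    using F that assms(2) S316_secant_ideal by blast
  have "p \<in> polyring n" unfolding p using F g by (auto intro!: polyring_sum polyring_mult)
  moreover have "evalp x p = 0" if "x \<in> secant_cone" for x
    unfolding p using g that
    by (simp add: unital_hom.hom_sum[OF unital_hom_evalp] unital_hom.hom_mult[OF unital_hom_evalp] vanishes_def)
  ultimately show "p \<in> secant_ideal n" by (auto simp: secant_ideal_def)
qed

end
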